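(* Let $S$ be a scheme and let $\mathcal{Q}$ and $\mathcal{Q}'$ be quaternion algebras over $S$, with reduced norms $\mathrm{Nrd}:\mathcal{Q}\to\mathcal{O}_S$ and $\mathrm{Nrd}':\mathcal{Q}'\to\mathcal{O}_S$. Then $\mathcal{Q}'$ is isomorphic to $\mathcal{Q}$ (as an $\mathcal{O}_S$-algebra) if and only if the quadratic $S$-forms $\mathrm{Nrd}$ and $\mathrm{Nrd}'$ are isometric.
   Context: A quaternion algebra over a scheme $S$ is an Azumaya $\mathcal{O}_S$-algebra of rank $4$; equivalently, an étale $S$-form of the matrix algebra $M_2(\mathcal{O}_S)$. Its reduced norm $\mathrm{Nrd}$ is the quadratic form obtained by descent (twisting) from the determinant $M_2(\mathcal{O}_S)\to\mathcal{O}_S$. *)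

theory Defs
  imports "HOL-Algebra.Algebra" "HOL-Algebra.Free_Abelian_Groups"
    "HOL-Algebra.Indexed_Polynomials" "HOL-Analysis.Abstract_Topology"
begin

section \<open>Sheaves and ringed spaces\<close>

definition is_sheaf ::
  "'p topology \<Rightarrow> ('p set \<Rightarrow> 'x set) \<Rightarrow> ('p set \<Rightarrow> 'p set \<Rightarrow> 'x \<Rightarrow> 'x) \<Rightarrow> bool" where
  "is_sheaf T F r \<longleftrightarrow>
     (\<forall>U V. openin T U \<and> openin T V \<and> V \<subseteq> U \<longrightarrow> r U V \<in> F U \<rightarrow> F V) \<and>
     (\<forall>U. openin T U \<longrightarrow> (\<forall>s\<in>F U. r U U s = s)) \<and>
     (\<forall>U V W. openin T U \<and> openin T V \<and> openin T W \<and> W \<subseteq> V \<and> V \<subseteq> U \<longrightarrow>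
        (\<forall>s\<in>F U. r V W (r U V s) = r U W s)) \<and>
     (\<forall>\<U>. (\<forall>U\<in>\<U>. openin T U) \<longrightarrow>
        (\<forall>s\<in>F (\<Union>\<U>). \<forall>t\<in>F (\<Union>\<U>).
           (\<forall>U\<in>\<U>. r (\<Union>\<U>) U s = r (\<Union>\<U>) U t) \<longrightarrow> s = t) \<and>
        (\<forall>\<sigma>. (\<forall>U\<in>\<U>. \<sigma> U \<in> F U) \<and>
             (\<forall>U\<in>\<U>. \<forall>V\<in>\<U>. r U (U \<inter> V) (\<sigma> U) = r V (U \<inter> V) (\<sigma> V)) \<longrightarrow>
           (\<exists>s\<in>F (\<Union>\<U>). \<forall>U\<in>\<U>. r (\<Union>\<U>) U s = \<sigma> U)))"

record ('p, 'r) ringed_space =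
  rs_top :: "'p topology"
  rs_sec :: "'p set \<Rightarrow> 'r ring"
  rs_res :: "'p set \<Rightarrow> 'p set \<Rightarrow> 'r \<Rightarrow> 'r"

definition ringed_space :: "('p, 'r) ringed_space \<Rightarrow> bool" where
  "ringed_space Z \<longleftrightarrow>
     is_sheaf (rs_top Z) (\<lambda>U. carrier (rs_sec Z U)) (rs_res Z) \<and>
     (\<forall>U. openin (rs_top Z) U \<longrightarrow> cring (rs_sec Z U)) \<and>
     (\<forall>U V. openin (rs_top Z) U \<and> openin (rs_top Z) V \<and> V \<subseteq> U \<longrightarrow>
        rs_res Z U V \<in> ring_hom (rs_sec Z U) (rs_sec Z V))"

definition open_subspace :: "('p, 'r) ringed_space \<Rightarrow> 'p set \<Rightarrow> ('p, 'r) ringed_space" where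
  "open_subspace Z U = Z\<lparr>rs_top := subtopology (rs_top Z) U\<rparr>"

definition ringed_space_isomorphic ::
  "('p, 'r) ringed_space \<Rightarrow> ('q, 's) ringed_space \<Rightarrow> bool" where
  "ringed_space_isomorphic Z Y \<longleftrightarrow>
     (\<exists>g \<psi>. homeomorphic_map (rs_top Z) (rs_top Y) g \<and>
        (let pre = (\<lambda>V. {x \<in> topspace (rs_top Z). g x \<in> V}) in
         (\<forall>V. openin (rs_top Y) V \<longrightarrow> \<psi> V \<in> ring_iso (rs_sec Y V) (rs_sec Z (pre V))) \<and>
         (\<forall>V W. openin (rs_top Y) V \<and> openin (rs_top Y) W \<and> W \<subseteq> V \<longrightarrow>
            (\<forall>s\<in>carrier (rs_sec Y V).
               \<psi> W (rs_res Y V W s) = rs_res Z (pre V) (pre W) (\<psi> V s)))))"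


section \<open>Affine schemes and schemes\<close>

definition loc_frac :: "'r ring \<Rightarrow> 'r set \<Rightarrow> 'r \<Rightarrow> 'r \<Rightarrow> ('r \<times> 'r) set" where
  "loc_frac R p a s =
     {(b, t). b \<in> carrier R \<and> t \<in> carrier R - p \<and>
        (\<exists>u\<in>carrier R - p. u \<otimes>\<^bsub>R\<^esub> (t \<otimes>\<^bsub>R\<^esub> a) = u \<otimes>\<^bsub>R\<^esub> (s \<otimes>\<^bsub>R\<^esub> b))}"

definition loc_ring :: "'r ring \<Rightarrow> 'r set \<Rightarrow> ('r \<times> 'r) set ring" where
  "loc_ring R p =
     \<lparr>carrier = {loc_frac R p a s |a s. a \<in> carrier R \<and> s \<in> carrier R - p},
      monoid.mult = (\<lambda>Z Y. \<Union>(a, s)\<in>Z. \<Union>(b, t)\<in>Y. loc_frac R p (a \<otimes>\<^bsub>R\<^esub> b) (s \<otimes>\<^bsub>R\<^esub> t)),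
      monoid.one = loc_frac R p \<one>\<^bsub>R\<^esub> \<one>\<^bsub>R\<^esub>,
      ring.zero = loc_frac R p \<zero>\<^bsub>R\<^esub> \<one>\<^bsub>R\<^esub>,
      ring.add = (\<lambda>Z Y. \<Union>(a, s)\<in>Z. \<Union>(b, t)\<in>Y.
               loc_frac R p (a \<otimes>\<^bsub>R\<^esub> t \<oplus>\<^bsub>R\<^esub> b \<otimes>\<^bsub>R\<^esub> s) (s \<otimes>\<^bsub>R\<^esub> t))\<rparr>"

definition prime_spectrum :: "'r ring \<Rightarrow> 'r set set" where
  "prime_spectrum R = {p. primeideal p R}"

definition zariski_topology :: "'r ring \<Rightarrow> 'r set topology" where
  "zariski_topology R =
     topology (\<lambda>V. \<exists>E\<subseteq>carrier R. V = {p \<in> prime_spectrum R. \<not> E \<subseteq> p})"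

definition spec_sec :: "'r ring \<Rightarrow> 'r set set \<Rightarrow> ('r set \<Rightarrow> ('r \<times> 'r) set) ring" where
  "spec_sec R V =
     \<lparr>carrier = {\<sigma> \<in> (\<Pi>\<^sub>E p\<in>V. carrier (loc_ring R p)).
        \<forall>p\<in>V. \<exists>W. openin (zariski_topology R) W \<and> p \<in> W \<and> W \<subseteq> V \<and>
          (\<exists>a\<in>carrier R. \<exists>f\<in>carrier R. \<forall>q\<in>W. f \<notin> q \<and> \<sigma> q = loc_frac R q a f)},
      monoid.mult = (\<lambda>\<sigma> \<tau>. \<lambda>p\<in>V. \<sigma> p \<otimes>\<^bsub>loc_ring R p\<^esub> \<tau> p),
      monoid.one = (\<lambda>p\<in>V. \<one>\<^bsub>loc_ring R p\<^esub>),
      ring.zero = (\<lambda>p\<in>V. \<zero>\<^bsub>loc_ring R p\<^esub>),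
      ring.add = (\<lambda>\<sigma> \<tau>. \<lambda>p\<in>V. \<sigma> p \<oplus>\<^bsub>loc_ring R p\<^esub> \<tau> p)\<rparr>"

definition Spec :: "'r ring \<Rightarrow> ('r set, 'r set \<Rightarrow> ('r \<times> 'r) set) ringed_space" where
  "Spec R = \<lparr>rs_top = zariski_topology R, rs_sec = spec_sec R, rs_res = (\<lambda>V W \<sigma>. restrict \<sigma> W)\<rparr>"

text \<open>
  An isomorphism of ringed spaces with a spectrum is an isomorphism of locally ringed spaces,
  so stalks need not be mentioned.  As the ring is recovered from its spectrum as the ring of
  global sections, it may be taken over the type of the sections of \<^term>\<open>Z\<close>.
\<close>
definition affine_open :: "('p, 'r) ringed_space \<Rightarrow> 'p set \<Rightarrow> bool" where
  "affine_open Z U \<longleftrightarrow> openin (rs_top Z) U \<and>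
     (\<exists>R :: 'r ring. cring R \<and> ringed_space_isomorphic (open_subspace Z U) (Spec R))"

definition is_scheme :: "('p, 'r) ringed_space \<Rightarrow> bool" where
  "is_scheme Z \<longleftrightarrow> ringed_space Z \<and> (\<forall>x\<in>topspace (rs_top Z). \<exists>U. affine_open Z U \<and> x \<in> U)"


section \<open>Tensor products\<close>

definition tensor_relators ::
  "'r ring \<Rightarrow> ('r, 'm) module \<Rightarrow> ('r, 'n) module \<Rightarrow> (('m \<times> 'n) \<Rightarrow>\<^sub>0 int) set" where
  "tensor_relators R M N =
     {frag_of (x \<oplus>\<^bsub>M\<^esub> y, z) - frag_of (x, z) - frag_of (y, z) |x y z.
        x \<in> carrier M \<and> y \<in> carrier M \<and> z \<in> carrier N} \<union>
     {frag_of (x, y \<oplus>\<^bsub>N\<^esub> z) - frag_of (x, y) - frag_of (x, z) |x y z.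
        x \<in> carrier M \<and> y \<in> carrier N \<and> z \<in> carrier N} \<union>
     {frag_of (a \<odot>\<^bsub>M\<^esub> x, y) - frag_of (x, a \<odot>\<^bsub>N\<^esub> y) |a x y.
        a \<in> carrier R \<and> x \<in> carrier M \<and> y \<in> carrier N}"

text \<open>The underlying abelian group, written multiplicatively as all quotient groups here are.\<close>
definition tensor_product ::
  "'r ring \<Rightarrow> ('r, 'm) module \<Rightarrow> ('r, 'n) module \<Rightarrow> (('m \<times> 'n) \<Rightarrow>\<^sub>0 int) set monoid" where
  "tensor_product R M N =
     (let F = free_Abelian_group (carrier M \<times> carrier N)
      in F Mod (generate F (tensor_relators R M N)))"

text \<open>
  The map out of the tensor product induced by a biadditive balanced map \<^term>\<open>\<beta>\<close>: the additive
  extension of \<^term>\<open>\<beta>\<close> to the free abelian group is constant on each coset.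
\<close>
definition tensor_lift ::
  "('x, 'y) ring_scheme \<Rightarrow> ('m \<times> 'n \<Rightarrow> 'x) \<Rightarrow> (('m \<times> 'n) \<Rightarrow>\<^sub>0 int) set \<Rightarrow> 'x" where
  "tensor_lift P \<beta> Z =
     the_elem ((\<lambda>z. \<Oplus>\<^bsub>P\<^esub>k\<in>Poly_Mapping.keys z. [Poly_Mapping.lookup z k] \<cdot>\<^bsub>P\<^esub> \<beta> k) ` Z)"

definition restrict_scalars :: "'a ring \<Rightarrow> ('r \<Rightarrow> 'a) \<Rightarrow> ('r, 'a) module" where
  "restrict_scalars A h =
     \<lparr>carrier = carrier A, monoid.mult = monoid.mult A, monoid.one = monoid.one A, ring.zero = ring.zero A, ring.add = ring.add A,
      module.smult = (\<lambda>r x. h r \<otimes>\<^bsub>A\<^esub> x)\<rparr>"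


section \<open>Etale ring maps\<close>

text \<open>The polynomial ring in the variables with index below \<^term>\<open>n\<close>.\<close>
definition mpoly_ring :: "'r ring \<Rightarrow> nat \<Rightarrow> (nat multiset \<Rightarrow> 'r) ring" where
  "mpoly_ring R n =
     \<lparr>carrier = ring.indexed_pset R {..<n} (carrier R),
      monoid.mult = (\<lambda>P Q m. \<Oplus>\<^bsub>R\<^esub>a\<in>{a. a \<subseteq># m}. P a \<otimes>\<^bsub>R\<^esub> Q (m - a)),
      monoid.one = ring.indexed_const R \<one>\<^bsub>R\<^esub>,
      ring.zero = ring.indexed_const R \<zero>\<^bsub>R\<^esub>,
      ring.add = ring.indexed_padd R\<rparr>"

definition finitely_presented :: "'r ring \<Rightarrow> 'a ring \<Rightarrow> ('r \<Rightarrow> 'a) \<Rightarrow> bool" where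
  "finitely_presented R A h \<longleftrightarrow>
     (\<exists>n F. finite F \<and> F \<subseteq> carrier (mpoly_ring R n) \<and>
        (let I = genideal (mpoly_ring R n) F in
         \<exists>g \<in> ring_iso (mpoly_ring R n Quot I) A.
           \<forall>r\<in>carrier R. g (I +>\<^bsub>mpoly_ring R n\<^esub> ring.indexed_const R r) = h r))"

text \<open>
  Testing flatness on the inclusions of ideals is equivalent to testing it on all injective maps
  of modules, and avoids quantifying over the types of the modules.
\<close>
definition flat_map :: "'r ring \<Rightarrow> 'a ring \<Rightarrow> ('r \<Rightarrow> 'a) \<Rightarrow> bool" where
  "flat_map R A h \<longleftrightarrow>
     (\<forall>I. ideal I R \<longrightarrow>
        inj_on (tensor_lift A (\<lambda>(i, s). h i \<otimes>\<^bsub>A\<^esub> s))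
          (carrier (tensor_product R ((restrict_scalars R id)\<lparr>carrier := I\<rparr>)
                                     (restrict_scalars A h))))"

definition derivation ::
  "'r ring \<Rightarrow> 'a ring \<Rightarrow> ('r \<Rightarrow> 'a) \<Rightarrow> ('a, 'm) module \<Rightarrow> ('a \<Rightarrow> 'm) \<Rightarrow> bool" where
  "derivation R A h M D \<longleftrightarrow>
     D \<in> carrier A \<rightarrow> carrier M \<and>
     (\<forall>x\<in>carrier A. \<forall>y\<in>carrier A. D (x \<oplus>\<^bsub>A\<^esub> y) = D x \<oplus>\<^bsub>M\<^esub> D y) \<and>
     (\<forall>x\<in>carrier A. \<forall>y\<in>carrier A. D (x \<otimes>\<^bsub>A\<^esub> y) = x \<odot>\<^bsub>M\<^esub> D y \<oplus>\<^bsub>M\<^esub> y \<odot>\<^bsub>M\<^esub> D x) \<and>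
     (\<forall>r\<in>carrier R. D (h r) = \<zero>\<^bsub>M\<^esub>)"

text \<open>
  This says that the module of Kaehler differentials vanishes.  The universal derivation takes
  values in a quotient of the free module on the symbols \<open>dx\<close>, that is, in cosets of finitely
  supported functions, whence the type of the modules \<^term>\<open>M\<close>.
\<close>
definition unramified_map :: "'r ring \<Rightarrow> 'a ring \<Rightarrow> ('r \<Rightarrow> 'a) \<Rightarrow> bool" where
  "unramified_map R A h \<longleftrightarrow>
     (\<forall>(M :: ('a, ('a \<Rightarrow> 'a) set) module) D. module A M \<and> derivation R A h M D \<longrightarrow>
        (\<forall>x\<in>carrier A. D x = \<zero>\<^bsub>M\<^esub>))"

definition etale_map :: "'r ring \<Rightarrow> 'a ring \<Rightarrow> ('r \<Rightarrow> 'a) \<Rightarrow> bool" where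
  "etale_map R A h \<longleftrightarrow> cring R \<and> cring A \<and> h \<in> ring_hom R A \<and>
     finitely_presented R A h \<and> flat_map R A h \<and> unramified_map R A h"

definition surjective_on_spectra :: "'r ring \<Rightarrow> 'a ring \<Rightarrow> ('r \<Rightarrow> 'a) \<Rightarrow> bool" where
  "surjective_on_spectra R A h \<longleftrightarrow>
     (\<forall>p\<in>prime_spectrum R. \<exists>P\<in>prime_spectrum A. p = {r \<in> carrier R. h r \<in> P})"


section \<open>Matrix algebras and splittings\<close>

text \<open>The quadruple \<open>(a, b, c, d)\<close> is the matrix with rows \<open>(a, b)\<close> and \<open>(c, d)\<close>.\<close>
definition mat2 :: "'a ring \<Rightarrow> ('a, 'a \<times> 'a \<times> 'a \<times> 'a) module" where
  "mat2 A =
     \<lparr>carrier = carrier A \<times> carrier A \<times> carrier A \<times> carrier A,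
      monoid.mult = (\<lambda>(a, b, c, d) (a', b', c', d').
        (a \<otimes>\<^bsub>A\<^esub> a' \<oplus>\<^bsub>A\<^esub> b \<otimes>\<^bsub>A\<^esub> c', a \<otimes>\<^bsub>A\<^esub> b' \<oplus>\<^bsub>A\<^esub> b \<otimes>\<^bsub>A\<^esub> d',
         c \<otimes>\<^bsub>A\<^esub> a' \<oplus>\<^bsub>A\<^esub> d \<otimes>\<^bsub>A\<^esub> c', c \<otimes>\<^bsub>A\<^esub> b' \<oplus>\<^bsub>A\<^esub> d \<otimes>\<^bsub>A\<^esub> d')),
      monoid.one = (\<one>\<^bsub>A\<^esub>, \<zero>\<^bsub>A\<^esub>, \<zero>\<^bsub>A\<^esub>, \<one>\<^bsub>A\<^esub>),
      ring.zero = (\<zero>\<^bsub>A\<^esub>, \<zero>\<^bsub>A\<^esub>, \<zero>\<^bsub>A\<^esub>, \<zero>\<^bsub>A\<^esub>),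
      ring.add = (\<lambda>(a, b, c, d) (a', b', c', d').
        (a \<oplus>\<^bsub>A\<^esub> a', b \<oplus>\<^bsub>A\<^esub> b', c \<oplus>\<^bsub>A\<^esub> c', d \<oplus>\<^bsub>A\<^esub> d')),
      module.smult = (\<lambda>s (a, b, c, d). (s \<otimes>\<^bsub>A\<^esub> a, s \<otimes>\<^bsub>A\<^esub> b, s \<otimes>\<^bsub>A\<^esub> c, s \<otimes>\<^bsub>A\<^esub> d))\<rparr>"

definition det2 :: "'a ring \<Rightarrow> 'a \<times> 'a \<times> 'a \<times> 'a \<Rightarrow> 'a" where
  "det2 A = (\<lambda>(a, b, c, d). a \<otimes>\<^bsub>A\<^esub> d \<ominus>\<^bsub>A\<^esub> b \<otimes>\<^bsub>A\<^esub> c)"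

text \<open>
  An isomorphism of \<open>A\<close>-algebras from the base change of \<open>B\<close> along \<open>h\<close> to the matrix algebra,
  given by its restriction \<open>\<phi>\<close> to \<open>B\<close>: it sends \<open>x \<otimes> s\<close> to \<open>s \<cdot> \<phi> x\<close>.
\<close>
definition splitting ::
  "'r ring \<Rightarrow> ('r, 'q) module \<Rightarrow> 'a ring \<Rightarrow> ('r \<Rightarrow> 'a) \<Rightarrow> ('q \<Rightarrow> 'a \<times> 'a \<times> 'a \<times> 'a) \<Rightarrow> bool" where
  "splitting R B A h \<phi> \<longleftrightarrow>
     \<phi> \<in> ring_hom B (mat2 A) \<and>
     (\<forall>r\<in>carrier R. \<forall>x\<in>carrier B. \<phi> (r \<odot>\<^bsub>B\<^esub> x) = h r \<odot>\<^bsub>mat2 A\<^esub> \<phi> x) \<and>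
     bij_betw (tensor_lift (mat2 A) (\<lambda>(x, s). s \<odot>\<^bsub>mat2 A\<^esub> \<phi> x))
       (carrier (tensor_product R B (restrict_scalars A h))) (carrier (mat2 A))"


section \<open>Quaternion algebras over a scheme\<close>

record ('p, 'r, 'q) alg_sheaf =
  al_sec :: "'p set \<Rightarrow> ('r, 'q) module"
  al_res :: "'p set \<Rightarrow> 'p set \<Rightarrow> 'q \<Rightarrow> 'q"

text \<open>The library's locale \<^locale>\<open>algebra\<close> is restricted to commutative algebras.\<close>
definition assoc_algebra :: "'r ring \<Rightarrow> ('r, 'q) module \<Rightarrow> bool" where
  "assoc_algebra R B \<longleftrightarrow> module R B \<and> ring B \<and>
     (\<forall>a\<in>carrier R. \<forall>x\<in>carrier B. \<forall>y\<in>carrier B.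
        (a \<odot>\<^bsub>B\<^esub> x) \<otimes>\<^bsub>B\<^esub> y = a \<odot>\<^bsub>B\<^esub> (x \<otimes>\<^bsub>B\<^esub> y) \<and>
        x \<otimes>\<^bsub>B\<^esub> (a \<odot>\<^bsub>B\<^esub> y) = a \<odot>\<^bsub>B\<^esub> (x \<otimes>\<^bsub>B\<^esub> y))"

definition sheaf_of_algebras :: "('p, 'r) ringed_space \<Rightarrow> ('p, 'r, 'q) alg_sheaf \<Rightarrow> bool" where
  "sheaf_of_algebras S Q \<longleftrightarrow>
     is_sheaf (rs_top S) (\<lambda>U. carrier (al_sec Q U)) (al_res Q) \<and>
     (\<forall>U. openin (rs_top S) U \<longrightarrow> assoc_algebra (rs_sec S U) (al_sec Q U)) \<and>
     (\<forall>U V. openin (rs_top S) U \<and> openin (rs_top S) V \<and> V \<subseteq> U \<longrightarrow>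
        al_res Q U V \<in> ring_hom (al_sec Q U) (al_sec Q V) \<and>
        (\<forall>a\<in>carrier (rs_sec S U). \<forall>x\<in>carrier (al_sec Q U).
           al_res Q U V (a \<odot>\<^bsub>al_sec Q U\<^esub> x) = rs_res S U V a \<odot>\<^bsub>al_sec Q V\<^esub> al_res Q U V x))"

definition locally_free_of_rank ::
  "('p, 'r) ringed_space \<Rightarrow> ('p, 'r, 'q) alg_sheaf \<Rightarrow> nat \<Rightarrow> bool" where
  "locally_free_of_rank S Q n \<longleftrightarrow>
     (\<forall>x\<in>topspace (rs_top S). \<exists>U e. openin (rs_top S) U \<and> x \<in> U \<and>
        e \<in> {..<n} \<rightarrow> carrier (al_sec Q U) \<and>
        (\<forall>V. openin (rs_top S) V \<and> V \<subseteq> U \<longrightarrow>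
           bij_betw (\<lambda>c. \<Oplus>\<^bsub>al_sec Q V\<^esub>i\<in>{..<n}. c i \<odot>\<^bsub>al_sec Q V\<^esub> al_res Q U V (e i))
             ({..<n} \<rightarrow>\<^sub>E carrier (rs_sec S V)) (carrier (al_sec Q V))))"

text \<open>
  An etale trivialization of \<open>Q\<close> over the affine open set \<open>U\<close>: a surjective etale map
  from the spectrum of \<open>A\<close> to \<open>U\<close>, and an isomorphism \<open>\<phi>\<close> of the pullback of \<open>Q\<close> with the
  matrix algebra.  As \<open>Q\<close> will be quasi-coherent, its pullback is the sheaf associated
  with the base change of \<open>Q(U)\<close>.
\<close>
definition etale_trivialization ::
  "('p, 'r) ringed_space \<Rightarrow> ('p, 'r, 'q) alg_sheaf \<Rightarrow> 'p set \<Rightarrow> 'a ring \<Rightarrow> ('r \<Rightarrow> 'a) \<Rightarrow>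
     ('q \<Rightarrow> 'a \<times> 'a \<times> 'a \<times> 'a) \<Rightarrow> bool" where
  "etale_trivialization S Q U A h \<phi> \<longleftrightarrow> affine_open S U \<and>
     etale_map (rs_sec S U) A h \<and> surjective_on_spectra (rs_sec S U) A h \<and>
     splitting (rs_sec S U) (al_sec Q U) A h \<phi>"

text \<open>
  An etale form of the algebra of matrices of size two.  Local freeness of rank four follows from
  etale descent for a quasi-coherent sheaf; it is stated because it ensures quasi-coherence.
  Up to isomorphism, every finitely presented algebra over a ring of type \<^typ>\<open>'r ring\<close> has
  elements of type \<^typ>\<open>(nat multiset \<Rightarrow> 'r) set\<close>, and every etale covering of \<open>S\<close> has a
  refinement of the kind used here.
\<close>
definition quaternion_algebra ::
  "('p, 'r) ringed_space \<Rightarrow> ('p, 'r, 'q) alg_sheaf \<Rightarrow> bool" where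
  "quaternion_algebra S Q \<longleftrightarrow> sheaf_of_algebras S Q \<and> locally_free_of_rank S Q 4 \<and>
     (\<forall>x\<in>topspace (rs_top S).
        \<exists>U (A :: (nat multiset \<Rightarrow> 'r) set ring) h \<phi>. x \<in> U \<and> etale_trivialization S Q U A h \<phi>)"

definition algebra_isomorphic ::
  "('p, 'r) ringed_space \<Rightarrow> ('p, 'r, 'q) alg_sheaf \<Rightarrow> ('p, 'r, 'q2) alg_sheaf \<Rightarrow> bool" where
  "algebra_isomorphic S Q Q' \<longleftrightarrow>
     (\<exists>f. (\<forall>U. openin (rs_top S) U \<longrightarrow>
             f U \<in> ring_iso (al_sec Q U) (al_sec Q' U) \<and>
             (\<forall>a\<in>carrier (rs_sec S U). \<forall>x\<in>carrier (al_sec Q U).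
                f U (a \<odot>\<^bsub>al_sec Q U\<^esub> x) = a \<odot>\<^bsub>al_sec Q' U\<^esub> f U x)) \<and>
          (\<forall>U V. openin (rs_top S) U \<and> openin (rs_top S) V \<and> V \<subseteq> U \<longrightarrow>
             (\<forall>x\<in>carrier (al_sec Q U). f V (al_res Q U V x) = al_res Q' U V (f U x))))"


section \<open>Quadratic forms and reduced norms\<close>

definition polar_form :: "'r ring \<Rightarrow> ('r, 'q) module \<Rightarrow> ('q \<Rightarrow> 'r) \<Rightarrow> 'q \<Rightarrow> 'q \<Rightarrow> 'r" where
  "polar_form R M q x y = q (x \<oplus>\<^bsub>M\<^esub> y) \<ominus>\<^bsub>R\<^esub> q x \<ominus>\<^bsub>R\<^esub> q y"

definition quadratic_map :: "'r ring \<Rightarrow> ('r, 'q) module \<Rightarrow> ('q \<Rightarrow> 'r) \<Rightarrow> bool" where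
  "quadratic_map R M q \<longleftrightarrow>
     q \<in> carrier M \<rightarrow> carrier R \<and>
     (\<forall>a\<in>carrier R. \<forall>x\<in>carrier M. q (a \<odot>\<^bsub>M\<^esub> x) = a \<otimes>\<^bsub>R\<^esub> a \<otimes>\<^bsub>R\<^esub> q x) \<and>
     (\<forall>x\<in>carrier M. \<forall>y\<in>carrier M. \<forall>z\<in>carrier M.
        polar_form R M q (x \<oplus>\<^bsub>M\<^esub> y) z = polar_form R M q x z \<oplus>\<^bsub>R\<^esub> polar_form R M q y z) \<and>
     (\<forall>a\<in>carrier R. \<forall>x\<in>carrier M. \<forall>y\<in>carrier M.
        polar_form R M q (a \<odot>\<^bsub>M\<^esub> x) y = a \<otimes>\<^bsub>R\<^esub> polar_form R M q x y)"

definition quadratic_form ::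
  "('p, 'r) ringed_space \<Rightarrow> ('p, 'r, 'q) alg_sheaf \<Rightarrow> ('p set \<Rightarrow> 'q \<Rightarrow> 'r) \<Rightarrow> bool" where
  "quadratic_form S Q N \<longleftrightarrow>
     (\<forall>U. openin (rs_top S) U \<longrightarrow> quadratic_map (rs_sec S U) (al_sec Q U) (N U)) \<and>
     (\<forall>U V. openin (rs_top S) U \<and> openin (rs_top S) V \<and> V \<subseteq> U \<longrightarrow>
        (\<forall>x\<in>carrier (al_sec Q U). N V (al_res Q U V x) = rs_res S U V (N U x)))"

text \<open>
  The form \<open>N\<close> is obtained by descent from the determinant along a trivializing etale covering.
  The base change of \<open>N\<close> is the unique quadratic form whose value at \<open>x \<otimes> 1\<close> is the image of
  \<open>N x\<close>, hence it equals the transported determinant as soon as the two agree at all \<open>x \<otimes> 1\<close>.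
  The reduced norm does not depend on the covering, so this condition determines \<open>N\<close> on all
  sections over open sets.
\<close>
definition reduced_norm ::
  "('p, 'r) ringed_space \<Rightarrow> ('p, 'r, 'q) alg_sheaf \<Rightarrow> ('p set \<Rightarrow> 'q \<Rightarrow> 'r) \<Rightarrow> bool" where
  "reduced_norm S Q N \<longleftrightarrow> quadratic_form S Q N \<and>
     (\<forall>x\<in>topspace (rs_top S).
        \<exists>U (A :: (nat multiset \<Rightarrow> 'r) set ring) h \<phi>. x \<in> U \<and> etale_trivialization S Q U A h \<phi> \<and>
          (\<forall>y\<in>carrier (al_sec Q U). det2 A (\<phi> y) = h (N U y)))"

definition isometric ::
  "('p, 'r) ringed_space \<Rightarrow> ('p, 'r, 'q) alg_sheaf \<Rightarrow> ('p set \<Rightarrow> 'q \<Rightarrow> 'r) \<Rightarrow>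
     ('p, 'r, 'q2) alg_sheaf \<Rightarrow> ('p set \<Rightarrow> 'q2 \<Rightarrow> 'r) \<Rightarrow> bool" where
  "isometric S Q N Q' N' \<longleftrightarrow>
     (\<exists>f. (\<forall>U. openin (rs_top S) U \<longrightarrow>
             bij_betw (f U) (carrier (al_sec Q U)) (carrier (al_sec Q' U)) \<and>
             (\<forall>x\<in>carrier (al_sec Q U). \<forall>y\<in>carrier (al_sec Q U).
                f U (x \<oplus>\<^bsub>al_sec Q U\<^esub> y) = f U x \<oplus>\<^bsub>al_sec Q' U\<^esub> f U y) \<and>
             (\<forall>a\<in>carrier (rs_sec S U). \<forall>x\<in>carrier (al_sec Q U).
                f U (a \<odot>\<^bsub>al_sec Q U\<^esub> x) = a \<odot>\<^bsub>al_sec Q' U\<^esub> f U x) \<and>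
             (\<forall>x\<in>carrier (al_sec Q U). N' U (f U x) = N U x)) \<and>
          (\<forall>U V. openin (rs_top S) U \<and> openin (rs_top S) V \<and> V \<subseteq> U \<longrightarrow>
             (\<forall>x\<in>carrier (al_sec Q U). f V (al_res Q U V x) = al_res Q' U V (f U x))))"

end

theory Submission
  imports Defs
begin

text \<open>
  The reduced norm of a quaternion algebra determines a trace, and the identities between norm,
  trace and product that hold for matrices hold locally, since they can be checked in an etale
  splitting.  Locally there are also sections \<open>a\<close>, \<open>b\<close>, \<open>c\<close> for which \<open>\<langle>[a, b], c\<rangle>\<close> is a unit, where
  \<open>\<langle>x, y\<rangle>\<close> is the polar form: this holds for a triple of matrices, and the pullback along a surjection
  of spectra detects vanishing at a point.  As \<open>[a, b]\<close> is orthogonal to \<open>1\<close>, \<open>a\<close> and \<open>b\<close>, such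
  sections form with \<open>1\<close> a basis, by Steinitz exchange over the local rings against a local basis of
  the sheaf.  So neither descent nor quasi-coherence is needed.

  Given an isometry \<open>f\<close>, put \<open>u = f 1\<close> and let \<open>g x\<close> be the conjugate of \<open>u\<close> times \<open>f x\<close>, an isometry
  that preserves \<open>1\<close>.  The alternating maps \<open>g (x y) - g y g x\<close> and \<open>[g x, g y]\<close> are proportional: the
  first is \<open>e\<close> times the second for a unique scalar \<open>e\<close>, and associativity forces \<open>e\<close> to be idempotent.
  By uniqueness the local \<open>e\<close> glue, and \<open>e g + (1 - e) g\<^sup>*\<close>, where \<open>g\<^sup>*\<close> is \<open>g\<close> followed by the conjugation,
  is an isomorphism of algebras.  Conversely the norm can be recovered from the algebra by comparing
  the quadratic equations satisfied by an element and its image.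
\<close>

section \<open>The tensor product and flatness\<close>

text \<open>The trilinear form \<open>tau x y z\<close>, the polar form at \<open>[x, y]\<close> and
  \<open>z\<close>, is alternating and vanishes when an argument is \<open>1\<close>, so it is a
  volume form on the rank three quotient of the algebra by its scalars. Any other such form is a
  multiple of it, which is where the scalar \<open>e\<close> comes from. Nothing is divided by two:
  in characteristic two the trace of \<open>1\<close> is zero and the elements of trace zero no
  longer complement the scalars, but a unit value of \<open>tau\<close> still makes the polar form
  nondegenerate.

  Injectivity of a splitting on the sections over an affine set is not established. Identities
  between scalars descend along the etale ring map, which is injective; an identity between sections
  is tested by pairing both sides with a frame. Hence the trace identities come before the frame and
  Cayley-Hamilton after it.

  The scalar \<open>e\<close> is a locally constant switch: \<open>1\<close> where the unital
  isometry is multiplicative, \<open>0\<close> where it reverses products. On a disconnected base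
  both may occur, so in general neither the isometry nor its composite with the conjugation is an
  isomorphism.\<close>

definition frag_lift :: "('x, 'y) ring_scheme \<Rightarrow> ('k \<Rightarrow> 'x) \<Rightarrow> ('k \<Rightarrow>\<^sub>0 int) \<Rightarrow> 'x" where
  "frag_lift P \<beta> z = (\<Oplus>\<^bsub>P\<^esub>k\<in>Poly_Mapping.keys z. [Poly_Mapping.lookup z k] \<cdot>\<^bsub>P\<^esub> \<beta> k)"

text \<open>The support of a sum can shrink by cancellation, so the values of
  \<open>frag_lift\<close> at two fragments and at their sum are compared over one common finite
  set; the extra terms have multiplicity zero.\<close>

lemma frag_lift_superset:
  assumes "abelian_group P" "\<beta> \<in> S \<rightarrow> carrier P" "Poly_Mapping.keys z \<subseteq> T" "T \<subseteq> S" "finite T"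
  shows "frag_lift P \<beta> z = (\<Oplus>\<^bsub>P\<^esub>k\<in>T. [Poly_Mapping.lookup z k] \<cdot>\<^bsub>P\<^esub> \<beta> k)"
proof -
  interpret abelian_group P by fact
  have "\<beta> k \<in> carrier P" if "k \<in> T" for k
    using assms that by auto
  moreover have "add_pow P (0::int) x = \<zero>\<^bsub>P\<^esub>" for x
    by (simp add: add_pow_def)
  ultimately show ?thesis
    unfolding frag_lift_def using assms(3,5)
    by (intro add.finprod_mono_neutral_cong_left) (auto simp: in_keys_iff)
qed

lemma frag_lift_hom:
  assumes "abelian_group P" "\<beta> \<in> S \<rightarrow> carrier P"
  shows "frag_lift P \<beta> \<in> hom (free_Abelian_group S) (add_monoid P)"
proof -
  interpret abelian_group P by fact
  have \<beta>: "\<beta> k \<in> carrier P" if "k \<in> S" for k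
    using assms that by auto
  show ?thesis
  proof (rule homI)
    fix z assume "z \<in> carrier (free_Abelian_group S)"
    then show "frag_lift P \<beta> z \<in> carrier (add_monoid P)"
      unfolding frag_lift_def by (auto intro!: add.finprod_closed \<beta>)
  next
    fix y z assume yz: "y \<in> carrier (free_Abelian_group S)" "z \<in> carrier (free_Abelian_group S)"
    let ?T = "Poly_Mapping.keys y \<union> Poly_Mapping.keys z"
    have T: "?T \<subseteq> S" "finite ?T" using yz by auto
    have B: "\<beta> k \<in> carrier P" if "k \<in> ?T" for k using that T \<beta> by auto
    have "frag_lift P \<beta> (y + z) =
        (\<Oplus>\<^bsub>P\<^esub>k\<in>?T. [Poly_Mapping.lookup y k] \<cdot>\<^bsub>P\<^esub> \<beta> k \<oplus>\<^bsub>P\<^esub> [Poly_Mapping.lookup z k] \<cdot>\<^bsub>P\<^esub> \<beta> k)"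
      unfolding frag_lift_superset[OF assms keys_add T(1,2)]
      by (rule finsum_cong') (auto simp: lookup_add add.int_pow_mult B)
    also have "\<dots> = frag_lift P \<beta> y \<oplus>\<^bsub>P\<^esub> frag_lift P \<beta> z"
      by (subst finsum_addf)
        (auto simp: B frag_lift_superset[OF assms _ T(1,2)])
    finally show "frag_lift P \<beta> (y \<otimes>\<^bsub>free_Abelian_group S\<^esub> z) =
        frag_lift P \<beta> y \<otimes>\<^bsub>add_monoid P\<^esub> frag_lift P \<beta> z"
      by simp
  qed
qed

lemma frag_lift_of:
  assumes "abelian_group P" "\<beta> k \<in> carrier P"
  shows "frag_lift P \<beta> (frag_of k) = \<beta> k"
proof -
  interpret abelian_group P by fact
  show ?thesis using assms(2) by (simp add: frag_lift_def add.int_pow_1)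
qed

text \<open>The hypotheses are closure and biadditivity rather than the module laws, so that an
  ideal, encoded as a record of the ring with its carrier shrunk, can be put in directly.\<close>

locale balanced_map =
  fixes R :: "'r ring" and M :: "('r, 'm) module" and N :: "('r, 'n) module"
    and P :: "('x, 'y) ring_scheme" and \<beta> :: "'m \<times> 'n \<Rightarrow> 'x"
  assumes P: "abelian_group P"
    and M_add: "\<And>x y. x \<in> carrier M \<Longrightarrow> y \<in> carrier M \<Longrightarrow> x \<oplus>\<^bsub>M\<^esub> y \<in> carrier M"
    and N_add: "\<And>x y. x \<in> carrier N \<Longrightarrow> y \<in> carrier N \<Longrightarrow> x \<oplus>\<^bsub>N\<^esub> y \<in> carrier N"
    and M_smult: "\<And>a x. a \<in> carrier R \<Longrightarrow> x \<in> carrier M \<Longrightarrow> a \<odot>\<^bsub>M\<^esub> x \<in> carrier M"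
    and N_smult: "\<And>a x. a \<in> carrier R \<Longrightarrow> x \<in> carrier N \<Longrightarrow> a \<odot>\<^bsub>N\<^esub> x \<in> carrier N"
    and closed: "\<And>x y. x \<in> carrier M \<Longrightarrow> y \<in> carrier N \<Longrightarrow> \<beta> (x, y) \<in> carrier P"
    and add_left: "\<And>x y z. x \<in> carrier M \<Longrightarrow> y \<in> carrier M \<Longrightarrow> z \<in> carrier N \<Longrightarrow>
      \<beta> (x \<oplus>\<^bsub>M\<^esub> y, z) = \<beta> (x, z) \<oplus>\<^bsub>P\<^esub> \<beta> (y, z)"
    and add_right: "\<And>x y z. x \<in> carrier M \<Longrightarrow> y \<in> carrier N \<Longrightarrow> z \<in> carrier N \<Longrightarrow>
      \<beta> (x, y \<oplus>\<^bsub>N\<^esub> z) = \<beta> (x, y) \<oplus>\<^bsub>P\<^esub> \<beta> (x, z)"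
    and balanced: "\<And>a x y. a \<in> carrier R \<Longrightarrow> x \<in> carrier M \<Longrightarrow> y \<in> carrier N \<Longrightarrow>
      \<beta> (a \<odot>\<^bsub>M\<^esub> x, y) = \<beta> (x, a \<odot>\<^bsub>N\<^esub> y)"
begin

abbreviation "F \<equiv> free_Abelian_group (carrier M \<times> carrier N)"
abbreviation "K \<equiv> generate F (tensor_relators R M N)"

sublocale P: abelian_group P by (rule P)

lemma \<beta>_funcset: "\<beta> \<in> carrier M \<times> carrier N \<rightarrow> carrier P"
  using closed by auto

sublocale lift: group_hom F "add_monoid P" "frag_lift P \<beta>"
  using frag_lift_hom[OF P \<beta>_funcset] P.add.is_group
  by (simp add: group_hom_def group_hom_axioms_def)

lemma lift_of: "x \<in> carrier M \<Longrightarrow> y \<in> carrier N \<Longrightarrow> frag_lift P \<beta> (frag_of (x, y)) = \<beta> (x, y)"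
  by (intro frag_lift_of P closed)

lemma lift_diff:
  assumes "y \<in> carrier F" "z \<in> carrier F"
  shows "frag_lift P \<beta> (y - z) = frag_lift P \<beta> y \<ominus>\<^bsub>P\<^esub> frag_lift P \<beta> z"
  using lift.hom_mult[of y "inv\<^bsub>F\<^esub> z"] lift.hom_inv[of z] assms
  by (simp add: a_inv_def a_minus_def)

lemma relators_carrier: "tensor_relators R M N \<subseteq> carrier F"
proof -
  have "frag_of p - frag_of q \<in> carrier F" if "p \<in> carrier M \<times> carrier N" "q \<in> carrier M \<times> carrier N"
    for p q
    using that keys_diff[of "frag_of p" "frag_of q"] by auto
  moreover have "frag_of p - frag_of q - frag_of r \<in> carrier F"
    if "p \<in> carrier M \<times> carrier N" "q \<in> carrier M \<times> carrier N" "r \<in> carrier M \<times> carrier N"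
    for p q r
    using that keys_diff[of "frag_of p" "frag_of q"] keys_diff[of "frag_of p - frag_of q" "frag_of r"]
    by fastforce
  ultimately show ?thesis
    unfolding tensor_relators_def
    by (auto simp del: carrier_free_Abelian_group_iff simp: M_add N_add M_smult N_smult)
qed

lemma lift_relator: "z \<in> tensor_relators R M N \<Longrightarrow> frag_lift P \<beta> z = \<zero>\<^bsub>P\<^esub>"
proof -
  have [simp]: "frag_of (x, y) \<in> carrier F" if "x \<in> carrier M" "y \<in> carrier N" for x y
    using that by simp
  have [simp]: "frag_of (x, y) - frag_of (x', y') \<in> carrier F"
    if "x \<in> carrier M" "y \<in> carrier N" "x' \<in> carrier M" "y' \<in> carrier N" for x y x' y'
    using that keys_diff[of "frag_of (x, y)" "frag_of (x', y')"] by auto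
  have [simp]: "x \<oplus>\<^bsub>P\<^esub> y \<ominus>\<^bsub>P\<^esub> x \<ominus>\<^bsub>P\<^esub> y = \<zero>\<^bsub>P\<^esub>" if "x \<in> carrier P" "y \<in> carrier P" for x y
    using that P.r_neg[of "x \<oplus>\<^bsub>P\<^esub> y"] by (simp add: P.minus_eq P.minus_add P.a_assoc)
  have [simp]: "x \<ominus>\<^bsub>P\<^esub> x = \<zero>\<^bsub>P\<^esub>" if "x \<in> carrier P" for x
    using that by (simp add: P.minus_eq P.r_neg)
  assume "z \<in> tensor_relators R M N"
  then show ?thesis
    unfolding tensor_relators_def
    by (auto simp del: carrier_free_Abelian_group_iff simp: lift_diff lift_of M_add N_add M_smult N_smult add_left add_right
        balanced closed)
qed

lemma lift_K: "z \<in> K \<Longrightarrow> frag_lift P \<beta> z = \<zero>\<^bsub>P\<^esub>"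
proof -
  have "tensor_relators R M N \<subseteq> kernel F (add_monoid P) (frag_lift P \<beta>)"
    using relators_carrier lift_relator
    by (auto simp del: carrier_free_Abelian_group_iff simp: kernel_def)
  then have "K \<subseteq> kernel F (add_monoid P) (frag_lift P \<beta>)"
    by (rule group.generate_subgroup_incl[OF group_free_Abelian_group _ lift.subgroup_kernel])
  then show "z \<in> K \<Longrightarrow> frag_lift P \<beta> z = \<zero>\<^bsub>P\<^esub>"
    by (auto simp: kernel_def)
qed

lemma K_subgroup: "subgroup K F"
  by (rule group.generate_is_subgroup[OF group_free_Abelian_group relators_carrier])

lemma carrier_tensor_product: "carrier (tensor_product R M N) = {K #>\<^bsub>F\<^esub> z |z. z \<in> carrier F}"
  by (auto simp: tensor_product_def Let_def FactGroup_def RCOSETS_def)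

text \<open>\<open>tensor_lift\<close> takes the unique element of the image of a coset, and this
  image is a singleton because \<open>K\<close> lies in the kernel.\<close>

lemma tensor_lift_coset:
  assumes "z \<in> carrier F"
  shows "tensor_lift P \<beta> (K #>\<^bsub>F\<^esub> z) = frag_lift P \<beta> z"
proof -
  have "frag_lift P \<beta> y = frag_lift P \<beta> z" if y: "y \<in> K #>\<^bsub>F\<^esub> z" for y
  proof -
    obtain k where k: "k \<in> K" "y = k \<otimes>\<^bsub>F\<^esub> z"
      using y by (auto simp: r_coset_def)
    have "k \<in> carrier F"
      using k(1) K_subgroup subgroup.mem_carrier by metis
    then show ?thesis
      using assms k lift_K[OF k(1)] lift.hom_mult[of k z] lift.hom_closed[OF assms] by simp
  qed
  moreover have "z \<in> K #>\<^bsub>F\<^esub> z"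
    using group.rcos_self[OF group_free_Abelian_group assms K_subgroup] .
  ultimately have "frag_lift P \<beta> ` (K #>\<^bsub>F\<^esub> z) = {frag_lift P \<beta> z}"
    by blast
  then show ?thesis
    by (simp add: tensor_lift_def frag_lift_def)
qed

end

text \<open>Induction over partial sums. It later turns surjectivity of a tensor lift into a
  spanning statement.\<close>

lemma frag_lift_in_subgroup:
  assumes "abelian_group P" "subgroup C (add_monoid P)" "\<And>k. k \<in> Poly_Mapping.keys z \<Longrightarrow> \<beta> k \<in> C"
  shows "frag_lift P \<beta> z \<in> C"
proof -
  interpret abelian_group P by fact
  interpret C: subgroup C "add_monoid P" by fact
  have "(\<Oplus>\<^bsub>P\<^esub>k\<in>T. [Poly_Mapping.lookup z k] \<cdot>\<^bsub>P\<^esub> \<beta> k) \<in> C"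
    if "finite T" "T \<subseteq> Poly_Mapping.keys z" for T
    using that
  proof (induction T rule: finite_induct)
    case empty
    then show ?case using C.one_closed by simp
  next
    case (insert k T)
    have *: "[Poly_Mapping.lookup z j] \<cdot>\<^bsub>P\<^esub> \<beta> j \<in> C" if "j \<in> insert k T" for j
      using that insert.prems assms(3) by (intro add.subgroup_int_pow_closed[OF assms(2)]) auto
    show ?case
      using insert * C.m_closed C.subset by (subst finsum_insert) (auto simp: subset_iff)
  qed
  then show ?thesis
    by (simp add: frag_lift_def)
qed

text \<open>A one-term case of the equational criterion: \<open>h r = 0\<close> says that
  \<open>r \<otimes> 1\<close> dies in \<open>A\<close>, hence already in the tensor product of the
  ideal \<open>(r)\<close> with \<open>A\<close>. If every annihilator of \<open>r\<close> landed in
  \<open>P\<close>, then sending \<open>(t r, y)\<close> to \<open>h t y\<close> modulo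
  \<open>P\<close> would be well defined and balanced, yet it takes \<open>(r, 1)\<close> to
  \<open>1\<close>, which is nonzero modulo a prime.\<close>

lemma flat_annihilator:
  assumes R: "cring R" and A: "cring A" and h: "h \<in> ring_hom R A" and flat: "flat_map R A h"
    and P: "primeideal P A" and r: "r \<in> carrier R" "h r = \<zero>\<^bsub>A\<^esub>"
  shows "\<exists>s\<in>carrier R. h s \<notin> P \<and> s \<otimes>\<^bsub>R\<^esub> r = \<zero>\<^bsub>R\<^esub>"
proof (rule ccontr)
  assume "\<not> ?thesis"
  then have ann: "h s \<in> P" if "s \<in> carrier R" "s \<otimes>\<^bsub>R\<^esub> r = \<zero>\<^bsub>R\<^esub>" for s
    using that by blast
  interpret R: cring R by fact
  interpret A: cring A by fact
  interpret h: ring_hom_cring R A h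
    using h by (simp add: ring_hom_cring_def ring_hom_cring_axioms_def R A)
  interpret P: primeideal P A by fact
  define I where "I = PIdl\<^bsub>R\<^esub> r"
  have I: "ideal I R" unfolding I_def by (rule R.cgenideal_ideal[OF r(1)])
  note I_add = additive_subgroup.a_closed[OF ideal.axioms(1)[OF I]] and I_mul = ideal.I_l_closed[OF I]
  have I_mult: "\<exists>t\<in>carrier R. i = t \<otimes>\<^bsub>R\<^esub> r" if "i \<in> I" for i
    using that by (auto simp: I_def cgenideal_def)
  \<comment> \<open>A multiplier is chosen for each element of the ideal. It is determined up to
    annihilators of \<open>r\<close>, an ambiguity that \<open>well\<close> absorbs.\<close>
  define t where "t i = (SOME t. t \<in> carrier R \<and> i = t \<otimes>\<^bsub>R\<^esub> r)" for i
  have t: "t i \<in> carrier R" "i = t i \<otimes>\<^bsub>R\<^esub> r" if "i \<in> I" for i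
    using someI_ex[of "\<lambda>t. t \<in> carrier R \<and> i = t \<otimes>\<^bsub>R\<^esub> r"] I_mult[OF that]
    unfolding t_def by blast+
  have I_carr: "i \<in> carrier R" if "i \<in> I" for i using additive_subgroup.a_Hcarr[OF ideal.axioms(1)[OF I] that] .
  let ?M = "(restrict_scalars R id)\<lparr>carrier := I\<rparr>" and ?N = "restrict_scalars A h"
  let ?q = "\<lambda>x. P +>\<^bsub>A\<^esub> x"
  have qeq: "?q x = ?q y" if "x \<in> carrier A" "y \<in> carrier A" "x \<ominus>\<^bsub>A\<^esub> y \<in> P" for x y
    using A.quotient_eq_iff_same_a_r_cos[OF P.is_ideal that(1,2)] that(3) by blast
  have well: "?q (h a \<otimes>\<^bsub>A\<^esub> y) = ?q (h b \<otimes>\<^bsub>A\<^esub> y)"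
    if "a \<in> carrier R" "b \<in> carrier R" "a \<otimes>\<^bsub>R\<^esub> r = b \<otimes>\<^bsub>R\<^esub> r" "y \<in> carrier A" for a b y
  proof (rule qeq)
    have "(a \<ominus>\<^bsub>R\<^esub> b) \<otimes>\<^bsub>R\<^esub> r = \<zero>\<^bsub>R\<^esub>"
      using that r by (simp add: R.minus_eq R.l_distr R.l_minus R.r_neg)
    then have "h a \<ominus>\<^bsub>A\<^esub> h b \<in> P"
      using ann[of "a \<ominus>\<^bsub>R\<^esub> b"] that by simp
    then have "(h a \<ominus>\<^bsub>A\<^esub> h b) \<otimes>\<^bsub>A\<^esub> y \<in> P"
      using that P.I_r_closed by simp
    also have "(h a \<ominus>\<^bsub>A\<^esub> h b) \<otimes>\<^bsub>A\<^esub> y = h a \<otimes>\<^bsub>A\<^esub> y \<ominus>\<^bsub>A\<^esub> h b \<otimes>\<^bsub>A\<^esub> y"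
      using that by (simp add: A.minus_eq A.l_distr A.l_minus)
    finally show "h a \<otimes>\<^bsub>A\<^esub> y \<ominus>\<^bsub>A\<^esub> h b \<otimes>\<^bsub>A\<^esub> y \<in> P" .
  qed (use that in auto)
  define \<gamma> where "\<gamma> = (\<lambda>(i, y). ?q (h (t i) \<otimes>\<^bsub>A\<^esub> y))"
  have \<gamma>: "\<gamma> (a \<otimes>\<^bsub>R\<^esub> r, y) = ?q (h a \<otimes>\<^bsub>A\<^esub> y)" if "a \<in> carrier R" "y \<in> carrier A" for a y
  proof -
    have *: "a \<otimes>\<^bsub>R\<^esub> r \<in> I" using that by (auto simp: I_def cgenideal_def)
    show ?thesis
      using well[OF t(1)[OF *] that(1) t(2)[OF *, symmetric] that(2)] by (simp add: \<gamma>_def)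
  qed
  have closedq: "?q x \<in> carrier (A Quot P)" if "x \<in> carrier A" for x
    using that by (auto simp: FactRing_def A_RCOSETS_def')
  have addq: "?q (x \<oplus>\<^bsub>A\<^esub> y) = ?q x \<oplus>\<^bsub>A Quot P\<^esub> ?q y" if "x \<in> carrier A" "y \<in> carrier A" for x y
    using that by (simp add: FactRing_def P.a_rcos_sum)
  have AQ: "abelian_group (A Quot P)"
    using P.quotient_is_ring ring.is_abelian_group by auto
  interpret g: balanced_map R ?M ?N "A Quot P" \<gamma>
  proof (rule balanced_map.intro[OF AQ]; (simp add: restrict_scalars_def I_add I_mul)?)
    fix x y assume "x \<in> I" "y \<in> carrier A"
    then show "\<gamma> (x, y) \<in> carrier (A Quot P)"
      unfolding \<gamma>_def using t by (auto intro!: closedq)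
  next
    fix x y z assume xyz: "x \<in> I" "y \<in> I" "z \<in> carrier A"
    have "\<gamma> (x \<oplus>\<^bsub>R\<^esub> y, z) = \<gamma> ((t x \<oplus>\<^bsub>R\<^esub> t y) \<otimes>\<^bsub>R\<^esub> r, z)"
      using t[OF xyz(1)] t[OF xyz(2)] r by (metis R.l_distr)
    then show "\<gamma> (x \<oplus>\<^bsub>R\<^esub> y, z) = \<gamma> (x, z) \<oplus>\<^bsub>A Quot P\<^esub> \<gamma> (y, z)"
      using t[OF xyz(1)] t[OF xyz(2)] xyz by (simp add: \<gamma>) (simp add: \<gamma>_def addq A.l_distr)
  next
    fix x y z assume "x \<in> I" "y \<in> carrier A" "z \<in> carrier A"
    then show "\<gamma> (x, y \<oplus>\<^bsub>A\<^esub> z) = \<gamma> (x, y) \<oplus>\<^bsub>A Quot P\<^esub> \<gamma> (x, z)"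
      using t by (simp add: \<gamma>_def A.r_distr addq)
  next
    fix a x y assume axy: "a \<in> carrier R" "x \<in> I" "y \<in> carrier A"
    have "\<gamma> (a \<otimes>\<^bsub>R\<^esub> x, y) = \<gamma> ((a \<otimes>\<^bsub>R\<^esub> t x) \<otimes>\<^bsub>R\<^esub> r, y)"
      using t[OF axy(2)] axy r by (metis R.m_assoc)
    then show "\<gamma> (a \<otimes>\<^bsub>R\<^esub> x, y) = \<gamma> (x, h a \<otimes>\<^bsub>A\<^esub> y)"
      using t[OF axy(2)] axy by (simp add: \<gamma>) (simp add: \<gamma>_def A.m_ac)
  qed
  interpret b: balanced_map R ?M ?N A "\<lambda>(i, s). h i \<otimes>\<^bsub>A\<^esub> s"
    by (rule balanced_map.intro[OF A.is_abelian_group]) (auto simp: restrict_scalars_def I_add I_mul I_carr A.l_distr A.r_distr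
        A.m_ac A.a_ac)
  have rI: "r \<in> I" unfolding I_def using R.cgenideal_self[OF r(1)] .
  have f: "frag_of (r, \<one>\<^bsub>A\<^esub>) \<in> carrier b.F" "\<one>\<^bsub>b.F\<^esub> \<in> carrier b.F"
    using rI by (auto simp: restrict_scalars_def)
  \<comment> \<open>Both \<open>r \<otimes> 1\<close> and the zero tensor have image
    \<open>h r = 0\<close>, so the injectivity in \<open>flat_map\<close> identifies their
    cosets.\<close>
  have "tensor_lift A (\<lambda>(i, s). h i \<otimes>\<^bsub>A\<^esub> s) (b.K #>\<^bsub>b.F\<^esub> frag_of (r, \<one>\<^bsub>A\<^esub>)) =
      tensor_lift A (\<lambda>(i, s). h i \<otimes>\<^bsub>A\<^esub> s) (b.K #>\<^bsub>b.F\<^esub> \<one>\<^bsub>b.F\<^esub>)"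
    using f b.lift.hom_one r b.lift_of[of r "\<one>\<^bsub>A\<^esub>"] rI
    by (simp only: b.tensor_lift_coset) (simp add: restrict_scalars_def)
  moreover have "inj_on (tensor_lift A (\<lambda>(i, s). h i \<otimes>\<^bsub>A\<^esub> s)) (carrier (tensor_product R ?M ?N))"
    using flat I by (simp add: flat_map_def)
  ultimately have "b.K #>\<^bsub>b.F\<^esub> frag_of (r, \<one>\<^bsub>A\<^esub>) = b.K #>\<^bsub>b.F\<^esub> \<one>\<^bsub>b.F\<^esub>"
    using f by (auto dest!: inj_onD simp: b.carrier_tensor_product)
  moreover have "frag_of (r, \<one>\<^bsub>A\<^esub>) \<in> b.K #>\<^bsub>b.F\<^esub> frag_of (r, \<one>\<^bsub>A\<^esub>)"
    using group.rcos_self[OF group_free_Abelian_group f(1) b.K_subgroup] .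
  ultimately have "frag_of (r, \<one>\<^bsub>A\<^esub>) \<in> b.K"
    using b.K_subgroup subgroup.subset[OF b.K_subgroup] by (auto simp: r_coset_def)
  \<comment> \<open>The relators do not mention the target group, so \<open>b.K\<close> is also the
    subgroup that the lift of \<open>\<gamma>\<close> kills.\<close>
  then have "\<gamma> (r, \<one>\<^bsub>A\<^esub>) = \<zero>\<^bsub>A Quot P\<^esub>"
    using g.lift_K g.lift_of[of r "\<one>\<^bsub>A\<^esub>"] rI by (simp add: restrict_scalars_def)
  moreover have "\<gamma> (r, \<one>\<^bsub>A\<^esub>) = ?q \<one>\<^bsub>A\<^esub>"
    using \<gamma>[of "\<one>\<^bsub>R\<^esub>" "\<one>\<^bsub>A\<^esub>"] r by simp
  ultimately have "?q \<one>\<^bsub>A\<^esub> = P"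
    by (simp add: FactRing_def)
  then have "\<one>\<^bsub>A\<^esub> \<in> P"
    using P.a_rcos_self[OF A.one_closed] by simp
  then show False
    using P.I_notcarr P.one_imp_carrier by blast
qed

section \<open>Stalks of schemes are local rings\<close>

text \<open>The operations of \<open>loc_ring\<close> are unions over all representatives of both
  classes. Such a union collapses once its members agree, and the two given pairs make it
  nonempty.\<close>

lemma UN_pairs_const:
  assumes "(a0, s0) \<in> Z" "(b0, t0) \<in> Y"
    and "\<And>a s b t. (a, s) \<in> Z \<Longrightarrow> (b, t) \<in> Y \<Longrightarrow> f a s b t = C"
  shows "(\<Union>(a, s)\<in>Z. \<Union>(b, t)\<in>Y. f a s b t) = C"
proof -
  have "(\<Union>y\<in>Y. f (fst x) (snd x) (fst y) (snd y)) = C" if "x \<in> Z" for x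
    using assms that by (intro SUP_eq_const) auto
  then have "(\<Union>x\<in>Z. \<Union>y\<in>Y. f (fst x) (snd x) (fst y) (snd y)) = C"
    using assms by (intro SUP_eq_const) auto
  then show ?thesis by (simp add: case_prod_beta)
qed

section \<open>Arithmetic of fractions at a prime\<close>

locale prime_localization = cring R + primeideal p R for R :: "'r ring" (structure) and p
begin

definition denom where "denom s \<longleftrightarrow> s \<in> carrier R \<and> s \<notin> p"

lemma denom_carrier [simp]: "denom s \<Longrightarrow> s \<in> carrier R"
  by (simp add: denom_def)

lemma denom_mult [simp]: "denom s \<Longrightarrow> denom t \<Longrightarrow> denom (s \<otimes> t)"
  using I_prime by (auto simp: denom_def)

lemma denom_one [simp]: "denom \<one>"
  using I_notcarr one_imp_carrier by (auto simp: denom_def)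

lemma loc_frac_iff:
  "(b, t) \<in> loc_frac R p a s \<longleftrightarrow>
     b \<in> carrier R \<and> denom t \<and> (\<exists>u. denom u \<and> u \<otimes> (t \<otimes> a) = u \<otimes> (s \<otimes> b))"
  by (auto simp: loc_frac_def denom_def)

lemma loc_frac_self: "a \<in> carrier R \<Longrightarrow> denom s \<Longrightarrow> (a, s) \<in> loc_frac R p a s"
  by (auto simp: loc_frac_iff intro: exI[of _ \<one>])

lemma loc_frac_subset:
  assumes "a \<in> carrier R" "denom s" "b \<in> carrier R" "denom t"
    and "denom u" "u \<otimes> (t \<otimes> a) = u \<otimes> (s \<otimes> b)"
  shows "loc_frac R p b t \<subseteq> loc_frac R p a s"
proof clarify
  fix c w assume "(c, w) \<in> loc_frac R p b t"
  then obtain v where v: "c \<in> carrier R" "denom w" "denom v" "v \<otimes> (w \<otimes> b) = v \<otimes> (t \<otimes> c)"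
    by (auto simp: loc_frac_iff)
  \<comment> \<open>Besides the two witnesses \<open>u\<close> and \<open>v\<close>, the middle
    denominator \<open>t\<close> goes into the multiplier, since it cannot be cancelled in a ring
    with zero divisors.\<close>
  have "(u \<otimes> v \<otimes> t) \<otimes> (w \<otimes> a) = (v \<otimes> w) \<otimes> (u \<otimes> (t \<otimes> a))"
    using assms(1-5) v(1-3) by (simp add: m_ac)
  also have "\<dots> = (u \<otimes> s) \<otimes> (v \<otimes> (w \<otimes> b))"
    using assms(1-5) v(1-3) unfolding assms(6) by (simp add: m_ac)
  also have "\<dots> = (u \<otimes> v \<otimes> t) \<otimes> (s \<otimes> c)"
    using assms(1-5) v(1-3) unfolding v(4) by (simp add: m_ac)
  finally show "(c, w) \<in> loc_frac R p a s"
    using assms(2,4,5) v(1-3) by (auto simp: loc_frac_iff intro!: exI[of _ "u \<otimes> v \<otimes> t"])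
qed

lemma loc_frac_eqI:
  assumes "a \<in> carrier R" "denom s" "b \<in> carrier R" "denom t"
    and "denom u" "u \<otimes> (t \<otimes> a) = u \<otimes> (s \<otimes> b)"
  shows "loc_frac R p b t = loc_frac R p a s"
  using loc_frac_subset[OF assms] loc_frac_subset[OF assms(3,4,1,2,5) assms(6)[symmetric]]
  by blast

lemma loc_frac_mult:
  assumes "a \<in> carrier R" "denom s" "b \<in> carrier R" "denom t"
  shows "loc_frac R p a s \<otimes>\<^bsub>loc_ring R p\<^esub> loc_frac R p b t = loc_frac R p (a \<otimes> b) (s \<otimes> t)"
proof -
  have "loc_frac R p (a' \<otimes> b') (s' \<otimes> t') = loc_frac R p (a \<otimes> b) (s \<otimes> t)"
    if as: "(a', s') \<in> loc_frac R p a s" and bt: "(b', t') \<in> loc_frac R p b t" for a' s' b' t'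
  proof -
    obtain u where u: "a' \<in> carrier R" "denom s'" "denom u" "u \<otimes> (s' \<otimes> a) = u \<otimes> (s \<otimes> a')"
      using as by (auto simp: loc_frac_iff)
    obtain v where v: "b' \<in> carrier R" "denom t'" "denom v" "v \<otimes> (t' \<otimes> b) = v \<otimes> (t \<otimes> b')"
      using bt by (auto simp: loc_frac_iff)
    have "(u \<otimes> v) \<otimes> ((s' \<otimes> t') \<otimes> (a \<otimes> b)) = (u \<otimes> (s' \<otimes> a)) \<otimes> (v \<otimes> (t' \<otimes> b))"
      using assms u(1-3) v(1-3) by (simp add: m_ac)
    also have "\<dots> = (u \<otimes> v) \<otimes> ((s \<otimes> t) \<otimes> (a' \<otimes> b'))"
      unfolding u(4) v(4) using assms u(1-3) v(1-3) by (simp add: m_ac)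
    finally show ?thesis
      using assms u v by (intro loc_frac_eqI[of _ _ _ _ "u \<otimes> v"]) auto
  qed
  from UN_pairs_const[OF loc_frac_self[OF assms(1,2)] loc_frac_self[OF assms(3,4)],
      of "\<lambda>a s b t. loc_frac R p (a \<otimes> b) (s \<otimes> t)", OF this]
  show ?thesis by (simp add: loc_ring_def)
qed

lemma loc_frac_add:
  assumes "a \<in> carrier R" "denom s" "b \<in> carrier R" "denom t"
  shows "loc_frac R p a s \<oplus>\<^bsub>loc_ring R p\<^esub> loc_frac R p b t =
    loc_frac R p (a \<otimes> t \<oplus> b \<otimes> s) (s \<otimes> t)"
proof -
  have "loc_frac R p (a' \<otimes> t' \<oplus> b' \<otimes> s') (s' \<otimes> t') = loc_frac R p (a \<otimes> t \<oplus> b \<otimes> s) (s \<otimes> t)"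
    if as: "(a', s') \<in> loc_frac R p a s" and bt: "(b', t') \<in> loc_frac R p b t" for a' s' b' t'
  proof -
    obtain u where u: "a' \<in> carrier R" "denom s'" "denom u" "u \<otimes> (s' \<otimes> a) = u \<otimes> (s \<otimes> a')"
      using as by (auto simp: loc_frac_iff)
    obtain v where v: "b' \<in> carrier R" "denom t'" "denom v" "v \<otimes> (t' \<otimes> b) = v \<otimes> (t \<otimes> b')"
      using bt by (auto simp: loc_frac_iff)
    have "(u \<otimes> v) \<otimes> ((s' \<otimes> t') \<otimes> (a \<otimes> t \<oplus> b \<otimes> s)) =
        (v \<otimes> t' \<otimes> t) \<otimes> (u \<otimes> (s' \<otimes> a)) \<oplus> (u \<otimes> s' \<otimes> s) \<otimes> (v \<otimes> (t' \<otimes> b))"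
      using assms u(1-3) v(1-3) by (simp add: m_ac r_distr)
    also have "\<dots> = (u \<otimes> v) \<otimes> ((s \<otimes> t) \<otimes> (a' \<otimes> t' \<oplus> b' \<otimes> s'))"
      unfolding u(4) v(4) using assms u(1-3) v(1-3) by (simp add: m_ac r_distr)
    finally show ?thesis
      using assms u v by (intro loc_frac_eqI[of _ _ _ _ "u \<otimes> v"]) auto
  qed
  from UN_pairs_const[OF loc_frac_self[OF assms(1,2)] loc_frac_self[OF assms(3,4)],
      of "\<lambda>a s b t. loc_frac R p (a \<otimes> t \<oplus> b \<otimes> s) (s \<otimes> t)", OF this]
  show ?thesis by (simp add: loc_ring_def)
qed

lemma loc_frac_in_carrier: "a \<in> carrier R \<Longrightarrow> denom s \<Longrightarrow> loc_frac R p a s \<in> carrier (loc_ring R p)"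
  by (auto simp: loc_ring_def denom_def)

lemma loc_one: "\<one>\<^bsub>loc_ring R p\<^esub> = loc_frac R p \<one> \<one>"
  by (simp add: loc_ring_def)

lemma loc_zero: "\<zero>\<^bsub>loc_ring R p\<^esub> = loc_frac R p \<zero> \<one>"
  by (simp add: loc_ring_def)

text \<open>If \<open>a / s = 1\<close> then \<open>u s = u a\<close> for some denominator
  \<open>u\<close>; the left side avoids \<open>p\<close> and the right side lies in it.\<close>

lemma loc_frac_not_one:
  assumes "a \<in> p" "denom s"
  shows "loc_frac R p a s \<noteq> \<one>\<^bsub>loc_ring R p\<^esub>"
proof
  assume eq: "loc_frac R p a s = \<one>\<^bsub>loc_ring R p\<^esub>"
  have a: "a \<in> carrier R" using assms(1) a_subset by blast
  have "(a, s) \<in> loc_frac R p \<one> \<one>"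
    using loc_frac_self[OF a assms(2)] eq by (simp add: loc_one)
  then obtain u where u: "denom u" "u \<otimes> (s \<otimes> \<one>) = u \<otimes> (\<one> \<otimes> a)"
    by (auto simp: loc_frac_iff)
  have "denom (u \<otimes> s)" using u(1) assms by simp
  moreover have "u \<otimes> s \<in> p"
    using u a assms I_l_closed by (simp add: denom_def)
  ultimately show False by (simp add: denom_def)
qed

end

lemma prime_localizationI: "cring R \<Longrightarrow> p \<in> prime_spectrum R \<Longrightarrow> prime_localization R p"
  by (simp add: prime_localization_def prime_spectrum_def)

lemma prime_spectrum_mult:
  assumes "cring R" "p \<in> prime_spectrum R" "a \<in> carrier R" "b \<in> carrier R"
  shows "a \<otimes>\<^bsub>R\<^esub> b \<in> p \<longleftrightarrow> a \<in> p \<or> b \<in> p"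
proof -
  interpret prime_localization R p using assms(1,2) by (rule prime_localizationI)
  show ?thesis using I_prime[OF assms(3,4)] I_l_closed[of b a] I_r_closed[of a b] assms(3,4) by auto
qed

text \<open>\<open>topology\<close> is meaningful only on predicates that satisfy the axioms, so
  these come first. For an intersection the equations are multiplied, and primality separates the
  factors again.\<close>

lemma openin_zariski:
  assumes "cring R"
  shows "openin (zariski_topology R) V \<longleftrightarrow>
    (\<exists>E\<subseteq>carrier R. V = {p \<in> prime_spectrum R. \<not> E \<subseteq> p})"
proof -
  let ?P = "\<lambda>V. \<exists>E\<subseteq>carrier R. V = {p \<in> prime_spectrum R. \<not> E \<subseteq> p}"
  have "istopology ?P"
    unfolding istopology_def
  proof (intro conjI allI impI)
    fix V W assume "?P V" "?P W"
    then obtain E F where EF: "E \<subseteq> carrier R" "V = {p \<in> prime_spectrum R. \<not> E \<subseteq> p}"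
      "F \<subseteq> carrier R" "W = {p \<in> prime_spectrum R. \<not> F \<subseteq> p}" by blast
    let ?G = "{a \<otimes>\<^bsub>R\<^esub> b |a b. a \<in> E \<and> b \<in> F}"
    have "?G \<subseteq> carrier R"
      using EF assms by (auto intro!: monoid.m_closed cring.axioms ring.axioms simp: cring_def ring_def)
    moreover have "V \<inter> W = {p \<in> prime_spectrum R. \<not> ?G \<subseteq> p}"
    proof -
      have "\<not> ?G \<subseteq> p \<longleftrightarrow> \<not> E \<subseteq> p \<and> \<not> F \<subseteq> p" if "p \<in> prime_spectrum R" for p
      proof -
        have "a \<otimes>\<^bsub>R\<^esub> b \<in> p \<longleftrightarrow> a \<in> p \<or> b \<in> p" if "a \<in> E" "b \<in> F" for a b
          using prime_spectrum_mult[OF assms \<open>p \<in> _\<close>, of a b] that EF by auto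
        then show ?thesis by blast
      qed
      then show ?thesis using EF by blast
    qed
    ultimately show "?P (V \<inter> W)" by blast
  next
    fix \<K> assume *: "\<forall>K\<in>\<K>. ?P K"
    \<comment> \<open>All equation sets that define some member of the family are united, which
      avoids choosing one for each member.\<close>
    let ?G = "\<Union>{E. E \<subseteq> carrier R \<and> {p \<in> prime_spectrum R. \<not> E \<subseteq> p} \<in> \<K>}"
    have "\<Union>\<K> = {p \<in> prime_spectrum R. \<not> ?G \<subseteq> p}"
    proof (intro equalityI subsetI)
      fix p assume "p \<in> \<Union>\<K>"
      then obtain K where "K \<in> \<K>" "p \<in> K" by blast
      moreover from this obtain E where "E \<subseteq> carrier R" "K = {p \<in> prime_spectrum R. \<not> E \<subseteq> p}"
        using bspec[OF * \<open>K \<in> \<K>\<close>] by blast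
      ultimately show "p \<in> {p \<in> prime_spectrum R. \<not> ?G \<subseteq> p}" by blast
    qed blast
    moreover have "?G \<subseteq> carrier R" by blast
    ultimately show "?P (\<Union>\<K>)" by (intro exI[of _ ?G] conjI)
  qed
  then show ?thesis
    by (simp add: zariski_topology_def)
qed

lemma topspace_zariski:
  assumes "cring R" shows "topspace (zariski_topology R) = prime_spectrum R"
proof
  show "topspace (zariski_topology R) \<subseteq> prime_spectrum R"
    using openin_topspace[of "zariski_topology R"] unfolding openin_zariski[OF assms] by blast
  have "prime_spectrum R = {p \<in> prime_spectrum R. \<not> {\<one>\<^bsub>R\<^esub>} \<subseteq> p}"
    using prime_localization.denom_one[OF prime_localizationI[OF assms]]
    by (auto simp: prime_localization.denom_def[OF prime_localizationI[OF assms]])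
  moreover have "{\<one>\<^bsub>R\<^esub>} \<subseteq> carrier R"
    using assms by (simp add: cring_def ring_def monoid.one_closed)
  ultimately have "openin (zariski_topology R) (prime_spectrum R)"
    unfolding openin_zariski[OF assms] by blast
  then show "prime_spectrum R \<subseteq> topspace (zariski_topology R)"
    by (rule openin_subset)
qed

lemma openin_zariski_basic:
  assumes "cring R" "a \<in> carrier R"
  shows "openin (zariski_topology R) {p \<in> prime_spectrum R. a \<notin> p}"
  unfolding openin_zariski[OF assms(1)] using assms(2) by (intro exI[of _ "{a}"]) auto

section \<open>Sections over open subsets of a spectrum\<close>

definition locally_frac :: "'r ring \<Rightarrow> 'r set set \<Rightarrow> ('r set \<Rightarrow> ('r \<times> 'r) set) \<Rightarrow> bool" where
  "locally_frac R V \<xi> \<longleftrightarrow> (\<forall>p\<in>V. \<exists>W. openin (zariski_topology R) W \<and> p \<in> W \<and> W \<subseteq> V \<and>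
     (\<exists>a\<in>carrier R. \<exists>f\<in>carrier R. \<forall>q\<in>W. f \<notin> q \<and> \<xi> q = loc_frac R q a f))"

lemma locally_frac_iff:
  "locally_frac R V \<xi> \<longleftrightarrow> (\<forall>p\<in>V. \<exists>W a f. openin (zariski_topology R) W \<and> p \<in> W \<and> W \<subseteq> V \<and>
     a \<in> carrier R \<and> f \<in> carrier R \<and> (\<forall>q\<in>W. f \<notin> q \<and> \<xi> q = loc_frac R q a f))"
  by (simp add: locally_frac_def Bex_def)

lemma locally_fracI:
  assumes "\<And>p. p \<in> V \<Longrightarrow> \<exists>W a f. openin (zariski_topology R) W \<and> p \<in> W \<and> W \<subseteq> V \<and>
     a \<in> carrier R \<and> f \<in> carrier R \<and> (\<forall>q\<in>W. f \<notin> q) \<and> (\<forall>q\<in>W. \<xi> q = loc_frac R q a f)"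
  shows "locally_frac R V \<xi>"
  unfolding locally_frac_iff ball_conj_distrib using assms by simp

lemma locally_fracE:
  assumes "locally_frac R V \<xi>" "p \<in> V"
  obtains W a f where "openin (zariski_topology R) W" "p \<in> W" "W \<subseteq> V"
     "a \<in> carrier R" "f \<in> carrier R" "\<forall>q\<in>W. f \<notin> q"
     "\<forall>q\<in>W. \<xi> q = loc_frac R q a f"
  using assms unfolding locally_frac_iff by meson

locale spec_ring = cring R for R :: "'r ring" (structure)
begin

abbreviation "T \<equiv> zariski_topology R"

lemma is_cr: "cring R" by (rule is_cring)

lemma open_prime: "openin T V \<Longrightarrow> q \<in> V \<Longrightarrow> q \<in> prime_spectrum R"
  using openin_subset topspace_zariski[OF is_cr] by blast

lemma open_loc: "openin T V \<Longrightarrow> q \<in> V \<Longrightarrow> prime_localization R q"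
  using open_prime prime_localizationI[OF is_cr] by blast

lemma loc_denom: "openin T V \<Longrightarrow> q \<in> V \<Longrightarrow> prime_localization.denom R q s \<longleftrightarrow> s \<in> carrier R \<and> s \<notin> q"
  using prime_localization.denom_def[OF open_loc] .

text \<open>A function that is locally a fraction automatically takes values in the localizations,
  so \<open>extensional\<close> can replace the dependent product.\<close>

lemma carrier_spec_sec:
  assumes "openin T V"
  shows "carrier (spec_sec R V) = {\<xi> \<in> extensional V. locally_frac R V \<xi>}"
proof -
  have "\<xi> p \<in> carrier (loc_ring R p)" if fr: "locally_frac R V \<xi>" and p: "p \<in> V" for \<xi> p
  proof -
    interpret p: prime_localization R p by (rule open_loc[OF assms p])
    obtain W a f where "p \<in> W" "a \<in> carrier R" "f \<in> carrier R" "\<forall>q\<in>W. f \<notin> q \<and> \<xi> q = loc_frac R q a f"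
      using fr p unfolding locally_frac_iff by meson
    then show ?thesis
      using p.loc_frac_in_carrier[of a f] by (simp add: p.denom_def)
  qed
  then have "{\<xi> \<in> extensional V. locally_frac R V \<xi>} =
      {\<xi> \<in> (\<Pi>\<^sub>E p\<in>V. carrier (loc_ring R p)). locally_frac R V \<xi>}"
    by (auto simp: PiE_def)
  then show ?thesis
    by (simp add: spec_sec_def locally_frac_def)
qed

lemma locally_frac_subset:
  assumes "openin T V" "openin T W" "W \<subseteq> V" "locally_frac R V \<xi>"
  shows "locally_frac R W (restrict \<xi> W)"
proof (rule locally_fracI)
  fix p assume "p \<in> W"
  then have "p \<in> V" using assms by blast
  obtain W1 a f where W1: "openin T W1" "p \<in> W1" "W1 \<subseteq> V" "a \<in> carrier R" "f \<in> carrier R"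
    "\<forall>q\<in>W1. f \<notin> q" "\<forall>q\<in>W1. \<xi> q = loc_frac R q a f"
    by (rule locally_fracE[OF assms(4) \<open>p \<in> V\<close>])
  show "\<exists>W1 a f. openin T W1 \<and> p \<in> W1 \<and> W1 \<subseteq> W \<and> a \<in> carrier R \<and> f \<in> carrier R \<and>
      (\<forall>q\<in>W1. f \<notin> q) \<and> (\<forall>q\<in>W1. restrict \<xi> W q = loc_frac R q a f)"
    by (rule exI[of _ "W1 \<inter> W"], rule exI[of _ a], rule exI[of _ f])
      (use W1 \<open>p \<in> W\<close> assms in auto)
qed

lemma restrict_spec_sec:
  assumes "openin T V" "openin T W" "W \<subseteq> V" "\<xi> \<in> carrier (spec_sec R V)"
  shows "restrict \<xi> W \<in> carrier (spec_sec R W)"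
  using locally_frac_subset[OF assms(1-3)] assms by (simp add: carrier_spec_sec)

text \<open>Serves sums and products at once: both have the product of the denominators as
  denominator, \<open>F\<close> is the operation in the localizations and \<open>G\<close> the
  resulting numerator.\<close>

lemma locally_frac_binop:
  assumes V: "openin T V" and \<xi>: "locally_frac R V \<xi>" and \<zeta>: "locally_frac R V \<zeta>"
    and op: "\<And>a f b g q. a \<in> carrier R \<Longrightarrow> f \<in> carrier R \<Longrightarrow> f \<notin> q \<Longrightarrow> b \<in> carrier R \<Longrightarrow>
      g \<in> carrier R \<Longrightarrow> g \<notin> q \<Longrightarrow> q \<in> V \<Longrightarrow>
      F q (loc_frac R q a f) (loc_frac R q b g) = loc_frac R q (G a f b g) (f \<otimes> g)"
    and closed: "\<And>a f b g. a \<in> carrier R \<Longrightarrow> f \<in> carrier R \<Longrightarrow> b \<in> carrier R \<Longrightarrow>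
      g \<in> carrier R \<Longrightarrow> G a f b g \<in> carrier R"
  shows "locally_frac R V (\<lambda>q\<in>V. F q (\<xi> q) (\<zeta> q))"
proof (rule locally_fracI)
  fix p assume p: "p \<in> V"
  obtain W1 a f where W1: "openin T W1" "p \<in> W1" "W1 \<subseteq> V" "a \<in> carrier R" "f \<in> carrier R"
    "\<forall>q\<in>W1. f \<notin> q" "\<forall>q\<in>W1. \<xi> q = loc_frac R q a f"
    by (rule locally_fracE[OF \<xi> p])
  obtain W2 b g where W2: "openin T W2" "p \<in> W2" "W2 \<subseteq> V" "b \<in> carrier R" "g \<in> carrier R"
    "\<forall>q\<in>W2. g \<notin> q" "\<forall>q\<in>W2. \<zeta> q = loc_frac R q b g"
    by (rule locally_fracE[OF \<zeta> p])
  have "\<forall>q\<in>W1 \<inter> W2. f \<otimes> g \<notin> q \<and>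
      (\<lambda>q\<in>V. F q (\<xi> q) (\<zeta> q)) q = loc_frac R q (G a f b g) (f \<otimes> g)"
  proof
    fix q assume q: "q \<in> W1 \<inter> W2"
    then have "f \<otimes> g \<notin> q"
      using prime_spectrum_mult[OF is_cr open_prime[OF V], of q f g] W1 W2 by blast
    moreover have "F q (loc_frac R q a f) (loc_frac R q b g) = loc_frac R q (G a f b g) (f \<otimes> g)"
      using q W1 W2 by (intro op) auto
    ultimately show "f \<otimes> g \<notin> q \<and>
        (\<lambda>q\<in>V. F q (\<xi> q) (\<zeta> q)) q = loc_frac R q (G a f b g) (f \<otimes> g)"
      using q W1 W2 by auto
  qed
  then show "\<exists>W1 a f. openin T W1 \<and> p \<in> W1 \<and> W1 \<subseteq> V \<and> a \<in> carrier R \<and> f \<in> carrier R \<and>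
      (\<forall>q\<in>W1. f \<notin> q) \<and> (\<forall>q\<in>W1. (\<lambda>q\<in>V. F q (\<xi> q) (\<zeta> q)) q = loc_frac R q a f)"
    using W1(1-5) W2(1-5) closed[of a f b g]
    by - (rule exI[of _ "W1 \<inter> W2"], rule exI[of _ "G a f b g"], rule exI[of _ "f \<otimes> g"], auto)
qed

lemma mult_spec_sec:
  assumes "openin T V" "\<xi> \<in> carrier (spec_sec R V)" "\<zeta> \<in> carrier (spec_sec R V)"
  shows "\<xi> \<otimes>\<^bsub>spec_sec R V\<^esub> \<zeta> \<in> carrier (spec_sec R V)"
proof -
  have "locally_frac R V (\<lambda>q\<in>V. \<xi> q \<otimes>\<^bsub>loc_ring R q\<^esub> \<zeta> q)"
    using assms by (intro locally_frac_binop[where G = "\<lambda>a f b g. a \<otimes> b"])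
      (auto simp: carrier_spec_sec prime_localization.loc_frac_mult[OF open_loc[OF assms(1)]] loc_denom)
  then show ?thesis
    unfolding carrier_spec_sec[OF assms(1)] by (simp add: spec_sec_def)
qed

lemma add_spec_sec:
  assumes "openin T V" "\<xi> \<in> carrier (spec_sec R V)" "\<zeta> \<in> carrier (spec_sec R V)"
  shows "\<xi> \<oplus>\<^bsub>spec_sec R V\<^esub> \<zeta> \<in> carrier (spec_sec R V)"
proof -
  have "locally_frac R V (\<lambda>q\<in>V. \<xi> q \<oplus>\<^bsub>loc_ring R q\<^esub> \<zeta> q)"
    using assms by (intro locally_frac_binop[where G = "\<lambda>a f b g. a \<otimes> g \<oplus> b \<otimes> f"])
      (auto simp: carrier_spec_sec prime_localization.loc_frac_add[OF open_loc[OF assms(1)]] loc_denom)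
  then show ?thesis
    unfolding carrier_spec_sec[OF assms(1)] by (simp add: spec_sec_def)
qed

lemma one_spec_sec:
  assumes "openin T V"
  shows "\<one>\<^bsub>spec_sec R V\<^esub> \<in> carrier (spec_sec R V)"
proof -
  have "locally_frac R V (\<lambda>q\<in>V. \<one>\<^bsub>loc_ring R q\<^esub>)"
    using assms loc_denom[OF assms] prime_localization.denom_one[OF open_loc[OF assms]]
    by (intro locally_fracI exI[of _ V] exI[of _ \<one>])
      (auto simp: prime_localization.loc_one[OF open_loc[OF assms]])
  then show ?thesis
    unfolding carrier_spec_sec[OF assms] by (simp add: spec_sec_def)
qed

lemma spec_sec_at:
  assumes "openin T V" "\<xi> \<in> carrier (spec_sec R V)" "q \<in> V"
  shows "\<exists>a f. a \<in> carrier R \<and> prime_localization.denom R q f \<and> \<xi> q = loc_frac R q a f"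
proof -
  have "locally_frac R V \<xi>" using assms(2) by (simp add: carrier_spec_sec[OF assms(1)])
  then obtain W a f where "openin T W" "q \<in> W" "W \<subseteq> V" "a \<in> carrier R" "f \<in> carrier R"
    "\<forall>q\<in>W. f \<notin> q" "\<forall>q\<in>W. \<xi> q = loc_frac R q a f"
    using assms(3) by (rule locally_fracE)
  then show ?thesis unfolding loc_denom[OF assms(1,3)] by metis
qed

text \<open>Invertibility of the value in the local ring at \<open>q\<close>, in a form that extends
  to a neighborhood.\<close>

definition frac_unit :: "('r set \<Rightarrow> ('r \<times> 'r) set) \<Rightarrow> 'r set \<Rightarrow> bool" where
  "frac_unit \<xi> q \<longleftrightarrow> (\<exists>a f. a \<in> carrier R \<and> f \<in> carrier R \<and> a \<notin> q \<and> f \<notin> q \<and> \<xi> q = loc_frac R q a f)"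

text \<open>Where numerator and denominator both lie outside the prime, the reciprocal fraction is
  an inverse; such primes form an open set.\<close>

lemma frac_unit_imp_Units:
  assumes V: "openin T V" "q \<in> V" and \<xi>: "\<xi> \<in> carrier (spec_sec R V)" and u: "frac_unit \<xi> q"
  shows "\<exists>W. openin T W \<and> q \<in> W \<and> W \<subseteq> V \<and> restrict \<xi> W \<in> Units (spec_sec R W)"
proof -
  interpret q: prime_localization R q by (rule open_loc[OF V])
  have "locally_frac R V \<xi>" using \<xi> by (simp add: carrier_spec_sec V)
  then obtain W1 a f where W1: "openin T W1" "q \<in> W1" "W1 \<subseteq> V" "a \<in> carrier R" "f \<in> carrier R"
    "\<forall>q\<in>W1. f \<notin> q" "\<forall>q\<in>W1. \<xi> q = loc_frac R q a f"
    using V(2) by (rule locally_fracE)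
  obtain b g where b: "b \<in> carrier R" "g \<in> carrier R" "b \<notin> q" "g \<notin> q" "\<xi> q = loc_frac R q b g"
    using u unfolding frac_unit_def by blast
  \<comment> \<open>The local representative \<open>a / f\<close> need not be the one that witnesses
    \<open>frac_unit\<close>, so the two are compared at \<open>q\<close>.\<close>
  have "a \<notin> q"
  proof
    assume "a \<in> q"
    have "(a, f) \<in> loc_frac R q b g"
      using q.loc_frac_self[of a f] W1 b by (auto simp: q.denom_def)
    then obtain v where v: "q.denom v" "v \<otimes> (f \<otimes> b) = v \<otimes> (g \<otimes> a)"
      by (auto simp: q.loc_frac_iff)
    have "v \<otimes> (f \<otimes> b) \<in> q"
      unfolding v(2) using \<open>a \<in> q\<close> v b by (intro q.I_l_closed) auto
    moreover have "q.denom (v \<otimes> (f \<otimes> b))"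
      using v b W1 by (intro q.denom_mult) (auto simp: q.denom_def)
    ultimately show False by (simp add: q.denom_def)
  qed
  define W where "W = W1 \<inter> {p \<in> prime_spectrum R. a \<notin> p}"
  have W: "openin T W" "q \<in> W" "W \<subseteq> V"
    using W1 openin_zariski_basic[OF is_cr W1(4)] \<open>a \<notin> q\<close> open_prime[OF W1(1,2)]
    by (auto simp: W_def)
  define \<zeta> where "\<zeta> = (\<lambda>p\<in>W. loc_frac R p f a)"
  have "locally_frac R W \<zeta>"
    by (rule locally_fracI, rule exI[of _ W], rule exI[of _ f], rule exI[of _ a])
      (use W W1 in \<open>auto simp: \<zeta>_def W_def\<close>)
  then have \<zeta>: "\<zeta> \<in> carrier (spec_sec R W)"
    by (simp add: carrier_spec_sec[OF W(1)] \<zeta>_def)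
  have *: "loc_frac R p a f \<otimes>\<^bsub>loc_ring R p\<^esub> loc_frac R p f a = \<one>\<^bsub>loc_ring R p\<^esub> \<and>
      loc_frac R p f a \<otimes>\<^bsub>loc_ring R p\<^esub> loc_frac R p a f = \<one>\<^bsub>loc_ring R p\<^esub>" if "p \<in> W" for p
  proof -
    interpret p: prime_localization R p by (rule open_loc[OF W(1) that])
    have "p.denom a" "p.denom f" using that W1 by (auto simp: W_def p.denom_def)
    then have "loc_frac R p (a \<otimes> f) (a \<otimes> f) = loc_frac R p \<one> \<one>"
      using W1 by (intro p.loc_frac_eqI[of _ _ _ _ \<one>]) auto
    then show ?thesis
      using W1 \<open>p.denom a\<close> \<open>p.denom f\<close> by (simp add: p.loc_frac_mult p.loc_one m_comm[of f a])
  qed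
  have "restrict \<xi> W \<in> Units (spec_sec R W)"
  proof -
    have "restrict \<xi> W \<otimes>\<^bsub>spec_sec R W\<^esub> \<zeta> = \<one>\<^bsub>spec_sec R W\<^esub>"
      "\<zeta> \<otimes>\<^bsub>spec_sec R W\<^esub> restrict \<xi> W = \<one>\<^bsub>spec_sec R W\<^esub>"
      using * W1(7) by (auto simp: spec_sec_def \<zeta>_def W_def intro!: restrict_ext)
    then show ?thesis
      using restrict_spec_sec[OF V(1) W(1,3) \<xi>] \<zeta> unfolding Units_def by blast
  qed
  then show ?thesis using W by blast
qed

lemma Units_imp_frac_unit:
  assumes V: "openin T V" "q \<in> V" and \<xi>: "\<xi> \<in> Units (spec_sec R V)"
  shows "frac_unit \<xi> q"
proof -
  interpret q: prime_localization R q by (rule open_loc[OF V])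
  obtain \<zeta> where \<zeta>: "\<zeta> \<in> carrier (spec_sec R V)" "\<xi> \<otimes>\<^bsub>spec_sec R V\<^esub> \<zeta> = \<one>\<^bsub>spec_sec R V\<^esub>"
    "\<xi> \<in> carrier (spec_sec R V)"
    using \<xi> by (auto simp: Units_def)
  obtain a f where a: "a \<in> carrier R" "q.denom f" "\<xi> q = loc_frac R q a f"
    using spec_sec_at[OF V(1) \<zeta>(3) V(2)] by blast
  obtain b g where b: "b \<in> carrier R" "q.denom g" "\<zeta> q = loc_frac R q b g"
    using spec_sec_at[OF V(1) \<zeta>(1) V(2)] by blast
  have "\<xi> q \<otimes>\<^bsub>loc_ring R q\<^esub> \<zeta> q = \<one>\<^bsub>loc_ring R q\<^esub>"
    using fun_cong[OF \<zeta>(2), of q] V by (simp add: spec_sec_def)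
  then have "loc_frac R q (a \<otimes> b) (f \<otimes> g) = \<one>\<^bsub>loc_ring R q\<^esub>"
    using a b by (simp add: q.loc_frac_mult)
  then have "a \<otimes> b \<notin> q"
    using q.loc_frac_not_one[of "a \<otimes> b" "f \<otimes> g"] a b by auto
  then have "a \<notin> q"
    using q.I_r_closed b by blast
  then show ?thesis
    unfolding frac_unit_def using a by (auto simp: q.denom_def)
qed

text \<open>The local ring property: a sum of two non-units at \<open>q\<close> has the numerator
  \<open>a g + b f\<close> in \<open>q\<close>, and then no representative of it has a numerator
  outside \<open>q\<close>.\<close>

lemma frac_unit_add:
  assumes V: "openin T V" "q \<in> V"
    and "\<xi> \<in> carrier (spec_sec R V)" "\<zeta> \<in> carrier (spec_sec R V)"
    and u: "frac_unit (\<xi> \<oplus>\<^bsub>spec_sec R V\<^esub> \<zeta>) q"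
  shows "frac_unit \<xi> q \<or> frac_unit \<zeta> q"
proof (rule ccontr)
  assume n: "\<not> ?thesis"
  interpret q: prime_localization R q by (rule open_loc[OF V])
  obtain a f where a: "a \<in> carrier R" "q.denom f" "\<xi> q = loc_frac R q a f"
    using spec_sec_at[OF V(1) assms(3) V(2)] by blast
  obtain b g where b: "b \<in> carrier R" "q.denom g" "\<zeta> q = loc_frac R q b g"
    using spec_sec_at[OF V(1) assms(4) V(2)] by blast
  have "a \<in> q"
    using n a unfolding frac_unit_def q.denom_def by blast
  moreover have "b \<in> q"
    using n b unfolding frac_unit_def q.denom_def by blast
  ultimately have num: "a \<otimes> g \<oplus> b \<otimes> f \<in> q"
    using a b by (intro additive_subgroup.a_closed[OF q.additive_subgroup_axioms] q.I_r_closed)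
      (simp_all add: q.denom_carrier)
  have sum: "(\<xi> \<oplus>\<^bsub>spec_sec R V\<^esub> \<zeta>) q = loc_frac R q (a \<otimes> g \<oplus> b \<otimes> f) (f \<otimes> g)"
    using V a b by (simp add: spec_sec_def q.loc_frac_add)
  obtain c k where c: "c \<in> carrier R" "k \<in> carrier R" "c \<notin> q" "k \<notin> q"
    "(\<xi> \<oplus>\<^bsub>spec_sec R V\<^esub> \<zeta>) q = loc_frac R q c k"
    using u unfolding frac_unit_def by blast
  have "(c, k) \<in> loc_frac R q (a \<otimes> g \<oplus> b \<otimes> f) (f \<otimes> g)"
    using q.loc_frac_self[of c k] c sum by (simp add: q.denom_def)
  then obtain v where v: "q.denom v"
    "v \<otimes> (k \<otimes> (a \<otimes> g \<oplus> b \<otimes> f)) = v \<otimes> ((f \<otimes> g) \<otimes> c)"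
    by (auto simp: q.loc_frac_iff)
  have "v \<otimes> ((f \<otimes> g) \<otimes> c) \<in> q"
    unfolding v(2)[symmetric] using num v c by (intro q.I_l_closed) auto
  moreover have "q.denom (v \<otimes> ((f \<otimes> g) \<otimes> c))"
  proof -
    have "q.denom c" using c by (simp add: q.denom_def)
    then show ?thesis using v(1) a(2) b(2) by simp
  qed
  ultimately show False by (simp add: q.denom_def)
qed

text \<open>\<open>ring_hom\<close> does not ask that zero be preserved. The equation
  \<open>0 + 0 = 0\<close> later forces an additive map on sections to send zero to zero.\<close>

lemma zero_spec_sec:
  assumes "openin T V"
  shows "\<zero>\<^bsub>spec_sec R V\<^esub> \<in> carrier (spec_sec R V)"
    and "\<zero>\<^bsub>spec_sec R V\<^esub> \<oplus>\<^bsub>spec_sec R V\<^esub> \<zero>\<^bsub>spec_sec R V\<^esub> = \<zero>\<^bsub>spec_sec R V\<^esub>"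
proof -
  have "locally_frac R V (\<lambda>q\<in>V. \<zero>\<^bsub>loc_ring R q\<^esub>)"
  proof (rule locally_fracI, rule exI[of _ V], rule exI[of _ \<zero>], rule exI[of _ \<one>])
    fix p assume "p \<in> V"
    then show "openin T V \<and> p \<in> V \<and> V \<subseteq> V \<and> \<zero> \<in> carrier R \<and> \<one> \<in> carrier R \<and>
        (\<forall>q\<in>V. \<one> \<notin> q) \<and> (\<forall>q\<in>V. (\<lambda>q\<in>V. \<zero>\<^bsub>loc_ring R q\<^esub>) q = loc_frac R q \<zero> \<one>)"
      using assms loc_denom[OF assms] prime_localization.denom_one[OF open_loc[OF assms]]
      by (simp add: prime_localization.loc_zero[OF open_loc[OF assms]])
  qed
  then show "\<zero>\<^bsub>spec_sec R V\<^esub> \<in> carrier (spec_sec R V)"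
    unfolding carrier_spec_sec[OF assms] by (simp add: spec_sec_def)
  have "\<zero>\<^bsub>loc_ring R q\<^esub> \<oplus>\<^bsub>loc_ring R q\<^esub> \<zero>\<^bsub>loc_ring R q\<^esub> = \<zero>\<^bsub>loc_ring R q\<^esub>" if "q \<in> V" for q
  proof -
    interpret q: prime_localization R q by (rule open_loc[OF assms that])
    show ?thesis by (simp add: q.loc_zero q.loc_frac_add)
  qed
  then show "\<zero>\<^bsub>spec_sec R V\<^esub> \<oplus>\<^bsub>spec_sec R V\<^esub> \<zero>\<^bsub>spec_sec R V\<^esub> = \<zero>\<^bsub>spec_sec R V\<^esub>"
    by (auto simp: spec_sec_def intro!: restrict_ext)
qed

lemma frac_unit_zero:
  assumes "openin T V" "q \<in> V"
  shows "\<not> frac_unit (\<zero>\<^bsub>spec_sec R V\<^esub>) q"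
proof
  interpret q: prime_localization R q by (rule open_loc[OF assms])
  assume "frac_unit (\<zero>\<^bsub>spec_sec R V\<^esub>) q"
  then obtain b g where b: "b \<in> carrier R" "g \<in> carrier R" "b \<notin> q" "g \<notin> q"
    "(\<zero>\<^bsub>spec_sec R V\<^esub>) q = loc_frac R q b g"
    unfolding frac_unit_def by blast
  then have "(b, g) \<in> loc_frac R q \<zero> \<one>"
    using q.loc_frac_self[of b g] assms by (simp add: q.denom_def q.loc_zero spec_sec_def)
  then obtain v where v: "q.denom v" "v \<otimes> (g \<otimes> \<zero>) = v \<otimes> (\<one> \<otimes> b)"
    by (auto simp: q.loc_frac_iff)
  then have "v \<otimes> b = \<zero>" using b by simp
  moreover have "q.denom (v \<otimes> b)"
    using v(1) b by (intro q.denom_mult) (simp_all add: q.denom_def)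
  ultimately show False
    using additive_subgroup.zero_closed[OF q.additive_subgroup_axioms] by (simp add: q.denom_def)
qed

end

text \<open>Invertibility of the germ at \<open>x\<close> in the stalk, stated on a neighborhood so
  that no stalk has to be constructed.\<close>

definition germ_unit :: "('p, 'r) ringed_space \<Rightarrow> 'p set \<Rightarrow> 'p \<Rightarrow> 'r \<Rightarrow> bool" where
  "germ_unit S U x r \<longleftrightarrow>
     (\<exists>V. openin (rs_top S) V \<and> x \<in> V \<and> V \<subseteq> U \<and> rs_res S U V r \<in> Units (rs_sec S V))"

lemma ringed_spaceD:
  assumes "ringed_space S"
  shows "is_sheaf (rs_top S) (\<lambda>U. carrier (rs_sec S U)) (rs_res S)"
    and "openin (rs_top S) U \<Longrightarrow> cring (rs_sec S U)"
    and "openin (rs_top S) U \<Longrightarrow> openin (rs_top S) V \<Longrightarrow> V \<subseteq> U \<Longrightarrow>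
      rs_res S U V \<in> ring_hom (rs_sec S U) (rs_sec S V)"
  using assms by (auto simp: ringed_space_def)

text \<open>The isomorphism matches neighborhoods of \<open>x\<close> with neighborhoods of
  \<open>g x\<close> and preserves units over each, so an invertible germ corresponds to an
  invertible value in the localization.\<close>

lemma germ_unit_transport:
  assumes S: "ringed_space S" and U: "openin (rs_top S) U" and x: "x \<in> U" and R: "cring R"
    and g: "homeomorphic_map (subtopology (rs_top S) U) (zariski_topology R) g"
    and \<psi>: "\<And>V. openin (zariski_topology R) V \<Longrightarrow>
      \<psi> V \<in> ring_iso (spec_sec R V) (rs_sec S {y \<in> U. g y \<in> V})"
    and nat: "\<And>V W s. openin (zariski_topology R) V \<Longrightarrow> openin (zariski_topology R) W \<Longrightarrow> W \<subseteq> V \<Longrightarrow>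
      s \<in> carrier (spec_sec R V) \<Longrightarrow>
      \<psi> W (restrict s W) = rs_res S {y \<in> U. g y \<in> V} {y \<in> U. g y \<in> W} (\<psi> V s)"
    and Y: "openin (zariski_topology R) Y" and gx: "g x \<in> Y" and s: "s \<in> carrier (spec_sec R Y)"
  shows "germ_unit S {y \<in> U. g y \<in> Y} x (\<psi> Y s) \<longleftrightarrow> spec_ring.frac_unit R s (g x)"
proof -
  interpret spec_ring R by (rule spec_ring.intro[OF R])
  let ?pre = "\<lambda>V. {y \<in> U. g y \<in> V}"
  have top: "topspace (subtopology (rs_top S) U) = U"
    using openin_subset[OF U] by auto
  have gU: "g ` U = prime_spectrum R" "inj_on g U"
    using g top topspace_zariski[OF R] by (auto simp: homeomorphic_eq_everything_map)
  have pre_open: "openin (rs_top S) (?pre V)" if "openin T V" for V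
  proof -
    have "openin (subtopology (rs_top S) U) {y \<in> U. g y \<in> V}"
      using openin_continuous_map_preimage[OF homeomorphic_imp_continuous_map[OF g] that]
      unfolding top .
    then show ?thesis using U openin_trans_full by blast
  qed
  have resU: "\<psi> W (restrict s W) = rs_res S (?pre Y) (?pre W) (\<psi> Y s)" if "openin T W" "W \<subseteq> Y" for W
    using nat[OF Y that s] .
  show ?thesis
  proof
    assume "frac_unit s (g x)"
    then obtain W where W: "openin T W" "g x \<in> W" "W \<subseteq> Y" "restrict s W \<in> Units (spec_sec R W)"
      using frac_unit_imp_Units[OF Y gx s] by blast
    have hom: "\<psi> W \<in> ring_hom (spec_sec R W) (rs_sec S (?pre W))"
      using \<psi>[OF W(1)] by (simp add: ring_iso_def)
    obtain t where t: "t \<in> carrier (spec_sec R W)" "restrict s W \<otimes>\<^bsub>spec_sec R W\<^esub> t = \<one>\<^bsub>spec_sec R W\<^esub>"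
      "t \<otimes>\<^bsub>spec_sec R W\<^esub> restrict s W = \<one>\<^bsub>spec_sec R W\<^esub>" "restrict s W \<in> carrier (spec_sec R W)"
      using W(4) by (auto simp: Units_def)
    have "\<psi> W (restrict s W) \<in> Units (rs_sec S (?pre W))"
      unfolding Units_def
      using ring_hom_closed[OF hom t(4)] ring_hom_closed[OF hom t(1)]
        ring_hom_mult[OF hom t(4) t(1)] ring_hom_mult[OF hom t(1) t(4)] ring_hom_one[OF hom] t(2,3)
      by auto
    then show "germ_unit S (?pre Y) x (\<psi> Y s)"
      unfolding germ_unit_def using W pre_open[OF W(1)] x resU[OF W(1,3)]
      by (intro exI[of _ "?pre W"]) auto
  next
    assume "germ_unit S (?pre Y) x (\<psi> Y s)"
    then obtain V where V: "openin (rs_top S) V" "x \<in> V" "V \<subseteq> ?pre Y"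
      "rs_res S (?pre Y) V (\<psi> Y s) \<in> Units (rs_sec S V)"
      by (auto simp: germ_unit_def)
    \<comment> \<open>The image under the homeomorphism. Injectivity of \<open>g\<close> makes its
      preimage \<open>V\<close> again, so that \<open>\<psi> W\<close> lands in the sections over
      \<open>V\<close>.\<close>
    define W where "W = g ` V"
    have "openin (subtopology (rs_top S) U) V"
      using V by (simp add: openin_subset_topspace_eq openin_subtopology) blast
    then have W: "openin T W"
      using g unfolding W_def homeomorphic_eq_everything_map open_map_def by blast
    have preW: "?pre W = V"
      using V gU(2) by (auto simp: W_def inj_on_def)
    have WY: "W \<subseteq> Y" using V by (auto simp: W_def)
    have sW: "restrict s W \<in> carrier (spec_sec R W)"
      by (rule restrict_spec_sec[OF Y W WY s])
    have hom: "\<psi> W \<in> ring_hom (spec_sec R W) (rs_sec S V)"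
      and bij: "bij_betw (\<psi> W) (carrier (spec_sec R W)) (carrier (rs_sec S V))"
      using \<psi>[OF W] preW by (auto simp: ring_iso_def)
    have "\<psi> W (restrict s W) \<in> Units (rs_sec S V)"
      using V resU[OF W WY] preW by simp
    then obtain t' where t': "t' \<in> carrier (rs_sec S V)"
      "\<psi> W (restrict s W) \<otimes>\<^bsub>rs_sec S V\<^esub> t' = \<one>\<^bsub>rs_sec S V\<^esub>"
      "t' \<otimes>\<^bsub>rs_sec S V\<^esub> \<psi> W (restrict s W) = \<one>\<^bsub>rs_sec S V\<^esub>"
      by (auto simp: Units_def)
    obtain t where t: "t \<in> carrier (spec_sec R W)" "t' = \<psi> W t"
      using t'(1) bij by (auto simp: bij_betw_def)
    have inj: "inj_on (\<psi> W) (carrier (spec_sec R W))" using bij by (simp add: bij_betw_def)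
    have "restrict s W \<otimes>\<^bsub>spec_sec R W\<^esub> t = \<one>\<^bsub>spec_sec R W\<^esub>"
      using ring_hom_mult[OF hom sW t(1)] ring_hom_one[OF hom] t'(2) t(2)
      by (intro inj_onD[OF inj] mult_spec_sec[OF W sW t(1)] one_spec_sec[OF W]) simp
    moreover have "t \<otimes>\<^bsub>spec_sec R W\<^esub> restrict s W = \<one>\<^bsub>spec_sec R W\<^esub>"
      using ring_hom_mult[OF hom t(1) sW] ring_hom_one[OF hom] t'(3) t(2)
      by (intro inj_onD[OF inj] mult_spec_sec[OF W t(1) sW] one_spec_sec[OF W]) simp
    ultimately have "restrict s W \<in> Units (spec_sec R W)"
      using sW t(1) unfolding Units_def by blast
    then have "frac_unit (restrict s W) (g x)"
      using V(2) by (intro Units_imp_frac_unit[OF W]) (auto simp: W_def)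
    then show "frac_unit s (g x)"
      using V(2) by (simp add: frac_unit_def W_def)
  qed
qed

lemma scheme_affine:
  assumes "is_scheme S" "x \<in> topspace (rs_top S)"
  obtains U where "affine_open S U" "x \<in> U" "openin (rs_top S) U"
  using assms unfolding is_scheme_def by (meson affine_open_def)

text \<open>In an affine chart the stalk at \<open>x\<close> is the localization at the prime
  \<open>g x\<close>, hence a local ring.\<close>

lemma affine_germ_unit:
  assumes S: "ringed_space S" and U: "affine_open S U" and V: "openin (rs_top S) V" "V \<subseteq> U" "x \<in> V"
  shows affine_germ_unit_add: "r \<in> carrier (rs_sec S V) \<Longrightarrow> s \<in> carrier (rs_sec S V) \<Longrightarrow>
      germ_unit S V x (r \<oplus>\<^bsub>rs_sec S V\<^esub> s) \<Longrightarrow> germ_unit S V x r \<or> germ_unit S V x s"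
    and affine_germ_unit_zero: "\<not> germ_unit S V x \<zero>\<^bsub>rs_sec S V\<^esub>"
proof -
  obtain R :: "'b ring" where R: "cring R" and iso: "ringed_space_isomorphic (open_subspace S U) (Spec R)"
    and Uo: "openin (rs_top S) U"
    using U by (auto simp: affine_open_def)
  interpret spec_ring R by (rule spec_ring.intro[OF R])
  have top: "topspace (subtopology (rs_top S) U) = U"
    using openin_subset[OF Uo] by auto
  have "\<exists>g \<psi>. homeomorphic_map (subtopology (rs_top S) U) (zariski_topology R) g \<and>
      (\<forall>V. openin (zariski_topology R) V \<longrightarrow>
        \<psi> V \<in> ring_iso (spec_sec R V) (rs_sec S {y \<in> U. g y \<in> V})) \<and>
      (\<forall>V W. openin (zariski_topology R) V \<and> openin (zariski_topology R) W \<and> W \<subseteq> V \<longrightarrow>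
        (\<forall>s\<in>carrier (spec_sec R V).
          \<psi> W (restrict s W) = rs_res S {y \<in> U. g y \<in> V} {y \<in> U. g y \<in> W} (\<psi> V s)))"
    using iso unfolding ringed_space_isomorphic_def Let_def Spec_def open_subspace_def
    by (simp add: top del: topspace_subtopology)
  then obtain g \<psi> where g: "homeomorphic_map (subtopology (rs_top S) U) (zariski_topology R) g"
    and B: "\<forall>V. openin (zariski_topology R) V \<longrightarrow>
        \<psi> V \<in> ring_iso (spec_sec R V) (rs_sec S {y \<in> U. g y \<in> V})"
    and C: "\<forall>V W. openin (zariski_topology R) V \<and> openin (zariski_topology R) W \<and> W \<subseteq> V \<longrightarrow>
        (\<forall>s\<in>carrier (spec_sec R V).
          \<psi> W (restrict s W) = rs_res S {y \<in> U. g y \<in> V} {y \<in> U. g y \<in> W} (\<psi> V s))"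
    by (elim exE conjE) (rule that)
  have \<psi>: "\<psi> V \<in> ring_iso (spec_sec R V) (rs_sec S {y \<in> U. g y \<in> V})"
    if "openin (zariski_topology R) V" for V
    using B that by simp
  have nat: "\<psi> W (restrict s W) = rs_res S {y \<in> U. g y \<in> V} {y \<in> U. g y \<in> W} (\<psi> V s)"
    if "openin (zariski_topology R) V" "openin (zariski_topology R) W" "W \<subseteq> V"
      "s \<in> carrier (spec_sec R V)" for V W s
    using C that by simp
  define Y where "Y = g ` V"
  have inj: "inj_on g U"
    using g top by (auto simp: homeomorphic_eq_everything_map)
  have "openin (subtopology (rs_top S) U) V"
    using V by (auto simp: openin_subtopology intro!: exI[of _ V])
  then have Y: "openin T Y"
    using g unfolding Y_def homeomorphic_eq_everything_map open_map_def by blast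
  have gx: "g x \<in> Y" using V by (auto simp: Y_def)
  have pre: "{y \<in> U. g y \<in> Y} = V" using inj V by (auto simp: Y_def inj_on_def)
  have hom: "\<psi> Y \<in> ring_hom (spec_sec R Y) (rs_sec S V)"
    and bij: "bij_betw (\<psi> Y) (carrier (spec_sec R Y)) (carrier (rs_sec S V))"
    using \<psi>[OF Y] pre by (auto simp: ring_iso_def)
  have tr: "germ_unit S V x (\<psi> Y s) \<longleftrightarrow> frac_unit s (g x)" if "s \<in> carrier (spec_sec R Y)" for s
  proof -
    have "x \<in> U" using V by blast
    have "germ_unit S {y \<in> U. g y \<in> Y} x (\<psi> Y s) \<longleftrightarrow> frac_unit s (g x)"
      by (rule germ_unit_transport[OF S Uo \<open>x \<in> U\<close> R g]; (rule \<psi> nat Y gx that)?; assumption?)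
    then show ?thesis by (simp only: pre)
  qed
  show "germ_unit S V x r \<or> germ_unit S V x s"
    if rs: "r \<in> carrier (rs_sec S V)" "s \<in> carrier (rs_sec S V)" "germ_unit S V x (r \<oplus>\<^bsub>rs_sec S V\<^esub> s)"
  proof -
    obtain a b where a: "a \<in> carrier (spec_sec R Y)" "r = \<psi> Y a"
      and b: "b \<in> carrier (spec_sec R Y)" "s = \<psi> Y b"
      using rs(1,2) unfolding bij_betw_imp_surj_on[OF bij, symmetric] by blast
    have "frac_unit (a \<oplus>\<^bsub>spec_sec R Y\<^esub> b) (g x)"
      using rs(3) ring_hom_add[OF hom a(1) b(1)] tr[OF add_spec_sec[OF Y a(1) b(1)]] a b by simp
    then show ?thesis
      using frac_unit_add[OF Y gx a(1) b(1)] tr[OF a(1)] tr[OF b(1)] a b by simp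
  qed
  interpret OU: cring "rs_sec S V" by (rule ringed_spaceD(2)[OF S V(1)])
  have "\<psi> Y \<zero>\<^bsub>spec_sec R Y\<^esub> = \<zero>\<^bsub>rs_sec S V\<^esub>"
    using ring_hom_add[OF hom zero_spec_sec(1)[OF Y] zero_spec_sec(1)[OF Y]] zero_spec_sec(2)[OF Y]
      ring_hom_closed[OF hom zero_spec_sec(1)[OF Y]] by (metis OU.add.l_cancel_one')
  then show "\<not> germ_unit S V x \<zero>\<^bsub>rs_sec S V\<^esub>"
    using tr[OF zero_spec_sec(1)[OF Y]] frac_unit_zero[OF Y gx] by simp
qed

lemma (in ring_hom_ring) hom_Units: "x \<in> Units R \<Longrightarrow> h x \<in> Units S"
  unfolding Units_def by clarify (metis hom_closed hom_mult hom_one)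

section \<open>Invertible germs on a scheme\<close>

locale scheme =
  fixes S :: "('p, 'r) ringed_space"
  assumes is_scheme: "is_scheme S"
begin

abbreviation "opens \<equiv> openin (rs_top S)"
abbreviation "sp \<equiv> topspace (rs_top S)"
abbreviation "Oc \<equiv> rs_sec S"
abbreviation "rho \<equiv> rs_res S"

lemma ringed: "ringed_space S"
  using is_scheme by (simp add: is_scheme_def)

lemma O_cring: "opens U \<Longrightarrow> cring (Oc U)"
  by (rule ringed_spaceD(2)[OF ringed])

lemma O_ring: "opens U \<Longrightarrow> ring (Oc U)"
  using O_cring by (simp add: cring_def)

lemma rho_hom: "opens U \<Longrightarrow> opens V \<Longrightarrow> V \<subseteq> U \<Longrightarrow> ring_hom_ring (Oc U) (Oc V) (rho U V)"
  by (intro ring_hom_ringI2 O_ring ringed_spaceD(3)[OF ringed])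

lemma rho_rho:
  "opens U \<Longrightarrow> opens V \<Longrightarrow> opens W \<Longrightarrow> W \<subseteq> V \<Longrightarrow> V \<subseteq> U \<Longrightarrow> r \<in> carrier (Oc U) \<Longrightarrow>
    rho V W (rho U V r) = rho U W r"
  using ringed_spaceD(1)[OF ringed] by (simp add: is_sheaf_def)

lemma rho_id: "opens U \<Longrightarrow> r \<in> carrier (Oc U) \<Longrightarrow> rho U U r = r"
  using ringed_spaceD(1)[OF ringed] by (simp add: is_sheaf_def)

lemma rho_closed:
  "opens U \<Longrightarrow> opens V \<Longrightarrow> V \<subseteq> U \<Longrightarrow> r \<in> carrier (Oc U) \<Longrightarrow> rho U V r \<in> carrier (Oc V)"
  using ring_hom_closed[OF ringed_spaceD(3)[OF ringed]] .

lemma rho_Units: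
  "opens U \<Longrightarrow> opens V \<Longrightarrow> V \<subseteq> U \<Longrightarrow> r \<in> Units (Oc U) \<Longrightarrow> rho U V r \<in> Units (Oc V)"
  by (rule ring_hom_ring.hom_Units[OF rho_hom])

lemma germ_unitI:
  "opens V \<Longrightarrow> x \<in> V \<Longrightarrow> V \<subseteq> U \<Longrightarrow> rho U V r \<in> Units (Oc V) \<Longrightarrow> germ_unit S U x r"
  by (auto simp: germ_unit_def)

lemma germ_unit_rho:
  assumes U: "opens U" and V: "opens V" "V \<subseteq> U" "x \<in> V" and r: "r \<in> carrier (Oc U)"
  shows "germ_unit S V x (rho U V r) \<longleftrightarrow> germ_unit S U x r"
proof
  assume "germ_unit S V x (rho U V r)"
  then obtain W where "opens W" "x \<in> W" "W \<subseteq> V" "rho V W (rho U V r) \<in> Units (Oc W)"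
    by (auto simp: germ_unit_def)
  then show "germ_unit S U x r"
    using V r U by (intro germ_unitI[of W]) (auto simp: rho_rho)
next
  assume "germ_unit S U x r"
  then obtain W where W: "opens W" "x \<in> W" "W \<subseteq> U" "rho U W r \<in> Units (Oc W)"
    by (auto simp: germ_unit_def)
  have "rho W (W \<inter> V) (rho U W r) \<in> Units (Oc (W \<inter> V))"
    using W V by - (rule rho_Units, auto)
  then have "rho V (W \<inter> V) (rho U V r) \<in> Units (Oc (W \<inter> V))"
    using W V U r by (simp add: rho_rho openin_Int)
  then show "germ_unit S V x (rho U V r)"
    using W V by (intro germ_unitI[of "W \<inter> V"]) auto
qed

text \<open>Locality of the stalk is known inside affine open sets. \<open>germ_unit\<close> is
  unchanged by restriction, so the claim is moved to the part of \<open>V\<close> in an affine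
  neighborhood.\<close>

lemma germ_unit_local:
  assumes V: "opens V" "x \<in> V"
  shows germ_unit_add: "r \<in> carrier (Oc V) \<Longrightarrow> s \<in> carrier (Oc V) \<Longrightarrow>
      germ_unit S V x (r \<oplus>\<^bsub>Oc V\<^esub> s) \<Longrightarrow> germ_unit S V x r \<or> germ_unit S V x s"
    and germ_unit_zero: "\<not> germ_unit S V x \<zero>\<^bsub>Oc V\<^esub>"
proof -
  have "x \<in> sp" using V openin_subset by blast
  then obtain U where U: "affine_open S U" "x \<in> U" "opens U"
    using scheme_affine[OF is_scheme] by blast
  let ?W = "V \<inter> U"
  have W: "opens ?W" "?W \<subseteq> U" "x \<in> ?W" "?W \<subseteq> V" using V U by auto
  interpret VW: ring_hom_ring "Oc V" "Oc ?W" "rho V ?W" by (rule rho_hom[OF V(1) W(1,4)])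
  note eq = germ_unit_rho[OF V(1) W(1,4,3), symmetric]
  show "germ_unit S V x r \<or> germ_unit S V x s"
    if "r \<in> carrier (Oc V)" "s \<in> carrier (Oc V)" "germ_unit S V x (r \<oplus>\<^bsub>Oc V\<^esub> s)"
    using affine_germ_unit_add[OF ringed U(1) W(1-3), of "rho V ?W r" "rho V ?W s"] that
    by (simp add: eq)
  show "\<not> germ_unit S V x \<zero>\<^bsub>Oc V\<^esub>"
    using affine_germ_unit_zero[OF ringed U(1) W(1-3)] by (simp add: eq)
qed

text \<open>A factor of a unit is a unit by commutativity; conversely two neighborhoods of
  invertibility are intersected.\<close>

lemma germ_unit_mult:
  assumes V: "opens V" "x \<in> V" and rs: "r \<in> carrier (Oc V)" "s \<in> carrier (Oc V)"
  shows "germ_unit S V x (r \<otimes>\<^bsub>Oc V\<^esub> s) \<longleftrightarrow> germ_unit S V x r \<and> germ_unit S V x s"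
proof
  assume "germ_unit S V x (r \<otimes>\<^bsub>Oc V\<^esub> s)"
  then obtain W where W: "opens W" "x \<in> W" "W \<subseteq> V" "rho V W (r \<otimes>\<^bsub>Oc V\<^esub> s) \<in> Units (Oc W)"
    by (auto simp: germ_unit_def)
  interpret VW: ring_hom_ring "Oc V" "Oc W" "rho V W" by (rule rho_hom[OF V(1) W(1,3)])
  interpret W: cring "Oc W" by (rule O_cring[OF W(1)])
  have "rho V W r \<in> Units (Oc W)" "rho V W s \<in> Units (Oc W)"
    using W(4) rs W.unit_factor[of "rho V W r" "rho V W s"] W.unit_factor[of "rho V W s" "rho V W r"]
      W.m_comm[of "rho V W r" "rho V W s"] by auto
  then show "germ_unit S V x r \<and> germ_unit S V x s"
    using W germ_unitI by blast
next
  assume "germ_unit S V x r \<and> germ_unit S V x s"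
  then obtain W W' where W: "opens W" "x \<in> W" "W \<subseteq> V" "rho V W r \<in> Units (Oc W)"
    and W': "opens W'" "x \<in> W'" "W' \<subseteq> V" "rho V W' s \<in> Units (Oc W')"
    unfolding germ_unit_def by blast
  let ?X = "W \<inter> W'"
  have X: "opens ?X" "x \<in> ?X" "?X \<subseteq> V" using W W' by auto
  interpret VX: ring_hom_ring "Oc V" "Oc ?X" "rho V ?X" by (rule rho_hom[OF V(1) X(1,3)])
  interpret X: cring "Oc ?X" by (rule O_cring[OF X(1)])
  have "rho W ?X (rho V W r) \<in> Units (Oc ?X)" "rho W' ?X (rho V W' s) \<in> Units (Oc ?X)"
    using W W' X by - (rule rho_Units; auto)+
  then have "rho V ?X r \<in> Units (Oc ?X)" "rho V ?X s \<in> Units (Oc ?X)"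
    using W W' X V rs by (simp_all add: rho_rho)
  then show "germ_unit S V x (r \<otimes>\<^bsub>Oc V\<^esub> s)"
    using X rs by (intro germ_unitI[of ?X]) auto
qed

lemma germ_unit_one: "opens V \<Longrightarrow> x \<in> V \<Longrightarrow> germ_unit S V x \<one>\<^bsub>Oc V\<^esub>"
  using O_ring[of V] by (intro germ_unitI[of V]) (auto simp: rho_id ring_def monoid.Units_one_closed monoid.one_closed)

text \<open>This is the prime of a point: the sections that vanish in the residue field at
  \<open>x\<close>. It lets \<open>surjective_on_spectra\<close> be applied at points without
  identifying the points of an affine set with the primes of its ring of sections.\<close>

lemma nonunits_primeideal:
  assumes V: "opens V" "x \<in> V"
  shows "primeideal {r \<in> carrier (Oc V). \<not> germ_unit S V x r} (Oc V)"
proof -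
  interpret cring "Oc V" by (rule O_cring[OF V(1)])
  have minus: "\<not> germ_unit S V x (\<ominus>\<^bsub>Oc V\<^esub> r)" if "r \<in> carrier (Oc V)" "\<not> germ_unit S V x r" for r
    using germ_unit_mult[OF V, of "\<ominus>\<^bsub>Oc V\<^esub> \<one>\<^bsub>Oc V\<^esub>" r] that by (simp add: l_minus)
  show ?thesis
  proof (rule primeidealI)
    show "ideal {r \<in> carrier (Oc V). \<not> germ_unit S V x r} (Oc V)"
    proof (rule idealI)
      show "subgroup {r \<in> carrier (Oc V). \<not> germ_unit S V x r} (add_monoid (Oc V))"
        using minus germ_unit_zero[OF V] germ_unit_add[OF V]
        by (intro add.subgroupI) (auto simp: a_inv_def[symmetric])
    qed (auto simp: germ_unit_mult[OF V] intro: ring_axioms)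
    show "carrier (Oc V) \<noteq> {r \<in> carrier (Oc V). \<not> germ_unit S V x r}"
      using germ_unit_one[OF V] by auto
  qed (auto simp: germ_unit_mult[OF V] is_cring)
qed

end

section \<open>Algebras with a norm form\<close>

context abelian_group
begin

lemma add_diff_eq: "x \<in> carrier G \<Longrightarrow> y \<in> carrier G \<Longrightarrow> z \<in> carrier G \<Longrightarrow> x \<oplus> (y \<ominus> z) = (x \<oplus> y) \<ominus> z"
  by (simp add: minus_eq a_ac)

lemma diff_add_eq: "x \<in> carrier G \<Longrightarrow> y \<in> carrier G \<Longrightarrow> z \<in> carrier G \<Longrightarrow> (x \<ominus> y) \<oplus> z = (x \<oplus> z) \<ominus> y"
  by (simp add: minus_eq a_ac)

lemma diff_diff_eq: "x \<in> carrier G \<Longrightarrow> y \<in> carrier G \<Longrightarrow> z \<in> carrier G \<Longrightarrow> (x \<ominus> y) \<ominus> z = x \<ominus> (y \<oplus> z)"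
  by (simp add: minus_eq minus_add a_ac)

lemma diff_diff_eq2: "x \<in> carrier G \<Longrightarrow> y \<in> carrier G \<Longrightarrow> z \<in> carrier G \<Longrightarrow> x \<ominus> (y \<ominus> z) = (x \<oplus> z) \<ominus> y"
  by (simp add: minus_eq minus_add a_ac)

lemma diff_eq_eq: "x \<in> carrier G \<Longrightarrow> y \<in> carrier G \<Longrightarrow> z \<in> carrier G \<Longrightarrow> x \<ominus> y = z \<longleftrightarrow> x = z \<oplus> y"
  by (metis minus_eq a_assoc a_inv_closed l_neg r_neg r_zero)

lemma eq_diff_eq: "x \<in> carrier G \<Longrightarrow> y \<in> carrier G \<Longrightarrow> z \<in> carrier G \<Longrightarrow> z = x \<ominus> y \<longleftrightarrow> z \<oplus> y = x"
  using diff_eq_eq[of x y z] by auto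

lemma add_minus_eq: "x \<in> carrier G \<Longrightarrow> y \<in> carrier G \<Longrightarrow> x \<oplus> \<ominus> y = x \<ominus> y"
  by (simp add: minus_eq)

lemma minus_add_eq: "x \<in> carrier G \<Longrightarrow> y \<in> carrier G \<Longrightarrow> \<ominus> x \<oplus> y = y \<ominus> x"
  by (simp add: minus_eq a_comm)

lemma minus_diff_eq: "x \<in> carrier G \<Longrightarrow> y \<in> carrier G \<Longrightarrow> \<ominus> (x \<ominus> y) = y \<ominus> x"
  by (simp add: minus_eq minus_add a_comm)

lemma diff_minus_eq: "x \<in> carrier G \<Longrightarrow> y \<in> carrier G \<Longrightarrow> x \<ominus> \<ominus> y = x \<oplus> y"
  by (simp add: minus_eq)

lemma minus_eq_iff: "x \<in> carrier G \<Longrightarrow> y \<in> carrier G \<Longrightarrow> \<ominus> x = y \<longleftrightarrow> y \<oplus> x = \<zero>"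
  using minus_equality[of y x] l_neg[of x] by auto

lemma eq_minus_iff: "x \<in> carrier G \<Longrightarrow> y \<in> carrier G \<Longrightarrow> y = \<ominus> x \<longleftrightarrow> y \<oplus> x = \<zero>"
  using minus_equality[of y x] l_neg[of x] by auto

lemma diff_self: "x \<in> carrier G \<Longrightarrow> x \<ominus> x = \<zero>"
  by (simp add: minus_eq r_neg)

text \<open>These rules move differences outward until an equation compares two sums, which the
  commutative laws decide.\<close>

lemmas diff_simps = add_diff_eq diff_add_eq diff_diff_eq diff_diff_eq2 diff_eq_eq eq_diff_eq
  add_minus_eq minus_add_eq minus_diff_eq diff_minus_eq a_ac

end

lemma (in ring) mult_diff_distrib:
  "x \<in> carrier R \<Longrightarrow> y \<in> carrier R \<Longrightarrow> z \<in> carrier R \<Longrightarrow> x \<otimes> (y \<ominus> z) = x \<otimes> y \<ominus> x \<otimes> z"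
  by (simp add: minus_eq r_distr r_minus)

lemma (in ring) diff_mult_distrib:
  "x \<in> carrier R \<Longrightarrow> y \<in> carrier R \<Longrightarrow> z \<in> carrier R \<Longrightarrow> (x \<ominus> y) \<otimes> z = x \<otimes> z \<ominus> y \<otimes> z"
  by (simp add: minus_eq l_distr l_minus)

lemma (in cring) Units_mult_eq_zero:
  "u \<in> Units R \<Longrightarrow> x \<in> carrier R \<Longrightarrow> x \<otimes> u = \<zero> \<Longrightarrow> x = \<zero>"
  by (metis Units_closed Units_l_cancel m_comm r_null zero_closed)

locale quad_alg =
  fixes R :: "'r ring" and B :: "('r, 'q) module" and N :: "'q \<Rightarrow> 'r"
  assumes R_cring: "cring R" and alg: "assoc_algebra R B" and quad: "quadratic_map R B N"
begin

sublocale R: cring R by (rule R_cring)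
sublocale B: ring B using alg by (simp add: assoc_algebra_def)
sublocale M: module R B using alg by (simp add: assoc_algebra_def)


abbreviation P :: "'q \<Rightarrow> 'q \<Rightarrow> 'r" where "P \<equiv> polar_form R B N"
abbreviation Tr :: "'q \<Rightarrow> 'r" where "Tr x \<equiv> P x \<one>\<^bsub>B\<^esub>"
definition comm :: "'q \<Rightarrow> 'q \<Rightarrow> 'q" where "comm x y = x \<otimes>\<^bsub>B\<^esub> y \<ominus>\<^bsub>B\<^esub> y \<otimes>\<^bsub>B\<^esub> x"
text \<open>Under the trace identity this is minus the trace of \<open>[x, y] z\<close>, because
  commutators have trace zero.\<close>

definition tau :: "'q \<Rightarrow> 'q \<Rightarrow> 'q \<Rightarrow> 'r" where "tau x y z = P (comm x y) z"
text \<open>The canonical involution; on two by two matrices it is the adjugate.\<close>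

definition conj :: "'q \<Rightarrow> 'q" where "conj x = Tr x \<odot>\<^bsub>B\<^esub> \<one>\<^bsub>B\<^esub> \<ominus>\<^bsub>B\<^esub> x"

lemma smult_mult [simp]:
  "a \<in> carrier R \<Longrightarrow> x \<in> carrier B \<Longrightarrow> y \<in> carrier B \<Longrightarrow>
    (a \<odot>\<^bsub>B\<^esub> x) \<otimes>\<^bsub>B\<^esub> y = a \<odot>\<^bsub>B\<^esub> (x \<otimes>\<^bsub>B\<^esub> y)"
  "a \<in> carrier R \<Longrightarrow> x \<in> carrier B \<Longrightarrow> y \<in> carrier B \<Longrightarrow>
    x \<otimes>\<^bsub>B\<^esub> (a \<odot>\<^bsub>B\<^esub> y) = a \<odot>\<^bsub>B\<^esub> (x \<otimes>\<^bsub>B\<^esub> y)"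
  using alg by (auto simp: assoc_algebra_def)

lemma N_closed [simp]: "x \<in> carrier B \<Longrightarrow> N x \<in> carrier R"
  using quad by (auto simp: quadratic_map_def)

lemma N_smult: "a \<in> carrier R \<Longrightarrow> x \<in> carrier B \<Longrightarrow> N (a \<odot>\<^bsub>B\<^esub> x) = a \<otimes>\<^bsub>R\<^esub> a \<otimes>\<^bsub>R\<^esub> N x"
  using quad by (auto simp: quadratic_map_def)

lemma P_closed [simp]: "x \<in> carrier B \<Longrightarrow> y \<in> carrier B \<Longrightarrow> P x y \<in> carrier R"
  by (simp add: polar_form_def)

lemma N_add: "x \<in> carrier B \<Longrightarrow> y \<in> carrier B \<Longrightarrow> N (x \<oplus>\<^bsub>B\<^esub> y) = P x y \<oplus>\<^bsub>R\<^esub> (N x \<oplus>\<^bsub>R\<^esub> N y)"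
  by (simp add: polar_form_def R.diff_simps)

lemma P_sym: "x \<in> carrier B \<Longrightarrow> y \<in> carrier B \<Longrightarrow> P x y = P y x"
  by (simp add: polar_form_def R.diff_simps B.a_comm[of y x])

lemma P_add [simp]:
  "x \<in> carrier B \<Longrightarrow> y \<in> carrier B \<Longrightarrow> z \<in> carrier B \<Longrightarrow> P (x \<oplus>\<^bsub>B\<^esub> y) z = P x z \<oplus>\<^bsub>R\<^esub> P y z"
  "x \<in> carrier B \<Longrightarrow> y \<in> carrier B \<Longrightarrow> z \<in> carrier B \<Longrightarrow> P z (x \<oplus>\<^bsub>B\<^esub> y) = P z x \<oplus>\<^bsub>R\<^esub> P z y"
  using quad P_sym[of z] P_sym[of x z] P_sym[of y z] B.a_closed[of x y]
  by (auto simp: quadratic_map_def)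

lemma P_smult [simp]:
  "a \<in> carrier R \<Longrightarrow> x \<in> carrier B \<Longrightarrow> z \<in> carrier B \<Longrightarrow> P (a \<odot>\<^bsub>B\<^esub> x) z = a \<otimes>\<^bsub>R\<^esub> P x z"
  "a \<in> carrier R \<Longrightarrow> x \<in> carrier B \<Longrightarrow> z \<in> carrier B \<Longrightarrow> P z (a \<odot>\<^bsub>B\<^esub> x) = a \<otimes>\<^bsub>R\<^esub> P z x"
  using quad P_sym[of z] P_sym[of x z] by (auto simp: quadratic_map_def)

lemma P_zero [simp]:
  "x \<in> carrier B \<Longrightarrow> P \<zero>\<^bsub>B\<^esub> x = \<zero>\<^bsub>R\<^esub>" "x \<in> carrier B \<Longrightarrow> P x \<zero>\<^bsub>B\<^esub> = \<zero>\<^bsub>R\<^esub>"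
  using P_smult[of "\<zero>\<^bsub>R\<^esub>" "\<zero>\<^bsub>B\<^esub>" x] by auto

lemma P_minus [simp]:
  assumes "x \<in> carrier B" "z \<in> carrier B"
  shows "P (\<ominus>\<^bsub>B\<^esub> x) z = \<ominus>\<^bsub>R\<^esub> P x z" "P z (\<ominus>\<^bsub>B\<^esub> x) = \<ominus>\<^bsub>R\<^esub> P z x"
  using P_add[of "\<ominus>\<^bsub>B\<^esub> x" x z] assms by (auto simp: R.eq_minus_iff B.l_neg simp del: P_add)

lemma P_diff [simp]:
  "x \<in> carrier B \<Longrightarrow> y \<in> carrier B \<Longrightarrow> z \<in> carrier B \<Longrightarrow> P (x \<ominus>\<^bsub>B\<^esub> y) z = P x z \<ominus>\<^bsub>R\<^esub> P y z"
  "x \<in> carrier B \<Longrightarrow> y \<in> carrier B \<Longrightarrow> z \<in> carrier B \<Longrightarrow> P z (x \<ominus>\<^bsub>B\<^esub> y) = P z x \<ominus>\<^bsub>R\<^esub> P z y"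
  by (simp_all add: B.minus_eq R.minus_eq)

lemma smult_diff:
  "a \<in> carrier R \<Longrightarrow> x \<in> carrier B \<Longrightarrow> y \<in> carrier B \<Longrightarrow>
    a \<odot>\<^bsub>B\<^esub> (x \<ominus>\<^bsub>B\<^esub> y) = a \<odot>\<^bsub>B\<^esub> x \<ominus>\<^bsub>B\<^esub> a \<odot>\<^bsub>B\<^esub> y"
  "a \<in> carrier R \<Longrightarrow> b \<in> carrier R \<Longrightarrow> x \<in> carrier B \<Longrightarrow>
    (a \<ominus>\<^bsub>R\<^esub> b) \<odot>\<^bsub>B\<^esub> x = a \<odot>\<^bsub>B\<^esub> x \<ominus>\<^bsub>B\<^esub> b \<odot>\<^bsub>B\<^esub> x"
  by (simp_all add: B.minus_eq R.minus_eq M.smult_r_distr M.smult_l_distr M.smult_r_minus M.smult_l_minus)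

lemma smult_smult: "a \<in> carrier R \<Longrightarrow> b \<in> carrier R \<Longrightarrow> x \<in> carrier B \<Longrightarrow>
    a \<odot>\<^bsub>B\<^esub> (b \<odot>\<^bsub>B\<^esub> x) = (a \<otimes>\<^bsub>R\<^esub> b) \<odot>\<^bsub>B\<^esub> x"
  by (simp add: M.smult_assoc1)

lemmas expand = M.smult_r_distr M.smult_l_distr smult_diff smult_smult B.l_distr B.r_distr
  B.mult_diff_distrib B.diff_mult_distrib B.diff_simps B.m_assoc
lemmas expand_R = R.l_distr R.r_distr R.mult_diff_distrib R.diff_mult_distrib R.diff_simps R.m_ac

lemma comm_closed [simp]: "x \<in> carrier B \<Longrightarrow> y \<in> carrier B \<Longrightarrow> comm x y \<in> carrier B"
  by (simp add: comm_def)

lemma tau_closed [simp]: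
  "x \<in> carrier B \<Longrightarrow> y \<in> carrier B \<Longrightarrow> z \<in> carrier B \<Longrightarrow> tau x y z \<in> carrier R"
  by (simp add: tau_def)

lemma conj_closed [simp]: "x \<in> carrier B \<Longrightarrow> conj x \<in> carrier B"
  by (simp add: conj_def)

lemma comm_add:
  "x \<in> carrier B \<Longrightarrow> y \<in> carrier B \<Longrightarrow> z \<in> carrier B \<Longrightarrow> comm (x \<oplus>\<^bsub>B\<^esub> y) z = comm x z \<oplus>\<^bsub>B\<^esub> comm y z"
  "x \<in> carrier B \<Longrightarrow> y \<in> carrier B \<Longrightarrow> z \<in> carrier B \<Longrightarrow> comm z (x \<oplus>\<^bsub>B\<^esub> y) = comm z x \<oplus>\<^bsub>B\<^esub> comm z y"
  by (simp_all add: comm_def expand)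

lemma comm_smult:
  "a \<in> carrier R \<Longrightarrow> x \<in> carrier B \<Longrightarrow> z \<in> carrier B \<Longrightarrow> comm (a \<odot>\<^bsub>B\<^esub> x) z = a \<odot>\<^bsub>B\<^esub> comm x z"
  "a \<in> carrier R \<Longrightarrow> x \<in> carrier B \<Longrightarrow> z \<in> carrier B \<Longrightarrow> comm z (a \<odot>\<^bsub>B\<^esub> x) = a \<odot>\<^bsub>B\<^esub> comm z x"
  by (simp_all add: comm_def expand)

lemma comm_self: "x \<in> carrier B \<Longrightarrow> comm x x = \<zero>\<^bsub>B\<^esub>"
  by (simp add: comm_def B.diff_self)

lemma comm_swap: "x \<in> carrier B \<Longrightarrow> y \<in> carrier B \<Longrightarrow> comm y x = \<ominus>\<^bsub>B\<^esub> comm x y"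
  by (simp add: comm_def B.diff_simps)

lemma comm_one:
  "x \<in> carrier B \<Longrightarrow> comm x \<one>\<^bsub>B\<^esub> = \<zero>\<^bsub>B\<^esub>" "x \<in> carrier B \<Longrightarrow> comm \<one>\<^bsub>B\<^esub> x = \<zero>\<^bsub>B\<^esub>"
  by (simp_all add: comm_def B.diff_self)

text \<open>The left side and the parenthesized part of the right side are the coefficients of
  \<open>e\<close> in the two bracketings expanded in \<open>splits_idem\<close>; they differ by a
  double commutator.\<close>

lemma comm_assoc_defect:
  assumes "x \<in> carrier B" "y \<in> carrier B" "z \<in> carrier B"
  shows "z \<otimes>\<^bsub>B\<^esub> comm x y \<oplus>\<^bsub>B\<^esub> comm (y \<otimes>\<^bsub>B\<^esub> x) z =
    (comm y z \<otimes>\<^bsub>B\<^esub> x \<oplus>\<^bsub>B\<^esub> comm x (z \<otimes>\<^bsub>B\<^esub> y)) \<oplus>\<^bsub>B\<^esub> comm y (comm x z)"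
  using assms by (simp add: comm_def B.mult_diff_distrib B.diff_mult_distrib B.diff_simps B.m_assoc)

text \<open>The Jacobi identity in derivation form. It makes the coefficients of the square of
  \<open>e\<close> differ by the same double commutator.\<close>

lemma comm_jacobi:
  assumes "x \<in> carrier B" "y \<in> carrier B" "z \<in> carrier B"
  shows "comm x (comm y z) = comm (comm x y) z \<oplus>\<^bsub>B\<^esub> comm y (comm x z)"
  using assms by (simp add: comm_def B.mult_diff_distrib B.diff_mult_distrib B.diff_simps B.m_assoc)

end

text \<open>The identities with values in the ground ring, kept apart from Cayley-Hamilton: they
  descend through an injective map of rings, while an identity in the algebra is obtained from the
  nondegenerate form.\<close>

locale trace_alg = quad_alg +
  assumes N_one: "N \<one>\<^bsub>B\<^esub> = \<one>\<^bsub>R\<^esub>"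
    and trace_mult: "\<And>x y. x \<in> carrier B \<Longrightarrow> y \<in> carrier B \<Longrightarrow>
      P x y = Tr x \<otimes>\<^bsub>R\<^esub> Tr y \<ominus>\<^bsub>R\<^esub> Tr (x \<otimes>\<^bsub>B\<^esub> y)"
begin

lemma Tr_mult: "x \<in> carrier B \<Longrightarrow> y \<in> carrier B \<Longrightarrow>
    Tr (x \<otimes>\<^bsub>B\<^esub> y) = Tr x \<otimes>\<^bsub>R\<^esub> Tr y \<ominus>\<^bsub>R\<^esub> P x y"
  using trace_mult[of x y] by (simp add: R.diff_simps)

lemma Tr_comm: "x \<in> carrier B \<Longrightarrow> y \<in> carrier B \<Longrightarrow> Tr (x \<otimes>\<^bsub>B\<^esub> y) = Tr (y \<otimes>\<^bsub>B\<^esub> x)"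
  by (simp add: Tr_mult P_sym[of y x] R.m_comm)

lemma Tr_one: "Tr \<one>\<^bsub>B\<^esub> = \<one>\<^bsub>R\<^esub> \<oplus>\<^bsub>R\<^esub> \<one>\<^bsub>R\<^esub>"
proof -
  \<comment> \<open>Evaluating \<open>N\<close> at \<open>1 + 1\<close> as the square of the scalar
    two gives \<open>P 1 1 = 4 - 2\<close>.\<close>
  have "N (\<one>\<^bsub>B\<^esub> \<oplus>\<^bsub>B\<^esub> \<one>\<^bsub>B\<^esub>) = N ((\<one>\<^bsub>R\<^esub> \<oplus>\<^bsub>R\<^esub> \<one>\<^bsub>R\<^esub>) \<odot>\<^bsub>B\<^esub> \<one>\<^bsub>B\<^esub>)"
    by (simp add: M.smult_l_distr)
  also have "\<dots> = (\<one>\<^bsub>R\<^esub> \<oplus>\<^bsub>R\<^esub> \<one>\<^bsub>R\<^esub>) \<otimes>\<^bsub>R\<^esub> (\<one>\<^bsub>R\<^esub> \<oplus>\<^bsub>R\<^esub> \<one>\<^bsub>R\<^esub>)"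
    by (simp add: N_smult N_one)
  finally show ?thesis
    by (simp add: polar_form_def N_one R.diff_simps R.l_distr R.r_distr)
qed

lemma tau_one: "x \<in> carrier B \<Longrightarrow> y \<in> carrier B \<Longrightarrow> tau x y \<one>\<^bsub>B\<^esub> = \<zero>\<^bsub>R\<^esub>"
  by (simp add: tau_def comm_def Tr_comm[of x y] R.diff_self)

text \<open>The trace of \<open>x y y - y x y\<close> vanishes by cyclicity, and the product of the
  traces vanishes because a commutator has trace zero.\<close>

lemma tau_23:
  assumes "x \<in> carrier B" "y \<in> carrier B" shows "tau x y y = \<zero>\<^bsub>R\<^esub>"
proof -
  have "Tr (comm x y \<otimes>\<^bsub>B\<^esub> y) = \<zero>\<^bsub>R\<^esub>"
    using assms Tr_comm[of "x \<otimes>\<^bsub>B\<^esub> y" y]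
    by (simp add: comm_def B.diff_mult_distrib B.m_assoc R.diff_self)
  then show ?thesis
    using assms trace_mult[of "comm x y" y] tau_one[of x y] by (simp add: tau_def R.diff_self)
qed

lemma tau_swap12: "x \<in> carrier B \<Longrightarrow> y \<in> carrier B \<Longrightarrow> z \<in> carrier B \<Longrightarrow> tau y x z = \<ominus>\<^bsub>R\<^esub> tau x y z"
  by (simp add: tau_def comm_swap[of x y])

lemma tau_13: "x \<in> carrier B \<Longrightarrow> y \<in> carrier B \<Longrightarrow> tau x y x = \<zero>\<^bsub>R\<^esub>"
  using tau_swap12[of y x x] tau_23[of y x] by simp

text \<open>Polarization of \<open>tau_23\<close>. Vanishing on repeated arguments is the primary
  fact, since skew symmetry does not imply it in characteristic two.\<close>

lemma tau_swap23:
  assumes "x \<in> carrier B" "y \<in> carrier B" "z \<in> carrier B"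
  shows "tau x z y = \<ominus>\<^bsub>R\<^esub> tau x y z"
  using tau_23[of x "y \<oplus>\<^bsub>B\<^esub> z"] tau_23[of x y] tau_23[of x z] assms
  by (simp add: tau_def comm_add R.eq_minus_iff R.a_comm)

lemma tau_cyc:
  assumes "x \<in> carrier B" "y \<in> carrier B" "z \<in> carrier B"
  shows "tau y z x = tau x y z"
  using tau_swap23[of y x z] tau_swap12[of x y z] assms by simp

end

locale ch_alg = trace_alg +
  assumes CH: "\<And>x. x \<in> carrier B \<Longrightarrow> x \<otimes>\<^bsub>B\<^esub> x = Tr x \<odot>\<^bsub>B\<^esub> x \<ominus>\<^bsub>B\<^esub> N x \<odot>\<^bsub>B\<^esub> \<one>\<^bsub>B\<^esub>"
begin

lemma CH_linear:
  assumes "x \<in> carrier B" "y \<in> carrier B"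
  shows "x \<otimes>\<^bsub>B\<^esub> y = (Tr x \<odot>\<^bsub>B\<^esub> y \<oplus>\<^bsub>B\<^esub> Tr y \<odot>\<^bsub>B\<^esub> x) \<ominus>\<^bsub>B\<^esub> (P x y \<odot>\<^bsub>B\<^esub> \<one>\<^bsub>B\<^esub> \<oplus>\<^bsub>B\<^esub> y \<otimes>\<^bsub>B\<^esub> x)"
proof -
  \<comment> \<open>\<open>?s\<close> holds the pure terms in \<open>x\<close> and in
    \<open>y\<close>. Cayley-Hamilton evaluates it, and it is cancelled from the equation for
    \<open>x + y\<close>.\<close>
  let ?s = "x \<otimes>\<^bsub>B\<^esub> x \<oplus>\<^bsub>B\<^esub> y \<otimes>\<^bsub>B\<^esub> y \<oplus>\<^bsub>B\<^esub> (N x \<odot>\<^bsub>B\<^esub> \<one>\<^bsub>B\<^esub> \<oplus>\<^bsub>B\<^esub> N y \<odot>\<^bsub>B\<^esub> \<one>\<^bsub>B\<^esub>)"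
  have x: "x \<otimes>\<^bsub>B\<^esub> x \<oplus>\<^bsub>B\<^esub> N x \<odot>\<^bsub>B\<^esub> \<one>\<^bsub>B\<^esub> = Tr x \<odot>\<^bsub>B\<^esub> x" if "x \<in> carrier B" for x
    using CH[OF that] that by (simp add: B.diff_simps)
  have s: "?s = Tr x \<odot>\<^bsub>B\<^esub> x \<oplus>\<^bsub>B\<^esub> Tr y \<odot>\<^bsub>B\<^esub> y"
    using assms by (simp add: x[symmetric] B.a_ac)
  have "(x \<otimes>\<^bsub>B\<^esub> y \<oplus>\<^bsub>B\<^esub> (P x y \<odot>\<^bsub>B\<^esub> \<one>\<^bsub>B\<^esub> \<oplus>\<^bsub>B\<^esub> y \<otimes>\<^bsub>B\<^esub> x)) \<oplus>\<^bsub>B\<^esub> ?s =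
      (x \<oplus>\<^bsub>B\<^esub> y) \<otimes>\<^bsub>B\<^esub> (x \<oplus>\<^bsub>B\<^esub> y) \<oplus>\<^bsub>B\<^esub> N (x \<oplus>\<^bsub>B\<^esub> y) \<odot>\<^bsub>B\<^esub> \<one>\<^bsub>B\<^esub>"
    using assms by (simp add: N_add M.smult_l_distr B.l_distr B.r_distr B.a_ac)
  also have "\<dots> = Tr (x \<oplus>\<^bsub>B\<^esub> y) \<odot>\<^bsub>B\<^esub> (x \<oplus>\<^bsub>B\<^esub> y)"
    using assms by (intro x) simp
  also have "\<dots> = (Tr x \<odot>\<^bsub>B\<^esub> y \<oplus>\<^bsub>B\<^esub> Tr y \<odot>\<^bsub>B\<^esub> x) \<oplus>\<^bsub>B\<^esub> ?s"
    unfolding s using assms by (simp add: M.smult_l_distr M.smult_r_distr B.a_ac)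
  finally show ?thesis
    using assms by (simp add: B.eq_diff_eq)
qed

lemma conj_add: "x \<in> carrier B \<Longrightarrow> y \<in> carrier B \<Longrightarrow> conj (x \<oplus>\<^bsub>B\<^esub> y) = conj x \<oplus>\<^bsub>B\<^esub> conj y"
  by (simp add: conj_def expand)

lemma conj_smult: "a \<in> carrier R \<Longrightarrow> x \<in> carrier B \<Longrightarrow> conj (a \<odot>\<^bsub>B\<^esub> x) = a \<odot>\<^bsub>B\<^esub> conj x"
  by (simp add: conj_def expand)

lemma conj_conj: "x \<in> carrier B \<Longrightarrow> conj (conj x) = x"
  by (simp add: conj_def Tr_one expand expand_R)

lemma conj_one: "conj \<one>\<^bsub>B\<^esub> = \<one>\<^bsub>B\<^esub>"
  by (simp add: conj_def Tr_one expand)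

lemma mult_conj: "x \<in> carrier B \<Longrightarrow> x \<otimes>\<^bsub>B\<^esub> conj x = N x \<odot>\<^bsub>B\<^esub> \<one>\<^bsub>B\<^esub>"
  using CH[of x] by (simp add: conj_def expand)

lemma conj_mult_self: "x \<in> carrier B \<Longrightarrow> conj x \<otimes>\<^bsub>B\<^esub> x = N x \<odot>\<^bsub>B\<^esub> \<one>\<^bsub>B\<^esub>"
  using CH[of x] by (simp add: conj_def expand)

lemma conj_mult:
  assumes "x \<in> carrier B" "y \<in> carrier B"
  shows "conj (x \<otimes>\<^bsub>B\<^esub> y) = conj y \<otimes>\<^bsub>B\<^esub> conj x"
proof -
  have "x \<otimes>\<^bsub>B\<^esub> y \<oplus>\<^bsub>B\<^esub> (P x y \<odot>\<^bsub>B\<^esub> \<one>\<^bsub>B\<^esub> \<oplus>\<^bsub>B\<^esub> y \<otimes>\<^bsub>B\<^esub> x) = Tr x \<odot>\<^bsub>B\<^esub> y \<oplus>\<^bsub>B\<^esub> Tr y \<odot>\<^bsub>B\<^esub> x"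
    using assms CH_linear[of x y] by (simp add: B.eq_diff_eq)
  \<comment> \<open>Adding the scalar \<open>Tr x Tr y\<close> to both sides turns the linearized
    Cayley-Hamilton identity into the expansion of \<open>conj y conj x\<close>.\<close>
  from arg_cong[OF this, of "\<lambda>z. z \<oplus>\<^bsub>B\<^esub> (Tr x \<otimes>\<^bsub>R\<^esub> Tr y) \<odot>\<^bsub>B\<^esub> \<one>\<^bsub>B\<^esub>"] show ?thesis
    using assms by (simp add: conj_def Tr_mult expand expand_R)
qed

text \<open>The usual derivation polarizes multiplicativity of the norm, which is proved below from
  a frame. Arguing from Cayley-Hamilton for \<open>y\<close> makes the identity available in the
  source algebra of an isometry, where no frame is given.\<close>

lemma P_mult_right:
  assumes "x \<in> carrier B" "y \<in> carrier B"
  shows "P (x \<otimes>\<^bsub>B\<^esub> y) y = N y \<otimes>\<^bsub>R\<^esub> Tr x"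
proof -
  have "(x \<otimes>\<^bsub>B\<^esub> y) \<otimes>\<^bsub>B\<^esub> y = Tr y \<odot>\<^bsub>B\<^esub> (x \<otimes>\<^bsub>B\<^esub> y) \<ominus>\<^bsub>B\<^esub> N y \<odot>\<^bsub>B\<^esub> x"
    using assms by (simp add: B.m_assoc CH[of y] expand)
  then show ?thesis
    using assms trace_mult[of "x \<otimes>\<^bsub>B\<^esub> y" y] by (simp add: expand_R)
qed

lemma P_mult_left:
  assumes "x \<in> carrier B" "y \<in> carrier B"
  shows "P (y \<otimes>\<^bsub>B\<^esub> x) y = N y \<otimes>\<^bsub>R\<^esub> Tr x"
proof -
  have "Tr ((y \<otimes>\<^bsub>B\<^esub> x) \<otimes>\<^bsub>B\<^esub> y) = Tr ((x \<otimes>\<^bsub>B\<^esub> y) \<otimes>\<^bsub>B\<^esub> y)"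
    using assms Tr_comm[of y "x \<otimes>\<^bsub>B\<^esub> y"] by (simp add: B.m_assoc)
  then have "P (y \<otimes>\<^bsub>B\<^esub> x) y = P (x \<otimes>\<^bsub>B\<^esub> y) y"
    using assms trace_mult[of "x \<otimes>\<^bsub>B\<^esub> y" y] trace_mult[of "y \<otimes>\<^bsub>B\<^esub> x" y] Tr_comm[of x y] by simp
  then show ?thesis
    using P_mult_right[OF assms] by simp
qed

end

section \<open>Frames and nondegeneracy of the polar form\<close>

locale frame_trace_alg = trace_alg +
  fixes a b c :: 'b
  assumes a [simp]: "a \<in> carrier B" and b [simp]: "b \<in> carrier B" and c [simp]: "c \<in> carrier B"
    and tau_unit: "tau a b c \<in> Units R"
    and span: "\<And>w. w \<in> carrier B \<Longrightarrow> \<exists>r0\<in>carrier R. \<exists>r1\<in>carrier R. \<exists>r2\<in>carrier R. \<exists>r3\<in>carrier R.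
      w = r0 \<odot>\<^bsub>B\<^esub> \<one>\<^bsub>B\<^esub> \<oplus>\<^bsub>B\<^esub> (r1 \<odot>\<^bsub>B\<^esub> a \<oplus>\<^bsub>B\<^esub> (r2 \<odot>\<^bsub>B\<^esub> b \<oplus>\<^bsub>B\<^esub> r3 \<odot>\<^bsub>B\<^esub> c))"
begin

lemma span_induct:
  assumes "w \<in> carrier B"
    and "Q \<one>\<^bsub>B\<^esub>" "Q a" "Q b" "Q c"
    and "\<And>x y. x \<in> carrier B \<Longrightarrow> y \<in> carrier B \<Longrightarrow> Q x \<Longrightarrow> Q y \<Longrightarrow> Q (x \<oplus>\<^bsub>B\<^esub> y)"
    and "\<And>r x. r \<in> carrier R \<Longrightarrow> x \<in> carrier B \<Longrightarrow> Q x \<Longrightarrow> Q (r \<odot>\<^bsub>B\<^esub> x)"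
  shows "Q w"
  using span[OF assms(1)] assms(2-7) by (auto intro!: assms(6))

lemma tau_linear:
  assumes "x \<in> carrier B" "y \<in> carrier B" "z \<in> carrier B"
  shows "w \<in> carrier B \<Longrightarrow> tau x y (z \<oplus>\<^bsub>B\<^esub> w) = tau x y z \<oplus>\<^bsub>R\<^esub> tau x y w"
    and "r \<in> carrier R \<Longrightarrow> tau x y (r \<odot>\<^bsub>B\<^esub> z) = r \<otimes>\<^bsub>R\<^esub> tau x y z"
  using assms by (simp_all add: tau_def)

lemma P_tau: "x \<in> carrier B \<Longrightarrow> y \<in> carrier B \<Longrightarrow> z \<in> carrier B \<Longrightarrow> P z (comm x y) = tau x y z"
  by (simp add: tau_def P_sym)

text \<open>The commutator \<open>[a, b]\<close> is orthogonal to \<open>1\<close>, \<open>a\<close>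
  and \<open>b\<close>, so pairing with it isolates the coefficient of \<open>c\<close>; cyclicity
  of \<open>tau\<close> serves the other two coordinates.\<close>

lemma coordinates:
  assumes r: "r0 \<in> carrier R" "r1 \<in> carrier R" "r2 \<in> carrier R" "r3 \<in> carrier R"
    and w: "w = r0 \<odot>\<^bsub>B\<^esub> \<one>\<^bsub>B\<^esub> \<oplus>\<^bsub>B\<^esub> (r1 \<odot>\<^bsub>B\<^esub> a \<oplus>\<^bsub>B\<^esub> (r2 \<odot>\<^bsub>B\<^esub> b \<oplus>\<^bsub>B\<^esub> r3 \<odot>\<^bsub>B\<^esub> c))"
  shows "P w (comm a b) = r3 \<otimes>\<^bsub>R\<^esub> tau a b c"
    and "P w (comm b c) = r1 \<otimes>\<^bsub>R\<^esub> tau a b c"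
    and "P w (comm c a) = r2 \<otimes>\<^bsub>R\<^esub> tau a b c"
  using r tau_cyc[of a b c] tau_cyc[of b c a] unfolding w
  by (simp_all add: P_tau tau_linear tau_one tau_13 tau_23)

lemma scalar_if_orthogonal:
  assumes w: "w \<in> carrier B"
    and "P w (comm a b) = \<zero>\<^bsub>R\<^esub>" "P w (comm b c) = \<zero>\<^bsub>R\<^esub>" "P w (comm c a) = \<zero>\<^bsub>R\<^esub>"
  shows "\<exists>r\<in>carrier R. w = r \<odot>\<^bsub>B\<^esub> \<one>\<^bsub>B\<^esub>"
proof -
  obtain r0 r1 r2 r3 where r: "r0 \<in> carrier R" "r1 \<in> carrier R" "r2 \<in> carrier R" "r3 \<in> carrier R"
    and eq: "w = r0 \<odot>\<^bsub>B\<^esub> \<one>\<^bsub>B\<^esub> \<oplus>\<^bsub>B\<^esub> (r1 \<odot>\<^bsub>B\<^esub> a \<oplus>\<^bsub>B\<^esub> (r2 \<odot>\<^bsub>B\<^esub> b \<oplus>\<^bsub>B\<^esub> r3 \<odot>\<^bsub>B\<^esub> c))"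
    using span[OF w] by blast
  have "r1 = \<zero>\<^bsub>R\<^esub>" "r2 = \<zero>\<^bsub>R\<^esub>" "r3 = \<zero>\<^bsub>R\<^esub>"
    using coordinates[OF r eq] assms(2-4) r R.Units_mult_eq_zero[OF tau_unit] by metis+
  then show ?thesis using r eq by auto
qed

lemma scalar_zero:
  assumes r: "r \<in> carrier R" and "\<And>z. z \<in> carrier B \<Longrightarrow> P (r \<odot>\<^bsub>B\<^esub> \<one>\<^bsub>B\<^esub>) z = \<zero>\<^bsub>R\<^esub>"
  shows "r = \<zero>\<^bsub>R\<^esub>"
proof -
  \<comment> \<open>The pairing of \<open>1\<close> with itself is two, possibly zero. The element
    \<open>[a, b] c\<close> has trace minus \<open>tau a b c\<close>, a unit.\<close>
  let ?z = "comm a b \<otimes>\<^bsub>B\<^esub> c"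
  have T: "Tr ?z = \<ominus>\<^bsub>R\<^esub> tau a b c"
    using tau_one[of a b] by (simp add: Tr_mult tau_def R.minus_eq)
  have "r \<otimes>\<^bsub>R\<^esub> Tr ?z = \<zero>\<^bsub>R\<^esub>"
    using assms(2)[of ?z] r P_sym[of "\<one>\<^bsub>B\<^esub>" ?z] by simp
  then have "r \<otimes>\<^bsub>R\<^esub> tau a b c = \<zero>\<^bsub>R\<^esub>"
    using r unfolding T by (simp add: R.r_minus R.minus_eq_iff)
  then show ?thesis using R.Units_mult_eq_zero[OF tau_unit r] by simp
qed

text \<open>Orthogonality to the frame spreads to the whole algebra. Pairing with commutators leaves
  only a scalar, and \<open>scalar_zero\<close> removes it.\<close>

lemma nondegenerate:
  assumes w: "w \<in> carrier B"
    and "P w \<one>\<^bsub>B\<^esub> = \<zero>\<^bsub>R\<^esub>" "P w a = \<zero>\<^bsub>R\<^esub>" "P w b = \<zero>\<^bsub>R\<^esub>" "P w c = \<zero>\<^bsub>R\<^esub>"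
  shows "w = \<zero>\<^bsub>B\<^esub>"
proof -
  have orth: "P w z = \<zero>\<^bsub>R\<^esub>" if "z \<in> carrier B" for z
    using that by (rule span_induct) (use assms in auto)
  obtain r where r: "r \<in> carrier R" "w = r \<odot>\<^bsub>B\<^esub> \<one>\<^bsub>B\<^esub>"
    using scalar_if_orthogonal[OF w] orth by auto
  then have "r = \<zero>\<^bsub>R\<^esub>"
    using orth by - (rule scalar_zero, auto)
  then show ?thesis using r by simp
qed

text \<open>With \<open>span\<close>, this makes \<open>1\<close>, \<open>a\<close>,
  \<open>b\<close>, \<open>c\<close> a basis. The coefficient of \<open>1\<close> is invisible to
  commutators and is therefore treated last.\<close>

lemma independent:
  assumes r: "r0 \<in> carrier R" "r1 \<in> carrier R" "r2 \<in> carrier R" "r3 \<in> carrier R"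
    and eq: "r0 \<odot>\<^bsub>B\<^esub> \<one>\<^bsub>B\<^esub> \<oplus>\<^bsub>B\<^esub> (r1 \<odot>\<^bsub>B\<^esub> a \<oplus>\<^bsub>B\<^esub> (r2 \<odot>\<^bsub>B\<^esub> b \<oplus>\<^bsub>B\<^esub> r3 \<odot>\<^bsub>B\<^esub> c)) = \<zero>\<^bsub>B\<^esub>"
  shows "r0 = \<zero>\<^bsub>R\<^esub>" "r1 = \<zero>\<^bsub>R\<^esub>" "r2 = \<zero>\<^bsub>R\<^esub>" "r3 = \<zero>\<^bsub>R\<^esub>"
proof -
  show 123: "r1 = \<zero>\<^bsub>R\<^esub>" "r2 = \<zero>\<^bsub>R\<^esub>" "r3 = \<zero>\<^bsub>R\<^esub>"
    using coordinates[OF r eq[symmetric]] r R.Units_mult_eq_zero[OF tau_unit] by auto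
  then have "r0 \<odot>\<^bsub>B\<^esub> \<one>\<^bsub>B\<^esub> = \<zero>\<^bsub>B\<^esub>"
    using eq r by simp
  then show "r0 = \<zero>\<^bsub>R\<^esub>"
    using r by - (rule scalar_zero, auto)
qed

lemma scalar_faithful:
  assumes "r \<in> carrier R" "s \<in> carrier R" "r \<odot>\<^bsub>B\<^esub> \<one>\<^bsub>B\<^esub> = s \<odot>\<^bsub>B\<^esub> \<one>\<^bsub>B\<^esub>"
  shows "r = s"
proof -
  have "(r \<ominus>\<^bsub>R\<^esub> s) \<odot>\<^bsub>B\<^esub> \<one>\<^bsub>B\<^esub> = \<zero>\<^bsub>B\<^esub>"
    using assms by (simp add: smult_diff B.diff_self)
  then have "r \<ominus>\<^bsub>R\<^esub> s = \<zero>\<^bsub>R\<^esub>"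
    using assms by - (rule scalar_zero, auto)
  then show ?thesis using assms by (simp add: R.diff_eq_eq)
qed

end

locale frame_alg = frame_trace_alg R B N a b c + ch_alg R B N
  for R :: "'r ring" and B :: "('r, 'q) module" and N a b c
begin

text \<open>The product of \<open>x y\<close> with its conjugate is
  \<open>x (y conj y) conj x\<close>, and the inner scalar moves out.\<close>

lemma N_mult:
  assumes "x \<in> carrier B" "y \<in> carrier B"
  shows "N (x \<otimes>\<^bsub>B\<^esub> y) = N x \<otimes>\<^bsub>R\<^esub> N y"
proof (rule scalar_faithful)
  have "N (x \<otimes>\<^bsub>B\<^esub> y) \<odot>\<^bsub>B\<^esub> \<one>\<^bsub>B\<^esub> = (x \<otimes>\<^bsub>B\<^esub> (y \<otimes>\<^bsub>B\<^esub> conj y)) \<otimes>\<^bsub>B\<^esub> conj x"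
    using assms by (simp add: mult_conj[symmetric] conj_mult B.m_assoc)
  also have "\<dots> = (N x \<otimes>\<^bsub>R\<^esub> N y) \<odot>\<^bsub>B\<^esub> \<one>\<^bsub>B\<^esub>"
    using assms by (simp add: mult_conj smult_smult R.m_comm)
  finally show "N (x \<otimes>\<^bsub>B\<^esub> y) \<odot>\<^bsub>B\<^esub> \<one>\<^bsub>B\<^esub> = (N x \<otimes>\<^bsub>R\<^esub> N y) \<odot>\<^bsub>B\<^esub> \<one>\<^bsub>B\<^esub>" .
qed (use assms in auto)

lemma N_conj:
  assumes "x \<in> carrier B"
  shows "N (conj x) = N x"
proof (rule scalar_faithful)
  show "N (conj x) \<odot>\<^bsub>B\<^esub> \<one>\<^bsub>B\<^esub> = N x \<odot>\<^bsub>B\<^esub> \<one>\<^bsub>B\<^esub>"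
    using assms mult_conj[of "conj x"] conj_mult_self[of x] by (simp add: conj_conj)
qed (use assms in auto)

text \<open>By cyclicity, \<open>k [x, y]\<close> is orthogonal to all commutators and so a scalar.
  Applied to \<open>[a, b]\<close> and to \<open>[a, a b] = a [a, b]\<close>, this makes a multiple
  of \<open>a\<close> a scalar, so by independence the multiple is zero; what remains is
  \<open>k tau a b c = 0\<close>.\<close>

lemma smult_comm_zero:
  assumes k: "k \<in> carrier R"
    and triple: "\<And>x y z. x \<in> carrier B \<Longrightarrow> y \<in> carrier B \<Longrightarrow> z \<in> carrier B \<Longrightarrow>
      k \<odot>\<^bsub>B\<^esub> comm y (comm x z) = \<zero>\<^bsub>B\<^esub>"
  shows "k = \<zero>\<^bsub>R\<^esub>"
proof -
  have kP: "k \<otimes>\<^bsub>R\<^esub> P (comm x y) (comm z w) = \<zero>\<^bsub>R\<^esub>"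
    if "x \<in> carrier B" "y \<in> carrier B" "z \<in> carrier B" "w \<in> carrier B" for x y z w
  proof -
    have "P (comm x y) (comm z w) = P (comm y (comm z w)) x"
      using tau_cyc[of x y "comm z w"] that by (simp add: tau_def)
    then have "k \<otimes>\<^bsub>R\<^esub> P (comm x y) (comm z w) = P (k \<odot>\<^bsub>B\<^esub> comm y (comm z w)) x"
      using k that by simp
    then show ?thesis using triple that by simp
  qed
  have scalar: "\<exists>r\<in>carrier R. k \<odot>\<^bsub>B\<^esub> comm x y = r \<odot>\<^bsub>B\<^esub> \<one>\<^bsub>B\<^esub>" if "x \<in> carrier B" "y \<in> carrier B" for x y
    using k that kP by (intro scalar_if_orthogonal) auto
  obtain r where r: "r \<in> carrier R" "k \<odot>\<^bsub>B\<^esub> comm a b = r \<odot>\<^bsub>B\<^esub> \<one>\<^bsub>B\<^esub>"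
    using scalar[of a b] by auto
  obtain s where s: "s \<in> carrier R" "k \<odot>\<^bsub>B\<^esub> comm a (a \<otimes>\<^bsub>B\<^esub> b) = s \<odot>\<^bsub>B\<^esub> \<one>\<^bsub>B\<^esub>"
    using scalar[of a "a \<otimes>\<^bsub>B\<^esub> b"] by auto
  have "comm a (a \<otimes>\<^bsub>B\<^esub> b) = a \<otimes>\<^bsub>B\<^esub> comm a b"
    by (simp add: comm_def B.mult_diff_distrib B.m_assoc)
  then have "s \<odot>\<^bsub>B\<^esub> \<one>\<^bsub>B\<^esub> = a \<otimes>\<^bsub>B\<^esub> (k \<odot>\<^bsub>B\<^esub> comm a b)"
    using s k by simp
  also have "\<dots> = r \<odot>\<^bsub>B\<^esub> a"
    using r by simp
  finally have "(\<ominus>\<^bsub>R\<^esub> s) \<odot>\<^bsub>B\<^esub> \<one>\<^bsub>B\<^esub> \<oplus>\<^bsub>B\<^esub> (r \<odot>\<^bsub>B\<^esub> a \<oplus>\<^bsub>B\<^esub> (\<zero>\<^bsub>R\<^esub> \<odot>\<^bsub>B\<^esub> b \<oplus>\<^bsub>B\<^esub> \<zero>\<^bsub>R\<^esub> \<odot>\<^bsub>B\<^esub> c)) = \<zero>\<^bsub>B\<^esub>"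
    using r s by (simp add: M.smult_l_minus B.l_neg)
  then have "r = \<zero>\<^bsub>R\<^esub>"
    using r s by (intro independent(2)[of "\<ominus>\<^bsub>R\<^esub> s" r "\<zero>\<^bsub>R\<^esub>" "\<zero>\<^bsub>R\<^esub>"]) auto
  then have "k \<odot>\<^bsub>B\<^esub> comm a b = \<zero>\<^bsub>B\<^esub>"
    using r by simp
  then have "P (k \<odot>\<^bsub>B\<^esub> comm a b) c = \<zero>\<^bsub>R\<^esub>"
    by simp
  then have "k \<otimes>\<^bsub>R\<^esub> tau a b c = \<zero>\<^bsub>R\<^esub>"
    using k by (simp add: tau_def)
  then show ?thesis
    using R.Units_mult_eq_zero[OF tau_unit k] by simp
qed

end

text \<open>
  A unital isometry \<open>g\<close> mixes an isomorphism and an anti-isomorphism: both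
  \<open>g (x y) - g y g x\<close> and the commutator of \<open>g x\<close> and \<open>g y\<close> are alternating in \<open>x\<close>, \<open>y\<close> and
  orthogonal to \<open>1\<close>, \<open>g x\<close> and \<open>g y\<close>, so the first is a multiple of the second.
\<close>
locale unital_isometry = Q: ch_alg R B N + Q': frame_alg R B' N' a' b' c'
  for R :: "'r ring" and B :: "('r, 'q) module" and N and B' :: "('r, 'q2) module" and N' a' b' c' +
  fixes g :: "'q \<Rightarrow> 'q2"
  assumes g_bij: "bij_betw g (carrier B) (carrier B')"
    and g_add: "\<And>x y. x \<in> carrier B \<Longrightarrow> y \<in> carrier B \<Longrightarrow> g (x \<oplus>\<^bsub>B\<^esub> y) = g x \<oplus>\<^bsub>B'\<^esub> g y"
    and g_smult: "\<And>r x. r \<in> carrier R \<Longrightarrow> x \<in> carrier B \<Longrightarrow> g (r \<odot>\<^bsub>B\<^esub> x) = r \<odot>\<^bsub>B'\<^esub> g x"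
    and g_N: "\<And>x. x \<in> carrier B \<Longrightarrow> N' (g x) = N x"
    and g_one: "g \<one>\<^bsub>B\<^esub> = \<one>\<^bsub>B'\<^esub>"
begin

lemma g_closed [simp]: "x \<in> carrier B \<Longrightarrow> g x \<in> carrier B'"
  using g_bij by (auto simp: bij_betw_def)

lemma g_surj: "y \<in> carrier B' \<Longrightarrow> \<exists>x\<in>carrier B. g x = y"
  using bij_betw_imp_surj_on[OF g_bij] by (metis imageE)

lemma g_diff:
  assumes "x \<in> carrier B" "y \<in> carrier B"
  shows "g (x \<ominus>\<^bsub>B\<^esub> y) = g x \<ominus>\<^bsub>B'\<^esub> g y"
  using assms g_add[of "x \<ominus>\<^bsub>B\<^esub> y" y]
  by (simp add: Q'.B.eq_diff_eq Q.B.diff_add_eq Q.B.add_diff_eq[symmetric] Q.B.diff_self)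

lemma g_P: "x \<in> carrier B \<Longrightarrow> y \<in> carrier B \<Longrightarrow> Q'.P (g x) (g y) = Q.P x y"
  by (simp add: polar_form_def g_N flip: g_add)

lemma g_Tr: "x \<in> carrier B \<Longrightarrow> Q'.Tr (g x) = Q.Tr x"
  using g_P[of x "\<one>\<^bsub>B\<^esub>"] by (simp add: g_one)

text \<open>The reversed product is the reference, so that the coefficient \<open>e\<close> is
  \<open>1\<close> in the multiplicative case and \<open>0\<close> in the product-reversing
  case.\<close>

definition defect where "defect x y = g (x \<otimes>\<^bsub>B\<^esub> y) \<ominus>\<^bsub>B'\<^esub> g y \<otimes>\<^bsub>B'\<^esub> g x"

definition delta where "delta x y z = Q'.P (defect x y) (g z)"

lemma defect_closed [simp]: "x \<in> carrier B \<Longrightarrow> y \<in> carrier B \<Longrightarrow> defect x y \<in> carrier B'"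
  by (simp add: defect_def)

lemma delta_closed [simp]:
  "x \<in> carrier B \<Longrightarrow> y \<in> carrier B \<Longrightarrow> z \<in> carrier B \<Longrightarrow> delta x y z \<in> carrier R"
  by (simp add: delta_def)

lemma defect_add:
  "x \<in> carrier B \<Longrightarrow> y \<in> carrier B \<Longrightarrow> z \<in> carrier B \<Longrightarrow> defect (x \<oplus>\<^bsub>B\<^esub> y) z = defect x z \<oplus>\<^bsub>B'\<^esub> defect y z"
  "x \<in> carrier B \<Longrightarrow> y \<in> carrier B \<Longrightarrow> z \<in> carrier B \<Longrightarrow> defect z (x \<oplus>\<^bsub>B\<^esub> y) = defect z x \<oplus>\<^bsub>B'\<^esub> defect z y"
  by (simp_all add: defect_def g_add Q.B.l_distr Q.B.r_distr Q'.expand)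

lemma defect_smult:
  "r \<in> carrier R \<Longrightarrow> x \<in> carrier B \<Longrightarrow> z \<in> carrier B \<Longrightarrow> defect (r \<odot>\<^bsub>B\<^esub> x) z = r \<odot>\<^bsub>B'\<^esub> defect x z"
  "r \<in> carrier R \<Longrightarrow> x \<in> carrier B \<Longrightarrow> z \<in> carrier B \<Longrightarrow> defect z (r \<odot>\<^bsub>B\<^esub> x) = r \<odot>\<^bsub>B'\<^esub> defect z x"
  by (simp_all add: defect_def g_smult Q'.expand)

text \<open>Squares are determined by trace and norm through Cayley-Hamilton, and \<open>g\<close>
  preserves both.\<close>

lemma defect_self: "x \<in> carrier B \<Longrightarrow> defect x x = \<zero>\<^bsub>B'\<^esub>"
  by (simp add: defect_def Q.CH[of x] Q'.CH[of "g x"] g_diff g_smult g_Tr g_N g_one Q'.B.diff_self)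

lemma defect_one:
  "x \<in> carrier B \<Longrightarrow> defect x \<one>\<^bsub>B\<^esub> = \<zero>\<^bsub>B'\<^esub>" "x \<in> carrier B \<Longrightarrow> defect \<one>\<^bsub>B\<^esub> x = \<zero>\<^bsub>B'\<^esub>"
  by (simp_all add: defect_def g_one Q'.B.diff_self)

lemma defect_swap:
  assumes "x \<in> carrier B" "y \<in> carrier B"
  shows "defect y x = \<ominus>\<^bsub>B'\<^esub> defect x y"
  using assms defect_self[of "x \<oplus>\<^bsub>B\<^esub> y"] defect_self[of x] defect_self[of y]
  by (simp add: defect_add Q'.B.eq_minus_iff Q'.B.a_comm)

lemma delta_swap12:
  "x \<in> carrier B \<Longrightarrow> y \<in> carrier B \<Longrightarrow> z \<in> carrier B \<Longrightarrow> delta y x z = \<ominus>\<^bsub>R\<^esub> delta x y z"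
  by (simp add: delta_def defect_swap[of x y])

lemma delta_one:
  assumes "x \<in> carrier B" "y \<in> carrier B"
  shows "Q'.Tr (defect x y) = \<zero>\<^bsub>R\<^esub>"
proof -
  have "Q'.Tr (defect x y) = Q.Tr (x \<otimes>\<^bsub>B\<^esub> y) \<ominus>\<^bsub>R\<^esub> (Q.Tr y \<otimes>\<^bsub>R\<^esub> Q.Tr x \<ominus>\<^bsub>R\<^esub> Q.P y x)"
    using assms by (simp add: defect_def g_Tr g_P Q'.Tr_mult)
  also have "\<dots> = \<zero>\<^bsub>R\<^esub>"
    using assms by (simp add: Q.Tr_mult Q.P_sym[of y x] Q.R.m_comm Q.R.diff_self)
  finally show ?thesis .
qed

text \<open>Both products pair with \<open>g y\<close> to the norm of \<open>y\<close> times the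
  trace of \<open>x\<close>.\<close>

lemma delta_23: "x \<in> carrier B \<Longrightarrow> y \<in> carrier B \<Longrightarrow> delta x y y = \<zero>\<^bsub>R\<^esub>"
  by (simp add: delta_def defect_def g_P Q.P_mult_right Q'.P_mult_left g_N g_Tr Q.R.diff_self)

lemma delta_swap23:
  assumes "x \<in> carrier B" "y \<in> carrier B" "z \<in> carrier B"
  shows "delta x z y = \<ominus>\<^bsub>R\<^esub> delta x y z"
  using delta_23[of x "y \<oplus>\<^bsub>B\<^esub> z"] delta_23[of x y] delta_23[of x z] assms
  by (simp add: delta_def defect_add g_add Q.R.eq_minus_iff Q.R.a_comm)

lemma delta_13: "x \<in> carrier B \<Longrightarrow> y \<in> carrier B \<Longrightarrow> delta x y x = \<zero>\<^bsub>R\<^esub>"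
  using delta_swap12[of y x x] delta_23[of y x] by simp

lemma delta_cyc:
  assumes "x \<in> carrier B" "y \<in> carrier B" "z \<in> carrier B"
  shows "delta y z x = delta x y z"
  using delta_swap23[of y x z] delta_swap12[of x y z] assms by simp

definition splits :: "'r \<Rightarrow> 'q \<Rightarrow> 'q \<Rightarrow> bool" where
  "splits e x y \<longleftrightarrow> g (x \<otimes>\<^bsub>B\<^esub> y) = g y \<otimes>\<^bsub>B'\<^esub> g x \<oplus>\<^bsub>B'\<^esub> e \<odot>\<^bsub>B'\<^esub> Q'.comm (g x) (g y)"

text \<open>Evaluation on the frame fixes \<open>e\<close> as the ratio of two alternating trilinear
  forms. Nondegeneracy promotes the proportionality from pairings to elements, and bilinearity
  spreads it from the frame.\<close>

lemma ex_splits: "\<exists>e\<in>carrier R. \<forall>x\<in>carrier B. \<forall>y\<in>carrier B. splits e x y"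
proof -
  obtain a where a [simp]: "a \<in> carrier B" "g a = a'" using g_surj[of a'] by auto
  obtain b where b [simp]: "b \<in> carrier B" "g b = b'" using g_surj[of b'] by auto
  obtain c where c [simp]: "c \<in> carrier B" "g c = c'" using g_surj[of c'] by auto
  note tauR [simp] = Q.R.Units_closed[OF Q'.tau_unit]
  define e where "e = delta a b c \<otimes>\<^bsub>R\<^esub> inv\<^bsub>R\<^esub> Q'.tau a' b' c'"
  have e [simp]: "e \<in> carrier R"
    using Q'.tau_unit by (simp add: e_def)
  have e_tau: "e \<otimes>\<^bsub>R\<^esub> Q'.tau a' b' c' = delta a b c"
    using Q'.tau_unit by (simp add: e_def Q.R.m_assoc)
  \<comment> \<open>The error term. It is alternating, bilinear and zero when an argument is
    \<open>1\<close>, so three pairs of frame elements decide whether it vanishes.\<close>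
  define W where "W x y = defect x y \<ominus>\<^bsub>B'\<^esub> e \<odot>\<^bsub>B'\<^esub> Q'.comm (g x) (g y)" for x y
  have W_closed [simp]: "W x y \<in> carrier B'" if "x \<in> carrier B" "y \<in> carrier B" for x y
    using that by (simp add: W_def)
  have W_self: "W x x = \<zero>\<^bsub>B'\<^esub>" if "x \<in> carrier B" for x
    using that by (simp add: W_def defect_self Q'.comm_self Q'.B.diff_self)
  have W_swap: "W y x = \<ominus>\<^bsub>B'\<^esub> W x y" if "x \<in> carrier B" "y \<in> carrier B" for x y
    using that by (simp add: W_def defect_swap[of x y] Q'.comm_swap[of "g x" "g y"] Q'.M.smult_r_minus
        Q'.expand)
  have W_one: "W x \<one>\<^bsub>B\<^esub> = \<zero>\<^bsub>B'\<^esub>" "W \<one>\<^bsub>B\<^esub> x = \<zero>\<^bsub>B'\<^esub>" if "x \<in> carrier B" for x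
    using that by (simp_all add: W_def defect_one g_one Q'.comm_one Q'.B.diff_self)
  have W_add: "W (x \<oplus>\<^bsub>B\<^esub> y) z = W x z \<oplus>\<^bsub>B'\<^esub> W y z" "W z (x \<oplus>\<^bsub>B\<^esub> y) = W z x \<oplus>\<^bsub>B'\<^esub> W z y"
    if "x \<in> carrier B" "y \<in> carrier B" "z \<in> carrier B" for x y z
    using that by (simp_all add: W_def defect_add g_add Q'.comm_add Q'.expand)
  have W_smult: "W (r \<odot>\<^bsub>B\<^esub> x) z = r \<odot>\<^bsub>B'\<^esub> W x z" "W z (r \<odot>\<^bsub>B\<^esub> x) = r \<odot>\<^bsub>B'\<^esub> W z x"
    if "r \<in> carrier R" "x \<in> carrier B" "z \<in> carrier B" for r x z
    using that by (simp_all add: W_def defect_smult g_smult Q'.comm_smult Q'.expand Q.R.m_comm)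
  have W_P: "Q'.P (W x y) (g z) = delta x y z \<ominus>\<^bsub>R\<^esub> e \<otimes>\<^bsub>R\<^esub> Q'.tau (g x) (g y) (g z)"
    if "x \<in> carrier B" "y \<in> carrier B" "z \<in> carrier B" for x y z
    using that by (simp add: W_def delta_def Q'.tau_def)
  have W_Tr: "Q'.Tr (W x y) = \<zero>\<^bsub>R\<^esub>" if "x \<in> carrier B" "y \<in> carrier B" for x y
    using that Q'.tau_one[of "g x" "g y"] by (simp add: W_def delta_one Q'.tau_def Q.R.diff_self)
  note frame_P = W_P[of _ _ a, simplified] W_P[of _ _ b, simplified] W_P[of _ _ c, simplified]
  note tau_cyc' = Q'.tau_cyc[of a' b' c', simplified] Q'.tau_cyc[of b' c' a', simplified]
  have W_ab: "W a b = \<zero>\<^bsub>B'\<^esub>"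
    by (rule Q'.nondegenerate)
      (simp_all add: W_Tr frame_P delta_13 delta_23 Q'.tau_13 Q'.tau_23 e_tau Q.R.diff_self)
  have W_bc: "W b c = \<zero>\<^bsub>B'\<^esub>"
    by (rule Q'.nondegenerate)
      (simp_all add: W_Tr frame_P delta_13 delta_23 Q'.tau_13 Q'.tau_23 e_tau Q.R.diff_self
        delta_cyc[of a b c] tau_cyc')
  have W_ca: "W c a = \<zero>\<^bsub>B'\<^esub>"
    by (rule Q'.nondegenerate)
      (simp_all add: W_Tr frame_P delta_13 delta_23 Q'.tau_13 Q'.tau_23 e_tau Q.R.diff_self
        delta_cyc[of b c a] delta_cyc[of a b c] tau_cyc')
  have W_frame: "W x y = \<zero>\<^bsub>B'\<^esub>" if "x \<in> {\<one>\<^bsub>B\<^esub>, a, b, c}" "y \<in> {\<one>\<^bsub>B\<^esub>, a, b, c}" for x y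
    using that W_ab W_bc W_ca W_swap[of a b] W_swap[of b c] W_swap[of c a] W_self W_one by auto
  \<comment> \<open>Induction over the source along the preimages of the frame. The span property is
    known in the target, so the predicate is carried across \<open>g\<close> and brought back by
    injectivity.\<close>
  have ind: "A w" if w: "w \<in> carrier B" and "\<And>w. w \<in> {\<one>\<^bsub>B\<^esub>, a, b, c} \<Longrightarrow> A w"
    and "\<And>x y. x \<in> carrier B \<Longrightarrow> y \<in> carrier B \<Longrightarrow> A x \<Longrightarrow> A y \<Longrightarrow> A (x \<oplus>\<^bsub>B\<^esub> y)"
    and "\<And>r x. r \<in> carrier R \<Longrightarrow> x \<in> carrier B \<Longrightarrow> A x \<Longrightarrow> A (r \<odot>\<^bsub>B\<^esub> x)" for A w
  proof -
    have "\<exists>x\<in>carrier B. A x \<and> g x = g w"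
      using g_closed[OF w]
    proof (rule Q'.span_induct)
      show "\<exists>x\<in>carrier B. A x \<and> g x = u \<oplus>\<^bsub>B'\<^esub> v"
        if "\<exists>x\<in>carrier B. A x \<and> g x = u" "\<exists>x\<in>carrier B. A x \<and> g x = v" for u v
        using that \<open>\<And>x y. _ \<Longrightarrow> _ \<Longrightarrow> _ \<Longrightarrow> _ \<Longrightarrow> A (x \<oplus>\<^bsub>B\<^esub> y)\<close> g_add Q.B.a_closed by metis
      show "\<exists>x\<in>carrier B. A x \<and> g x = r \<odot>\<^bsub>B'\<^esub> u"
        if "r \<in> carrier R" "\<exists>x\<in>carrier B. A x \<and> g x = u" for r u
        using that \<open>\<And>r x. _ \<Longrightarrow> _ \<Longrightarrow> _ \<Longrightarrow> A (r \<odot>\<^bsub>B\<^esub> x)\<close> g_smult Q.M.smult_closed by metis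
    qed (use \<open>\<And>w. _ \<Longrightarrow> A w\<close> g_one a b c Q.B.one_closed in \<open>blast intro: insertI1 insertI2\<close>)+
    then show "A w"
      using w g_bij by (auto simp: bij_betw_def inj_on_def)
  qed
  have "W x y = \<zero>\<^bsub>B'\<^esub>" if "x \<in> carrier B" "y \<in> carrier B" for x y
    using \<open>x \<in> carrier B\<close>
  proof (rule ind)
    fix x0 assume x0: "x0 \<in> {\<one>\<^bsub>B\<^esub>, a, b, c}"
    then have x0B: "x0 \<in> carrier B" by auto
    show "W x0 y = \<zero>\<^bsub>B'\<^esub>"
      using \<open>y \<in> carrier B\<close> by (rule ind) (use x0 x0B W_frame in \<open>simp_all add: W_add W_smult\<close>)
  qed (use \<open>y \<in> carrier B\<close> in \<open>simp_all add: W_add W_smult\<close>)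
  then have "splits e x y" if "x \<in> carrier B" "y \<in> carrier B" for x y
    using that unfolding splits_def W_def defect_def by (simp add: Q'.B.diff_simps)
  then show ?thesis using e by blast
qed

text \<open>One pair suffices: pairing the difference of the two relations with \<open>c'\<close>
  leaves a multiple of the unit \<open>tau\<close>.\<close>

lemma splits_unique:
  assumes "e \<in> carrier R" "e' \<in> carrier R" "x \<in> carrier B" "y \<in> carrier B" "g x = a'" "g y = b'"
    and "splits e x y" "splits e' x y"
  shows "e = e'"
proof -
  have "(e \<ominus>\<^bsub>R\<^esub> e') \<odot>\<^bsub>B'\<^esub> Q'.comm a' b' = \<zero>\<^bsub>B'\<^esub>"
    using assms unfolding splits_def by (simp add: Q'.smult_diff Q'.B.diff_self)
  then have "Q'.P ((e \<ominus>\<^bsub>R\<^esub> e') \<odot>\<^bsub>B'\<^esub> Q'.comm a' b') c' = \<zero>\<^bsub>R\<^esub>"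
    by simp
  then have "(e \<ominus>\<^bsub>R\<^esub> e') \<otimes>\<^bsub>R\<^esub> Q'.tau a' b' c' = \<zero>\<^bsub>R\<^esub>"
    using assms by (simp add: Q'.tau_def)
  then have "e \<ominus>\<^bsub>R\<^esub> e' = \<zero>\<^bsub>R\<^esub>"
    using assms by - (rule Q.R.Units_mult_eq_zero[OF Q'.tau_unit], auto)
  then show ?thesis using assms by (simp add: Q.R.diff_eq_eq)
qed

text \<open>Expanding \<open>g ((x y) z) = g (x (y z))\<close> gives an identity of degree two in
  \<open>e\<close>. The constant parts agree, and the linear and quadratic parts differ by the same
  double commutator with opposite signs.\<close>

lemma splits_idem:
  assumes e: "e \<in> carrier R" and splits: "\<And>x y. x \<in> carrier B \<Longrightarrow> y \<in> carrier B \<Longrightarrow> splits e x y"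
  shows "e \<otimes>\<^bsub>R\<^esub> e = e"
proof -
  have "(e \<ominus>\<^bsub>R\<^esub> e \<otimes>\<^bsub>R\<^esub> e) \<odot>\<^bsub>B'\<^esub> Q'.comm y' (Q'.comm x' z') = \<zero>\<^bsub>B'\<^esub>"
    if x': "x' \<in> carrier B'" and y': "y' \<in> carrier B'" and z': "z' \<in> carrier B'" for x' y' z'
  proof -
    obtain x y z where xyz: "x \<in> carrier B" "y \<in> carrier B" "z \<in> carrier B" "x' = g x" "y' = g y" "z' = g z"
      using g_surj[OF x'] g_surj[OF y'] g_surj[OF z'] by metis
    let ?l = "y' \<otimes>\<^bsub>B'\<^esub> x' \<oplus>\<^bsub>B'\<^esub> e \<odot>\<^bsub>B'\<^esub> Q'.comm x' y'" and ?r = "z' \<otimes>\<^bsub>B'\<^esub> y' \<oplus>\<^bsub>B'\<^esub> e \<odot>\<^bsub>B'\<^esub> Q'.comm y' z'"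
    have s: "g (x \<otimes>\<^bsub>B\<^esub> y) = g y \<otimes>\<^bsub>B'\<^esub> g x \<oplus>\<^bsub>B'\<^esub> e \<odot>\<^bsub>B'\<^esub> Q'.comm (g x) (g y)"
      if "x \<in> carrier B" "y \<in> carrier B" for x y
      using splits[OF that] by (simp add: splits_def)
    have "g ((x \<otimes>\<^bsub>B\<^esub> y) \<otimes>\<^bsub>B\<^esub> z) = g (x \<otimes>\<^bsub>B\<^esub> (y \<otimes>\<^bsub>B\<^esub> z))"
      using xyz by (simp add: Q.B.m_assoc)
    then have eq: "z' \<otimes>\<^bsub>B'\<^esub> ?l \<oplus>\<^bsub>B'\<^esub> e \<odot>\<^bsub>B'\<^esub> Q'.comm ?l z' = ?r \<otimes>\<^bsub>B'\<^esub> x' \<oplus>\<^bsub>B'\<^esub> e \<odot>\<^bsub>B'\<^esub> Q'.comm x' ?r"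
      using xyz by (simp only: s Q.B.m_closed)
    let ?K = "Q'.comm y' (Q'.comm x' z')" and ?J = "Q'.comm (Q'.comm x' y') z'"
    have "z' \<otimes>\<^bsub>B'\<^esub> ?l \<oplus>\<^bsub>B'\<^esub> e \<odot>\<^bsub>B'\<^esub> Q'.comm ?l z' = z' \<otimes>\<^bsub>B'\<^esub> (y' \<otimes>\<^bsub>B'\<^esub> x') \<oplus>\<^bsub>B'\<^esub>
        (e \<odot>\<^bsub>B'\<^esub> (z' \<otimes>\<^bsub>B'\<^esub> Q'.comm x' y' \<oplus>\<^bsub>B'\<^esub> Q'.comm (y' \<otimes>\<^bsub>B'\<^esub> x') z') \<oplus>\<^bsub>B'\<^esub> (e \<otimes>\<^bsub>R\<^esub> e) \<odot>\<^bsub>B'\<^esub> ?J)"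
      using e x' y' z' by (simp add: Q'.comm_add Q'.comm_smult Q'.B.r_distr Q'.M.smult_r_distr
          Q'.smult_smult Q'.B.a_ac)
    \<comment> \<open>The multiple of \<open>?K\<close> by the square of \<open>e\<close> is added
      and subtracted, so that the Jacobi identity completes the first summand to the second
      bracketing.\<close>
    also have "\<dots> = (z' \<otimes>\<^bsub>B'\<^esub> (y' \<otimes>\<^bsub>B'\<^esub> x') \<oplus>\<^bsub>B'\<^esub> (e \<odot>\<^bsub>B'\<^esub> (Q'.comm y' z' \<otimes>\<^bsub>B'\<^esub> x' \<oplus>\<^bsub>B'\<^esub>
        Q'.comm x' (z' \<otimes>\<^bsub>B'\<^esub> y')) \<oplus>\<^bsub>B'\<^esub> (e \<otimes>\<^bsub>R\<^esub> e) \<odot>\<^bsub>B'\<^esub> (?J \<oplus>\<^bsub>B'\<^esub> ?K))) \<oplus>\<^bsub>B'\<^esub> (e \<ominus>\<^bsub>R\<^esub> e \<otimes>\<^bsub>R\<^esub> e) \<odot>\<^bsub>B'\<^esub> ?K"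
      unfolding Q'.comm_assoc_defect[OF x' y' z']
      using e x' y' z' by (simp add: Q'.M.smult_r_distr Q'.smult_diff Q'.B.diff_simps)
    also have "z' \<otimes>\<^bsub>B'\<^esub> (y' \<otimes>\<^bsub>B'\<^esub> x') \<oplus>\<^bsub>B'\<^esub> (e \<odot>\<^bsub>B'\<^esub> (Q'.comm y' z' \<otimes>\<^bsub>B'\<^esub> x' \<oplus>\<^bsub>B'\<^esub>
        Q'.comm x' (z' \<otimes>\<^bsub>B'\<^esub> y')) \<oplus>\<^bsub>B'\<^esub> (e \<otimes>\<^bsub>R\<^esub> e) \<odot>\<^bsub>B'\<^esub> (?J \<oplus>\<^bsub>B'\<^esub> ?K)) =
        ?r \<otimes>\<^bsub>B'\<^esub> x' \<oplus>\<^bsub>B'\<^esub> e \<odot>\<^bsub>B'\<^esub> Q'.comm x' ?r"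
      using e x' y' z' by (simp add: Q'.comm_jacobi[of x' y' z'] Q'.comm_add Q'.comm_smult Q'.B.l_distr
          Q'.M.smult_r_distr Q'.smult_smult Q'.B.a_ac Q'.B.m_assoc)
    finally have "z' \<otimes>\<^bsub>B'\<^esub> ?l \<oplus>\<^bsub>B'\<^esub> e \<odot>\<^bsub>B'\<^esub> Q'.comm ?l z' =
        (?r \<otimes>\<^bsub>B'\<^esub> x' \<oplus>\<^bsub>B'\<^esub> e \<odot>\<^bsub>B'\<^esub> Q'.comm x' ?r) \<oplus>\<^bsub>B'\<^esub> (e \<ominus>\<^bsub>R\<^esub> e \<otimes>\<^bsub>R\<^esub> e) \<odot>\<^bsub>B'\<^esub> ?K" .
    then show ?thesis
      unfolding eq using e x' y' z' by (simp del: Q'.B.add.l_cancel_one add: Q'.B.add.l_cancel_one')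
  qed
  then have "e \<ominus>\<^bsub>R\<^esub> e \<otimes>\<^bsub>R\<^esub> e = \<zero>\<^bsub>R\<^esub>"
    using e by (intro Q'.smult_comm_zero) auto
  then show ?thesis using e by (simp add: Q.R.diff_eq_eq)
qed

end

section \<open>Twisting by an idempotent\<close>

context ch_alg
begin

text \<open>For idempotent \<open>e\<close>, the identity on the part of the base where
  \<open>e = 1\<close> and the conjugation on the part where \<open>e = 0\<close>.\<close>

definition twist :: "'a \<Rightarrow> 'b \<Rightarrow> 'b" where
  "twist e y = e \<odot>\<^bsub>B\<^esub> y \<oplus>\<^bsub>B\<^esub> (\<one>\<^bsub>R\<^esub> \<ominus>\<^bsub>R\<^esub> e) \<odot>\<^bsub>B\<^esub> conj y"

lemma twist_closed [simp]: "e \<in> carrier R \<Longrightarrow> y \<in> carrier B \<Longrightarrow> twist e y \<in> carrier B"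
  by (simp add: twist_def)

lemma twist_one: "e \<in> carrier R \<Longrightarrow> twist e \<one>\<^bsub>B\<^esub> = \<one>\<^bsub>B\<^esub>"
  by (simp add: twist_def conj_one expand)

lemma twist_add:
  "e \<in> carrier R \<Longrightarrow> x \<in> carrier B \<Longrightarrow> y \<in> carrier B \<Longrightarrow>
    twist e (x \<oplus>\<^bsub>B\<^esub> y) = twist e x \<oplus>\<^bsub>B\<^esub> twist e y"
  by (simp add: twist_def conj_add M.smult_r_distr B.a_ac)

lemma twist_smult:
  "e \<in> carrier R \<Longrightarrow> r \<in> carrier R \<Longrightarrow> x \<in> carrier B \<Longrightarrow> twist e (r \<odot>\<^bsub>B\<^esub> x) = r \<odot>\<^bsub>B\<^esub> twist e x"
  by (simp add: twist_def conj_smult M.smult_r_distr smult_smult R.m_comm)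

lemma idem_complement:
  assumes "e \<in> carrier R" "e \<otimes>\<^bsub>R\<^esub> e = e"
  shows "e \<otimes>\<^bsub>R\<^esub> (\<one>\<^bsub>R\<^esub> \<ominus>\<^bsub>R\<^esub> e) = \<zero>\<^bsub>R\<^esub>" "(\<one>\<^bsub>R\<^esub> \<ominus>\<^bsub>R\<^esub> e) \<otimes>\<^bsub>R\<^esub> e = \<zero>\<^bsub>R\<^esub>"
    "(\<one>\<^bsub>R\<^esub> \<ominus>\<^bsub>R\<^esub> e) \<otimes>\<^bsub>R\<^esub> (\<one>\<^bsub>R\<^esub> \<ominus>\<^bsub>R\<^esub> e) = \<one>\<^bsub>R\<^esub> \<ominus>\<^bsub>R\<^esub> e"
  using assms by (simp_all add: R.mult_diff_distrib R.diff_mult_distrib R.diff_self R.diff_simps)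

lemma twist_twist:
  assumes "e \<in> carrier R" "e \<otimes>\<^bsub>R\<^esub> e = e" "y \<in> carrier B"
  shows "twist e (twist e y) = y"
proof -
  have "twist e (twist e y) = e \<odot>\<^bsub>B\<^esub> y \<oplus>\<^bsub>B\<^esub> (\<one>\<^bsub>R\<^esub> \<ominus>\<^bsub>R\<^esub> e) \<odot>\<^bsub>B\<^esub> y"
    using assms idem_complement[OF assms(1,2)]
    by (simp add: twist_def conj_add conj_smult conj_conj M.smult_r_distr smult_smult)
  also have "\<dots> = y"
    using assms by (simp add: expand)
  finally show ?thesis .
qed

text \<open>The argument is the value that \<open>splits\<close> prescribes for a product.
  Multiplied by \<open>e\<close> it becomes \<open>x y\<close>; multiplied by \<open>1 - e\<close>
  it loses the commutator, and conjugation restores the order of the factors.\<close>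

lemma twist_mult:
  assumes e: "e \<in> carrier R" "e \<otimes>\<^bsub>R\<^esub> e = e" and "x \<in> carrier B" "y \<in> carrier B"
  shows "twist e (y \<otimes>\<^bsub>B\<^esub> x \<oplus>\<^bsub>B\<^esub> e \<odot>\<^bsub>B\<^esub> comm x y) = twist e x \<otimes>\<^bsub>B\<^esub> twist e y"
proof -
  let ?f = "\<one>\<^bsub>R\<^esub> \<ominus>\<^bsub>R\<^esub> e"
  have "twist e (y \<otimes>\<^bsub>B\<^esub> x \<oplus>\<^bsub>B\<^esub> e \<odot>\<^bsub>B\<^esub> comm x y) =
      e \<odot>\<^bsub>B\<^esub> (x \<otimes>\<^bsub>B\<^esub> y) \<oplus>\<^bsub>B\<^esub> ?f \<odot>\<^bsub>B\<^esub> (conj x \<otimes>\<^bsub>B\<^esub> conj y)"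
  proof -
    have "e \<odot>\<^bsub>B\<^esub> (y \<otimes>\<^bsub>B\<^esub> x \<oplus>\<^bsub>B\<^esub> e \<odot>\<^bsub>B\<^esub> comm x y) = e \<odot>\<^bsub>B\<^esub> (x \<otimes>\<^bsub>B\<^esub> y)"
      using assms by (simp add: comm_def M.smult_r_distr smult_smult smult_diff B.diff_simps)
    moreover have "?f \<odot>\<^bsub>B\<^esub> conj (y \<otimes>\<^bsub>B\<^esub> x \<oplus>\<^bsub>B\<^esub> e \<odot>\<^bsub>B\<^esub> comm x y) = ?f \<odot>\<^bsub>B\<^esub> (conj x \<otimes>\<^bsub>B\<^esub> conj y)"
      using assms idem_complement[OF e]
      by (simp add: conj_add conj_smult conj_mult M.smult_r_distr smult_smult)
    ultimately show ?thesis by (simp add: twist_def)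
  qed
  also have "\<dots> = twist e x \<otimes>\<^bsub>B\<^esub> twist e y"
    using assms idem_complement[OF e]
    by (simp add: twist_def B.l_distr B.r_distr M.smult_r_distr smult_smult)
  finally show ?thesis .
qed

end

locale isometry = Q: ch_alg R B N + Q': frame_alg R B' N' a' b' c'
  for R :: "'r ring" and B :: "('r, 'q) module" and N and B' :: "('r, 'q2) module" and N' a' b' c' +
  fixes f :: "'q \<Rightarrow> 'q2"
  assumes f_bij: "bij_betw f (carrier B) (carrier B')"
    and f_add: "\<And>x y. x \<in> carrier B \<Longrightarrow> y \<in> carrier B \<Longrightarrow> f (x \<oplus>\<^bsub>B\<^esub> y) = f x \<oplus>\<^bsub>B'\<^esub> f y"
    and f_smult: "\<And>r x. r \<in> carrier R \<Longrightarrow> x \<in> carrier B \<Longrightarrow> f (r \<odot>\<^bsub>B\<^esub> x) = r \<odot>\<^bsub>B'\<^esub> f x"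
    and f_N: "\<And>x. x \<in> carrier B \<Longrightarrow> N' (f x) = N x"
begin

lemma f_closed [simp]: "x \<in> carrier B \<Longrightarrow> f x \<in> carrier B'"
  using f_bij by (auto simp: bij_betw_def)

abbreviation u where "u \<equiv> f \<one>\<^bsub>B\<^esub>"
abbreviation g where "g x \<equiv> Q'.conj u \<otimes>\<^bsub>B'\<^esub> f x"

text \<open>The norm of \<open>u\<close> is the norm of \<open>1\<close>, so its conjugate is its
  inverse; multiplying by the latter makes the isometry unital.\<close>

lemma u_inverse: "u \<otimes>\<^bsub>B'\<^esub> Q'.conj u = \<one>\<^bsub>B'\<^esub>" "Q'.conj u \<otimes>\<^bsub>B'\<^esub> u = \<one>\<^bsub>B'\<^esub>"
  by (simp_all add: Q'.mult_conj Q'.conj_mult_self f_N Q.N_one)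

lemma u_cancel: "y \<in> carrier B' \<Longrightarrow> u \<otimes>\<^bsub>B'\<^esub> (Q'.conj u \<otimes>\<^bsub>B'\<^esub> y) = y"
  "y \<in> carrier B' \<Longrightarrow> Q'.conj u \<otimes>\<^bsub>B'\<^esub> (u \<otimes>\<^bsub>B'\<^esub> y) = y"
  by (simp_all add: u_inverse flip: Q'.B.m_assoc)

lemma bij_conj_u: "bij_betw (\<lambda>y. Q'.conj u \<otimes>\<^bsub>B'\<^esub> y) (carrier B') (carrier B')"
  by (rule bij_betwI[where g = "\<lambda>y. u \<otimes>\<^bsub>B'\<^esub> y"]) (auto simp: u_cancel)

sublocale unital: unital_isometry R B N B' N' a' b' c' g
proof
  show "bij_betw g (carrier B) (carrier B')"
    using bij_betw_trans[OF f_bij bij_conj_u] by (simp add: o_def)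
qed (simp_all add: f_add f_smult f_N u_inverse Q'.B.r_distr Q'.N_mult Q'.N_conj Q.N_one)

end

text \<open>The two equations for \<open>f y\<close> differ by a linear relation between
  \<open>1\<close> and \<open>f y\<close>. When \<open>f y\<close> is \<open>a\<close>,
  \<open>b\<close> or \<open>c\<close>, independence equates the traces; linearity spreads this to
  all elements, and then the relation also equates the norms.\<close>

lemma (in frame_alg) norm_of_isomorphism:
  assumes Q: "ch_alg R C M"
    and f: "f \<in> ring_iso C B"
    and smult: "\<And>r x. r \<in> carrier R \<Longrightarrow> x \<in> carrier C \<Longrightarrow> f (r \<odot>\<^bsub>C\<^esub> x) = r \<odot>\<^bsub>B\<^esub> f x"
    and x: "x \<in> carrier C"
  shows "N (f x) = M x"
proof -
  interpret Q: ch_alg R C M by (rule Q)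
  have bij: "bij_betw f (carrier C) (carrier B)" and hom: "f \<in> ring_hom C B"
    using f by (auto simp: ring_iso_def)
  have closed [simp]: "f x \<in> carrier B" if "x \<in> carrier C" for x
    using ring_hom_closed[OF hom that] .
  have f_one: "f \<one>\<^bsub>C\<^esub> = \<one>\<^bsub>B\<^esub>" using ring_hom_one[OF hom] .
  have surj: "\<exists>x\<in>carrier C. f x = y" if "y \<in> carrier B" for y
    using bij_betw_imp_surj_on[OF bij] that by (metis imageE)
  have inj: "x = y" if "f x = f y" "x \<in> carrier C" "y \<in> carrier C" for x y
    using bij that by (auto simp: bij_betw_def inj_on_def)
  have f_minus: "f (y \<ominus>\<^bsub>C\<^esub> z) = f y \<ominus>\<^bsub>B\<^esub> f z" if "y \<in> carrier C" "z \<in> carrier C" for y z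
    using ring_hom_add[OF hom, of "y \<ominus>\<^bsub>C\<^esub> z" z] that
    by (simp add: B.eq_diff_eq Q.B.diff_add_eq Q.B.add_diff_eq[symmetric] Q.B.diff_self)
  have key: "(N (f y) \<ominus>\<^bsub>R\<^esub> M y) \<odot>\<^bsub>B\<^esub> \<one>\<^bsub>B\<^esub> = (Tr (f y) \<ominus>\<^bsub>R\<^esub> Q.Tr y) \<odot>\<^bsub>B\<^esub> f y"
    if y: "y \<in> carrier C" for y
  proof -
    have "Tr (f y) \<odot>\<^bsub>B\<^esub> f y \<ominus>\<^bsub>B\<^esub> N (f y) \<odot>\<^bsub>B\<^esub> \<one>\<^bsub>B\<^esub> = f y \<otimes>\<^bsub>B\<^esub> f y"
      using y CH[of "f y"] by simp
    also have "\<dots> = f (Q.Tr y \<odot>\<^bsub>C\<^esub> y \<ominus>\<^bsub>C\<^esub> M y \<odot>\<^bsub>C\<^esub> \<one>\<^bsub>C\<^esub>)"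
      using y ring_hom_mult[OF hom y y] Q.CH[of y] by simp
    also have "\<dots> = Q.Tr y \<odot>\<^bsub>B\<^esub> f y \<ominus>\<^bsub>B\<^esub> M y \<odot>\<^bsub>B\<^esub> \<one>\<^bsub>B\<^esub>"
      using y by (simp add: f_minus smult f_one)
    finally show ?thesis
      using y by (simp add: smult_diff B.diff_simps)
  qed
  have gen: "\<exists>y\<in>carrier C. f y = w \<and> Tr w = Q.Tr y" if "w = a \<or> w = b \<or> w = c" for w
  proof -
    have wB: "w \<in> carrier B" using that by auto
    obtain y where y: "y \<in> carrier C" "f y = w" using surj[OF wB] by blast
    define t where "t = Tr w \<ominus>\<^bsub>R\<^esub> Q.Tr y"
    \<comment> \<open>The sign turns the relation in \<open>key\<close> into a vanishing
      combination, as \<open>independent\<close> expects.\<close>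
    define n where "n = \<ominus>\<^bsub>R\<^esub> (N w \<ominus>\<^bsub>R\<^esub> M y)"
    have tn: "t \<in> carrier R" "n \<in> carrier R" using y wB by (simp_all add: t_def n_def)
    have nt: "n \<odot>\<^bsub>B\<^esub> \<one>\<^bsub>B\<^esub> \<oplus>\<^bsub>B\<^esub> t \<odot>\<^bsub>B\<^esub> w = \<zero>\<^bsub>B\<^esub>"
      using key[OF y(1)] y wB tn unfolding n_def
      by (simp add: M.smult_l_minus t_def[symmetric] B.l_neg)
    have "t = \<zero>\<^bsub>R\<^esub>"
      using that
    proof (elim disjE)
      assume "w = a"
      then show ?thesis
        using nt tn by (intro independent(2)[of n t "\<zero>\<^bsub>R\<^esub>" "\<zero>\<^bsub>R\<^esub>"]) simp_all
    next
      assume "w = b"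
      then show ?thesis
        using nt tn by (intro independent(3)[of n "\<zero>\<^bsub>R\<^esub>" t "\<zero>\<^bsub>R\<^esub>"]) simp_all
    next
      assume "w = c"
      then show ?thesis
        using nt tn by (intro independent(4)[of n "\<zero>\<^bsub>R\<^esub>" "\<zero>\<^bsub>R\<^esub>" t]) simp_all
    qed
    then have "Tr w = Q.Tr y"
      using y wB by (simp add: t_def R.diff_eq_eq)
    then show ?thesis using y by blast
  qed
  have "\<exists>y\<in>carrier C. f y = w \<and> Tr w = Q.Tr y" if "w \<in> carrier B" for w
    using that
  proof (rule span_induct)
    show "\<exists>y\<in>carrier C. f y = \<one>\<^bsub>B\<^esub> \<and> Tr \<one>\<^bsub>B\<^esub> = Q.Tr y"
      using f_one by (intro bexI[of _ "\<one>\<^bsub>C\<^esub>"]) (auto simp: Tr_one Q.Tr_one)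
  next
    fix u v assume uv: "u \<in> carrier B" "v \<in> carrier B"
      and "\<exists>y\<in>carrier C. f y = u \<and> Tr u = Q.Tr y" "\<exists>y\<in>carrier C. f y = v \<and> Tr v = Q.Tr y"
    then obtain y z where "y \<in> carrier C" "f y = u" "Tr u = Q.Tr y" "z \<in> carrier C" "f z = v" "Tr v = Q.Tr z"
      by blast
    then show "\<exists>y\<in>carrier C. f y = u \<oplus>\<^bsub>B\<^esub> v \<and> Tr (u \<oplus>\<^bsub>B\<^esub> v) = Q.Tr y"
      using uv by (intro bexI[of _ "y \<oplus>\<^bsub>C\<^esub> z"]) (simp_all add: ring_hom_add[OF hom])
  next
    fix r u assume r: "r \<in> carrier R" "u \<in> carrier B" and "\<exists>y\<in>carrier C. f y = u \<and> Tr u = Q.Tr y"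
    then obtain y where "y \<in> carrier C" "f y = u" "Tr u = Q.Tr y" by blast
    then show "\<exists>y\<in>carrier C. f y = r \<odot>\<^bsub>B\<^esub> u \<and> Tr (r \<odot>\<^bsub>B\<^esub> u) = Q.Tr y"
      using r by (intro bexI[of _ "r \<odot>\<^bsub>C\<^esub> y"]) (simp_all add: smult)
  qed (auto intro!: gen)
  from this[of "f x"] have "Tr (f x) = Q.Tr x"
    using inj[OF _ _ x] x by auto
  then have "(N (f x) \<ominus>\<^bsub>R\<^esub> M x) \<odot>\<^bsub>B\<^esub> \<one>\<^bsub>B\<^esub> = \<zero>\<^bsub>R\<^esub> \<odot>\<^bsub>B\<^esub> \<one>\<^bsub>B\<^esub>"
    using key[OF x] x by (simp add: R.diff_self)
  then have "N (f x) \<ominus>\<^bsub>R\<^esub> M x = \<zero>\<^bsub>R\<^esub>"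
    using x by - (rule scalar_faithful, auto)
  then show ?thesis
    using x by (simp add: R.diff_eq_eq)
qed

section \<open>The matrix algebra\<close>

lemma mat2_simps:
  "carrier (mat2 A) = carrier A \<times> carrier A \<times> carrier A \<times> carrier A"
  "(p, q, r, s) \<otimes>\<^bsub>mat2 A\<^esub> (p', q', r', s') =
    (p \<otimes>\<^bsub>A\<^esub> p' \<oplus>\<^bsub>A\<^esub> q \<otimes>\<^bsub>A\<^esub> r', p \<otimes>\<^bsub>A\<^esub> q' \<oplus>\<^bsub>A\<^esub> q \<otimes>\<^bsub>A\<^esub> s',
     r \<otimes>\<^bsub>A\<^esub> p' \<oplus>\<^bsub>A\<^esub> s \<otimes>\<^bsub>A\<^esub> r', r \<otimes>\<^bsub>A\<^esub> q' \<oplus>\<^bsub>A\<^esub> s \<otimes>\<^bsub>A\<^esub> s')"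
  "\<one>\<^bsub>mat2 A\<^esub> = (\<one>\<^bsub>A\<^esub>, \<zero>\<^bsub>A\<^esub>, \<zero>\<^bsub>A\<^esub>, \<one>\<^bsub>A\<^esub>)"
  "\<zero>\<^bsub>mat2 A\<^esub> = (\<zero>\<^bsub>A\<^esub>, \<zero>\<^bsub>A\<^esub>, \<zero>\<^bsub>A\<^esub>, \<zero>\<^bsub>A\<^esub>)"
  "(p, q, r, s) \<oplus>\<^bsub>mat2 A\<^esub> (p', q', r', s') = (p \<oplus>\<^bsub>A\<^esub> p', q \<oplus>\<^bsub>A\<^esub> q', r \<oplus>\<^bsub>A\<^esub> r', s \<oplus>\<^bsub>A\<^esub> s')"
  "k \<odot>\<^bsub>mat2 A\<^esub> (p, q, r, s) = (k \<otimes>\<^bsub>A\<^esub> p, k \<otimes>\<^bsub>A\<^esub> q, k \<otimes>\<^bsub>A\<^esub> r, k \<otimes>\<^bsub>A\<^esub> s)"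
  "det2 A (p, q, r, s) = p \<otimes>\<^bsub>A\<^esub> s \<ominus>\<^bsub>A\<^esub> q \<otimes>\<^bsub>A\<^esub> r"
  by (simp_all add: mat2_def det2_def)

locale mat2_ring = cring R for R :: "'r ring" (structure)
begin

lemmas cring_expand = l_distr r_distr mult_diff_distrib diff_mult_distrib diff_simps m_ac

lemma abelian_group_mat2: "abelian_group (mat2 R)"
proof (rule abelian_groupI)
  fix x assume "x \<in> carrier (mat2 R)"
  then obtain p q r s where "x = (p, q, r, s)" "p \<in> carrier R" "q \<in> carrier R" "r \<in> carrier R" "s \<in> carrier R"
    by (auto simp: mat2_simps)
  then show "\<exists>y\<in>carrier (mat2 R). y \<oplus>\<^bsub>mat2 R\<^esub> x = \<zero>\<^bsub>mat2 R\<^esub>"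
    by (intro bexI[of _ "(\<ominus> p, \<ominus> q, \<ominus> r, \<ominus> s)"]) (auto simp: mat2_simps l_neg)
qed (auto simp: mat2_simps a_ac)

lemma monoid_mat2: "monoid (mat2 R)"
  by (rule monoidI) (auto simp: mat2_simps l_distr r_distr a_ac m_assoc)

lemma ring_mat2: "ring (mat2 R)"
  by (rule ringI[OF abelian_group_mat2 monoid_mat2])
    (auto simp: mat2_simps l_distr r_distr a_ac)

lemma assoc_algebra_mat2: "assoc_algebra R (mat2 R)"
proof -
  have "module R (mat2 R)"
    by (rule moduleI[OF is_cring abelian_group_mat2]) (auto simp: mat2_simps l_distr r_distr m_assoc)
  then show ?thesis
    unfolding assoc_algebra_def using ring_mat2
    by (auto simp: mat2_simps r_distr m_ac)
qed

lemma polar_det2: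
  assumes "p \<in> carrier R" "q \<in> carrier R" "r \<in> carrier R" "s \<in> carrier R"
    and "p' \<in> carrier R" "q' \<in> carrier R" "r' \<in> carrier R" "s' \<in> carrier R"
  shows "polar_form R (mat2 R) (det2 R) (p, q, r, s) (p', q', r', s') =
    (p \<otimes> s' \<oplus> s \<otimes> p') \<ominus> (q \<otimes> r' \<oplus> r \<otimes> q')"
  using assms by (simp add: polar_form_def mat2_simps cring_expand)

lemma quad_alg_mat2: "quad_alg R (mat2 R) (det2 R)"
proof
  show "assoc_algebra R (mat2 R)" by (rule assoc_algebra_mat2)
  show "quadratic_map R (mat2 R) (det2 R)"
    unfolding quadratic_map_def
  proof (intro conjI ballI)
    show "det2 R \<in> carrier (mat2 R) \<rightarrow> carrier R" by (auto simp: mat2_simps)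
    fix k x assume k [simp]: "k \<in> carrier R" and "x \<in> carrier (mat2 R)"
    then show "det2 R (k \<odot>\<^bsub>mat2 R\<^esub> x) = k \<otimes> k \<otimes> det2 R x"
      by (auto simp: mat2_simps mult_diff_distrib m_ac)
    fix y assume "y \<in> carrier (mat2 R)"
    then show "polar_form R (mat2 R) (det2 R) (k \<odot>\<^bsub>mat2 R\<^esub> x) y = k \<otimes> polar_form R (mat2 R) (det2 R) x y"
      using k \<open>x \<in> carrier (mat2 R)\<close> by (auto simp: mat2_simps polar_det2 cring_expand)
  next
    fix x y z assume "x \<in> carrier (mat2 R)" "y \<in> carrier (mat2 R)" "z \<in> carrier (mat2 R)"
    then show "polar_form R (mat2 R) (det2 R) (x \<oplus>\<^bsub>mat2 R\<^esub> y) z =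
        polar_form R (mat2 R) (det2 R) x z \<oplus> polar_form R (mat2 R) (det2 R) y z"
      by (auto simp: mat2_simps polar_det2 cring_expand)
  qed
qed

lemma ch_alg_mat2: "ch_alg R (mat2 R) (det2 R)"
proof -
  interpret M: quad_alg R "mat2 R" "det2 R" by (rule quad_alg_mat2)
  show ?thesis
  proof
    show "det2 R \<one>\<^bsub>mat2 R\<^esub> = \<one>"
      by (simp add: mat2_simps minus_eq)
    fix x assume xc: "x \<in> carrier (mat2 R)"
    then obtain p q r s where x [simp]: "x = (p, q, r, s)"
      "p \<in> carrier R" "q \<in> carrier R" "r \<in> carrier R" "s \<in> carrier R"
      by (auto simp: mat2_simps)
    have Tr: "polar_form R (mat2 R) (det2 R) (p, q, r, s) \<one>\<^bsub>mat2 R\<^esub> = p \<oplus> s"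
      if "p \<in> carrier R" "q \<in> carrier R" "r \<in> carrier R" "s \<in> carrier R" for p q r s
      using that by (simp add: mat2_simps(3) polar_det2 minus_eq)
    have "x \<otimes>\<^bsub>mat2 R\<^esub> x \<oplus>\<^bsub>mat2 R\<^esub> det2 R x \<odot>\<^bsub>mat2 R\<^esub> \<one>\<^bsub>mat2 R\<^esub> =
        polar_form R (mat2 R) (det2 R) x \<one>\<^bsub>mat2 R\<^esub> \<odot>\<^bsub>mat2 R\<^esub> x"
      by (simp add: Tr) (simp add: mat2_simps cring_expand)
    then show "x \<otimes>\<^bsub>mat2 R\<^esub> x = polar_form R (mat2 R) (det2 R) x \<one>\<^bsub>mat2 R\<^esub> \<odot>\<^bsub>mat2 R\<^esub> x \<ominus>\<^bsub>mat2 R\<^esub>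
        det2 R x \<odot>\<^bsub>mat2 R\<^esub> \<one>\<^bsub>mat2 R\<^esub>"
      by (rule M.B.eq_diff_eq[THEN iffD2, rotated -1])
        (intro M.M.smult_closed M.N_closed M.P_closed M.B.m_closed M.B.one_closed xc)+
    fix y assume "y \<in> carrier (mat2 R)"
    then obtain p' q' r' s' where y [simp]: "y = (p', q', r', s')"
      "p' \<in> carrier R" "q' \<in> carrier R" "r' \<in> carrier R" "s' \<in> carrier R"
      by (auto simp: mat2_simps)
    show "polar_form R (mat2 R) (det2 R) x y = polar_form R (mat2 R) (det2 R) x \<one>\<^bsub>mat2 R\<^esub> \<otimes>
        polar_form R (mat2 R) (det2 R) y \<one>\<^bsub>mat2 R\<^esub> \<ominus>
        polar_form R (mat2 R) (det2 R) (x \<otimes>\<^bsub>mat2 R\<^esub> y) \<one>\<^bsub>mat2 R\<^esub>"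
      by (simp add: Tr mat2_simps(2)) (simp add: polar_det2 cring_expand)
  qed
qed

text \<open>Matrix units with \<open>[E11, E12] = E12\<close>, paired against \<open>E21\<close>: a
  triple whose value is a unit over every commutative ring.\<close>

lemma tau_mat2:
  "quad_alg.tau R (mat2 R) (det2 R) (\<one>, \<zero>, \<zero>, \<zero>) (\<zero>, \<one>, \<zero>, \<zero>) (\<zero>, \<zero>, \<one>, \<zero>) = \<ominus> \<one>"
proof -
  interpret M: ch_alg R "mat2 R" "det2 R" by (rule ch_alg_mat2)
  have "M.comm (\<one>, \<zero>, \<zero>, \<zero>) (\<zero>, \<one>, \<zero>, \<zero>) = (\<zero>, \<one>, \<zero>, \<zero>)"
    by (simp add: M.comm_def M.B.diff_eq_eq mat2_simps)
  then show ?thesis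
    by (simp add: M.tau_def polar_det2 minus_eq)
qed

end

section \<open>Spans and generators\<close>

text \<open>Linear combinations built one term at a time, repetitions allowed. Without finite sums
  and coefficient functions, compatibility with restriction maps is a plain rule induction.\<close>

inductive_set lspan :: "'r ring \<Rightarrow> ('r, 'q) module \<Rightarrow> 'q set \<Rightarrow> 'q set" for R B Z where
  lspan_zero: "\<zero>\<^bsub>B\<^esub> \<in> lspan R B Z"
| lspan_step: "b \<in> Z \<Longrightarrow> r \<in> carrier R \<Longrightarrow> v \<in> lspan R B Z \<Longrightarrow> r \<odot>\<^bsub>B\<^esub> b \<oplus>\<^bsub>B\<^esub> v \<in> lspan R B Z"

lemma lspan_mono: "Y \<subseteq> Z \<Longrightarrow> lspan R B Y \<subseteq> lspan R B Z"
proof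
  fix w assume "w \<in> lspan R B Y" and "Y \<subseteq> Z"
  then show "w \<in> lspan R B Z"
    by (induction rule: lspan.induct) (auto intro: lspan.intros)
qed

locale plain_module = module R B for R :: "'r ring" and B :: "('r, 'q) module"
begin

lemma lspan_closed: "w \<in> lspan R B Z \<Longrightarrow> Z \<subseteq> carrier B \<Longrightarrow> w \<in> carrier B"
  by (induction rule: lspan.induct) auto

lemma lspan_add:
  assumes "Z \<subseteq> carrier B" "v \<in> lspan R B Z" "w \<in> lspan R B Z"
  shows "v \<oplus>\<^bsub>B\<^esub> w \<in> lspan R B Z"
  using assms(2)
proof (induction rule: lspan.induct)
  case lspan_zero
  then show ?case using assms lspan_closed by simp
next
  case (lspan_step b r v)
  have "(r \<odot>\<^bsub>B\<^esub> b \<oplus>\<^bsub>B\<^esub> v) \<oplus>\<^bsub>B\<^esub> w = r \<odot>\<^bsub>B\<^esub> b \<oplus>\<^bsub>B\<^esub> (v \<oplus>\<^bsub>B\<^esub> w)"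
    using lspan_step assms lspan_closed by (intro M.a_assoc) auto
  then show ?case using lspan_step by (auto intro: lspan.lspan_step)
qed

lemma lspan_smult:
  assumes "Z \<subseteq> carrier B" "k \<in> carrier R" "v \<in> lspan R B Z"
  shows "k \<odot>\<^bsub>B\<^esub> v \<in> lspan R B Z"
  using assms(3)
proof (induction rule: lspan.induct)
  case lspan_zero
  then show ?case using assms(2) by (simp add: lspan.lspan_zero)
next
  case (lspan_step b r v)
  have "k \<odot>\<^bsub>B\<^esub> (r \<odot>\<^bsub>B\<^esub> b \<oplus>\<^bsub>B\<^esub> v) = (k \<otimes>\<^bsub>R\<^esub> r) \<odot>\<^bsub>B\<^esub> b \<oplus>\<^bsub>B\<^esub> k \<odot>\<^bsub>B\<^esub> v"
    using lspan_step assms lspan_closed[OF lspan_step(3)]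
    by (subst smult_r_distr) (auto simp: smult_assoc1)
  then show ?case using lspan_step assms by (auto intro: lspan.lspan_step)
qed

lemma lspan_base:
  assumes "Z \<subseteq> carrier B" "b \<in> Z"
  shows "b \<in> lspan R B Z"
  using lspan_step[OF assms(2) R.one_closed lspan_zero, of B] assms by auto

lemma lspan_trans:
  assumes "Z \<subseteq> carrier B" "Y \<subseteq> lspan R B Z"
  shows "lspan R B Y \<subseteq> lspan R B Z"
proof
  fix w assume "w \<in> lspan R B Y"
  then show "w \<in> lspan R B Z"
    by (induction rule: lspan.induct) (use assms in \<open>auto intro: lspan.lspan_zero lspan_add lspan_smult\<close>)
qed

text \<open>All occurrences of \<open>b\<close> are collected into one coefficient, as exchange
  requires although combinations may repeat generators.\<close>

lemma lspan_insert:
  assumes "insert b Z \<subseteq> carrier B" "w \<in> lspan R B (insert b Z)"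
  shows "\<exists>r\<in>carrier R. \<exists>v\<in>lspan R B Z. w = r \<odot>\<^bsub>B\<^esub> b \<oplus>\<^bsub>B\<^esub> v"
  using assms(2)
proof (induction rule: lspan.induct)
  case lspan_zero
  then show ?case
    using assms(1) by (intro bexI[of _ "\<zero>\<^bsub>R\<^esub>"] bexI[of _ "\<zero>\<^bsub>B\<^esub>"]) (auto intro: lspan.lspan_zero)
next
  case (lspan_step c r w)
  then obtain s v where sv: "s \<in> carrier R" "v \<in> lspan R B Z" "w = s \<odot>\<^bsub>B\<^esub> b \<oplus>\<^bsub>B\<^esub> v" by blast
  have b: "b \<in> carrier B" "Z \<subseteq> carrier B" using assms(1) by auto
  have v: "v \<in> carrier B" using lspan_closed sv b by blast
  show ?case
  proof (cases "c = b")
    case True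
    have "r \<odot>\<^bsub>B\<^esub> c \<oplus>\<^bsub>B\<^esub> w = (r \<oplus>\<^bsub>R\<^esub> s) \<odot>\<^bsub>B\<^esub> b \<oplus>\<^bsub>B\<^esub> v"
      using True lspan_step(2) sv(1) v b unfolding sv(3) by (simp add: smult_l_distr M.a_assoc)
    then show ?thesis using lspan_step(2) sv by blast
  next
    case False
    then have c: "c \<in> Z" using lspan_step by auto
    then have "r \<odot>\<^bsub>B\<^esub> c \<oplus>\<^bsub>B\<^esub> w = s \<odot>\<^bsub>B\<^esub> b \<oplus>\<^bsub>B\<^esub> (r \<odot>\<^bsub>B\<^esub> c \<oplus>\<^bsub>B\<^esub> v)"
      using lspan_step(2) sv(1) v b unfolding sv(3) by (simp add: M.a_ac subsetD)
    moreover have "r \<odot>\<^bsub>B\<^esub> c \<oplus>\<^bsub>B\<^esub> v \<in> lspan R B Z"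
      using c lspan_step(2) sv by (intro lspan.lspan_step)
    ultimately show ?thesis using sv by blast
  qed
qed

text \<open>The combinatorial core of Steinitz exchange, with ``unit'' replaced by a predicate \<open>G\<close>.\<close>
lemma lspan_pick:
  assumes "finite Z" "Y \<union> Z \<subseteq> carrier B" "y \<in> lspan R B (Y \<union> Z)"
    and add: "\<And>r s. r \<in> carrier R \<Longrightarrow> s \<in> carrier R \<Longrightarrow> G (r \<oplus>\<^bsub>R\<^esub> s) \<Longrightarrow> G r \<or> G s"
    and mult: "\<And>r s. r \<in> carrier R \<Longrightarrow> s \<in> carrier R \<Longrightarrow> G (r \<otimes>\<^bsub>R\<^esub> s) \<Longrightarrow> G r"
    and zero: "\<not> G \<zero>\<^bsub>R\<^esub>"
    and l_closed: "\<And>v. v \<in> carrier B \<Longrightarrow> l v \<in> carrier R"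
    and l_add: "\<And>v w. v \<in> carrier B \<Longrightarrow> w \<in> carrier B \<Longrightarrow> l (v \<oplus>\<^bsub>B\<^esub> w) = l v \<oplus>\<^bsub>R\<^esub> l w"
    and l_smult: "\<And>r v. r \<in> carrier R \<Longrightarrow> v \<in> carrier B \<Longrightarrow> l (r \<odot>\<^bsub>B\<^esub> v) = r \<otimes>\<^bsub>R\<^esub> l v"
    and l_Y: "\<And>v. v \<in> Y \<Longrightarrow> l v = \<zero>\<^bsub>R\<^esub>"
    and G: "G (l y)"
  shows "\<exists>b\<in>Z. \<exists>r\<in>carrier R. \<exists>v\<in>lspan R B (Y \<union> (Z - {b})). y = r \<odot>\<^bsub>B\<^esub> b \<oplus>\<^bsub>B\<^esub> v \<and> G r"
  using assms(1-3) G
proof (induction Z arbitrary: y rule: finite_induct)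
  case empty
  have l_zero: "l \<zero>\<^bsub>B\<^esub> = \<zero>\<^bsub>R\<^esub>"
    using l_smult[of "\<zero>\<^bsub>R\<^esub>" "\<zero>\<^bsub>B\<^esub>"] l_closed[of "\<zero>\<^bsub>B\<^esub>"] by simp
  have lY: "l v = \<zero>\<^bsub>R\<^esub>" if "v \<in> lspan R B Y" for v
    using that
  proof (induction rule: lspan.induct)
    case (lspan_step b r v)
    moreover have "b \<in> carrier B" "v \<in> carrier B"
      using lspan_step empty(1) lspan_closed by auto
    ultimately show ?case by (simp add: l_add l_smult l_Y)
  qed (rule l_zero)
  then show ?case using empty zero by simp
next
  case (insert b Z)
  have carr: "insert b (Y \<union> Z) \<subseteq> carrier B" using insert.prems(1) by auto
  have "y \<in> lspan R B (insert b (Y \<union> Z))" using insert.prems(2) by simp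
  then obtain r v where rv: "r \<in> carrier R" "v \<in> lspan R B (Y \<union> Z)" "y = r \<odot>\<^bsub>B\<^esub> b \<oplus>\<^bsub>B\<^esub> v"
    using lspan_insert[OF carr] by blast
  have v: "v \<in> carrier B" "b \<in> carrier B" using lspan_closed rv(2) carr by auto
  \<comment> \<open>The functional takes \<open>y\<close> to \<open>r\<close> times its value at
    \<open>b\<close>, plus its value at \<open>v\<close>. Either the coefficient \<open>r\<close> is
    good, or the value at \<open>v\<close> is and the induction hypothesis applies to
    \<open>v\<close>.\<close>
  have "G (r \<otimes>\<^bsub>R\<^esub> l b \<oplus>\<^bsub>R\<^esub> l v)"
    using insert.prems(3) v rv by (simp add: l_add l_smult)
  then consider "G r" | "G (l v)"
    using add[of "r \<otimes>\<^bsub>R\<^esub> l b" "l v"] mult[of r "l b"] rv v l_closed by auto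
  then show ?case
  proof cases
    case 1
    have "insert b Z - {b} = Z" using insert.hyps by auto
    then show ?thesis using 1 rv by (intro bexI[of _ b]) auto
  next
    case 2
    then obtain b' r' v' where b': "b' \<in> Z" "r' \<in> carrier R" "v' \<in> lspan R B (Y \<union> (Z - {b'}))"
      "v = r' \<odot>\<^bsub>B\<^esub> b' \<oplus>\<^bsub>B\<^esub> v'" "G r'"
      using insert.IH[of v] rv carr by auto
    let ?X = "Y \<union> (insert b Z - {b'})"
    have "b \<noteq> b'" using b' insert.hyps by auto
    have v': "v' \<in> carrier B" "b' \<in> carrier B" using b' carr lspan_closed[OF b'(3)] by auto
    have "v' \<in> lspan R B ?X"
      using b'(3) lspan_mono[of "Y \<union> (Z - {b'})" ?X] by blast
    then have "r \<odot>\<^bsub>B\<^esub> b \<oplus>\<^bsub>B\<^esub> v' \<in> lspan R B ?X"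
      using rv \<open>b \<noteq> b'\<close> by (intro lspan.lspan_step) auto
    moreover have "y = r' \<odot>\<^bsub>B\<^esub> b' \<oplus>\<^bsub>B\<^esub> (r \<odot>\<^bsub>B\<^esub> b \<oplus>\<^bsub>B\<^esub> v')"
      unfolding rv(3) b'(4) using rv(1) b'(2) v v' by (simp add: M.a_ac)
    ultimately show ?thesis using b' by blast
  qed
qed

end

lemma (in quad_alg) plain_module: "plain_module R B"
  by (intro plain_module.intro M.module_axioms)

lemma (in quad_alg) lspan_four:
  assumes "a \<in> carrier B" "b \<in> carrier B" "c \<in> carrier B" "w \<in> lspan R B {\<one>\<^bsub>B\<^esub>, a, b, c}"
  shows "\<exists>r0\<in>carrier R. \<exists>r1\<in>carrier R. \<exists>r2\<in>carrier R. \<exists>r3\<in>carrier R.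
      w = r0 \<odot>\<^bsub>B\<^esub> \<one>\<^bsub>B\<^esub> \<oplus>\<^bsub>B\<^esub> (r1 \<odot>\<^bsub>B\<^esub> a \<oplus>\<^bsub>B\<^esub> (r2 \<odot>\<^bsub>B\<^esub> b \<oplus>\<^bsub>B\<^esub> r3 \<odot>\<^bsub>B\<^esub> c))"
proof -
  interpret L: plain_module R B by (rule plain_module)
  obtain r0 v0 where 0: "r0 \<in> carrier R" "v0 \<in> lspan R B {a, b, c}" "w = r0 \<odot>\<^bsub>B\<^esub> \<one>\<^bsub>B\<^esub> \<oplus>\<^bsub>B\<^esub> v0"
    using L.lspan_insert[of "\<one>\<^bsub>B\<^esub>" "{a, b, c}" w] assms by auto
  obtain r1 v1 where 1: "r1 \<in> carrier R" "v1 \<in> lspan R B {b, c}" "v0 = r1 \<odot>\<^bsub>B\<^esub> a \<oplus>\<^bsub>B\<^esub> v1"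
    using L.lspan_insert[of a "{b, c}" v0] assms 0 by auto
  obtain r2 v2 where 2: "r2 \<in> carrier R" "v2 \<in> lspan R B {c}" "v1 = r2 \<odot>\<^bsub>B\<^esub> b \<oplus>\<^bsub>B\<^esub> v2"
    using L.lspan_insert[of b "{c}" v1] assms 1 by auto
  obtain r3 v3 where 3: "r3 \<in> carrier R" "v3 \<in> lspan R B {}" "v2 = r3 \<odot>\<^bsub>B\<^esub> c \<oplus>\<^bsub>B\<^esub> v3"
    using L.lspan_insert[of c "{}" v2] assms 2 by auto
  have "v3 = \<zero>\<^bsub>B\<^esub>" using 3(2) by (cases rule: lspan.cases) auto
  then show ?thesis
    using 0 1 2 3 assms by (intro bexI[of _ r0] bexI[of _ r1] bexI[of _ r2] bexI[of _ r3]) auto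
qed

text \<open>The difference of the two sides of the trace identity is bilinear, so it vanishes once
  it does on generators.\<close>

lemma (in quad_alg) trace_algI:
  assumes one: "N \<one>\<^bsub>B\<^esub> = \<one>\<^bsub>R\<^esub>" and gens: "gens \<subseteq> carrier B"
    and span: "carrier B \<subseteq> lspan R B gens"
    and trace: "\<And>x y. x \<in> gens \<Longrightarrow> y \<in> gens \<Longrightarrow> P x y = Tr x \<otimes>\<^bsub>R\<^esub> Tr y \<ominus>\<^bsub>R\<^esub> Tr (x \<otimes>\<^bsub>B\<^esub> y)"
  shows "trace_alg R B N"
proof
  interpret L: plain_module R B by (rule plain_module)
  define E where "E x y = Tr x \<otimes>\<^bsub>R\<^esub> Tr y \<ominus>\<^bsub>R\<^esub> (Tr (x \<otimes>\<^bsub>B\<^esub> y) \<oplus>\<^bsub>R\<^esub> P x y)" for x y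
  have E_closed [simp]: "E x y \<in> carrier R" if "x \<in> carrier B" "y \<in> carrier B" for x y
    using that by (simp add: E_def)
  have E_add: "E (x \<oplus>\<^bsub>B\<^esub> z) y = E x y \<oplus>\<^bsub>R\<^esub> E z y" "E y (x \<oplus>\<^bsub>B\<^esub> z) = E y x \<oplus>\<^bsub>R\<^esub> E y z"
    if "x \<in> carrier B" "y \<in> carrier B" "z \<in> carrier B" for x y z
    using that by (simp_all add: E_def B.l_distr B.r_distr expand_R)
  have E_smult: "E (r \<odot>\<^bsub>B\<^esub> x) y = r \<otimes>\<^bsub>R\<^esub> E x y" "E y (r \<odot>\<^bsub>B\<^esub> x) = r \<otimes>\<^bsub>R\<^esub> E y x"
    if "r \<in> carrier R" "x \<in> carrier B" "y \<in> carrier B" for r x y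
    using that by (simp_all add: E_def expand_R)
  have E_zero: "E \<zero>\<^bsub>B\<^esub> y = \<zero>\<^bsub>R\<^esub>" "E y \<zero>\<^bsub>B\<^esub> = \<zero>\<^bsub>R\<^esub>" if "y \<in> carrier B" for y
    using that by (simp_all add: E_def R.diff_self)
  have E_X: "E x y = \<zero>\<^bsub>R\<^esub>" if "x \<in> gens" "y \<in> gens" for x y
    using trace[OF that] gens that by (simp add: E_def R.diff_simps subsetD)
  fix x y assume x: "x \<in> carrier B" and y: "y \<in> carrier B"
  have "x \<in> lspan R B gens" using x span by auto
  then have "E x y = \<zero>\<^bsub>R\<^esub>"
  proof (induction rule: lspan.induct)
    case (lspan_step x0 r v)
    have v: "v \<in> carrier B" "x0 \<in> carrier B" using lspan_step L.lspan_closed gens by auto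
    have "y \<in> lspan R B gens" using y span by auto
    then have "E x0 y = \<zero>\<^bsub>R\<^esub>"
    proof (induction rule: lspan.induct)
      case (lspan_step y0 s u)
      moreover have "u \<in> carrier B" "y0 \<in> carrier B" using lspan_step L.lspan_closed gens by auto
      ultimately show ?case using v \<open>x0 \<in> gens\<close> by (simp add: E_add E_smult E_X)
    qed (use v in \<open>simp add: E_zero\<close>)
    then show ?case using lspan_step v y by (simp add: E_add E_smult)
  qed (use y in \<open>simp add: E_zero\<close>)
  then show "P x y = Tr x \<otimes>\<^bsub>R\<^esub> Tr y \<ominus>\<^bsub>R\<^esub> Tr (x \<otimes>\<^bsub>B\<^esub> y)"
    using x y by (simp add: E_def R.diff_simps)
qed (rule one)

text \<open>The failure of Cayley-Hamilton is a quadratic map whose polarization is the failure of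
  the linearized identity, so both are required on the generators.\<close>

lemma (in trace_alg) ch_algI:
  assumes gens: "gens \<subseteq> carrier B" and span: "carrier B \<subseteq> lspan R B gens"
    and quadratic: "\<And>x. x \<in> gens \<Longrightarrow> x \<otimes>\<^bsub>B\<^esub> x \<oplus>\<^bsub>B\<^esub> N x \<odot>\<^bsub>B\<^esub> \<one>\<^bsub>B\<^esub> = Tr x \<odot>\<^bsub>B\<^esub> x"
    and linear: "\<And>x y. x \<in> gens \<Longrightarrow> y \<in> gens \<Longrightarrow>
      x \<otimes>\<^bsub>B\<^esub> y \<oplus>\<^bsub>B\<^esub> (P x y \<odot>\<^bsub>B\<^esub> \<one>\<^bsub>B\<^esub> \<oplus>\<^bsub>B\<^esub> y \<otimes>\<^bsub>B\<^esub> x) = Tr x \<odot>\<^bsub>B\<^esub> y \<oplus>\<^bsub>B\<^esub> Tr y \<odot>\<^bsub>B\<^esub> x"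
  shows "ch_alg R B N"
proof
  interpret L: plain_module R B by (rule plain_module)
  define E where "E x y = (Tr x \<odot>\<^bsub>B\<^esub> y \<oplus>\<^bsub>B\<^esub> Tr y \<odot>\<^bsub>B\<^esub> x) \<ominus>\<^bsub>B\<^esub> (x \<otimes>\<^bsub>B\<^esub> y \<oplus>\<^bsub>B\<^esub> (P x y \<odot>\<^bsub>B\<^esub> \<one>\<^bsub>B\<^esub> \<oplus>\<^bsub>B\<^esub> y \<otimes>\<^bsub>B\<^esub> x))"
    for x y
  have E_closed [simp]: "E x y \<in> carrier B" if "x \<in> carrier B" "y \<in> carrier B" for x y
    using that by (simp add: E_def)
  have E_add: "E (x \<oplus>\<^bsub>B\<^esub> z) y = E x y \<oplus>\<^bsub>B\<^esub> E z y" "E y (x \<oplus>\<^bsub>B\<^esub> z) = E y x \<oplus>\<^bsub>B\<^esub> E y z"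
    if "x \<in> carrier B" "y \<in> carrier B" "z \<in> carrier B" for x y z
    using that by (simp_all add: E_def expand)
  have E_smult: "E (r \<odot>\<^bsub>B\<^esub> x) y = r \<odot>\<^bsub>B\<^esub> E x y" "E y (r \<odot>\<^bsub>B\<^esub> x) = r \<odot>\<^bsub>B\<^esub> E y x"
    if "r \<in> carrier R" "x \<in> carrier B" "y \<in> carrier B" for r x y
    using that by (simp_all add: E_def expand R.m_comm)
  have E_zero: "E \<zero>\<^bsub>B\<^esub> y = \<zero>\<^bsub>B\<^esub>" "E y \<zero>\<^bsub>B\<^esub> = \<zero>\<^bsub>B\<^esub>" if "y \<in> carrier B" for y
    using that E_smult[of "\<zero>\<^bsub>R\<^esub>" "\<zero>\<^bsub>B\<^esub>" y] by simp_all
  have E_X: "E x y = \<zero>\<^bsub>B\<^esub>" if "x \<in> gens" "y \<in> gens" for x y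
    using linear[OF that] gens that by (simp add: E_def B.diff_self subsetD)
  have E: "E x y = \<zero>\<^bsub>B\<^esub>" if x: "x \<in> carrier B" and y: "y \<in> carrier B" for x y
  proof -
    have "x \<in> lspan R B gens" using x span by auto
    then show ?thesis
    proof (induction rule: lspan.induct)
      case (lspan_step x0 r v)
      have v: "v \<in> carrier B" "x0 \<in> carrier B" using lspan_step L.lspan_closed gens by auto
      have "y \<in> lspan R B gens" using y span by auto
      then have "E x0 y = \<zero>\<^bsub>B\<^esub>"
      proof (induction rule: lspan.induct)
        case (lspan_step y0 s u)
        moreover have "u \<in> carrier B" "y0 \<in> carrier B" using lspan_step L.lspan_closed gens by auto
        ultimately show ?case using v \<open>x0 \<in> gens\<close> by (simp add: E_add E_smult E_X)
      qed (use v in \<open>simp add: E_zero\<close>)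
      then show ?case using lspan_step v y by (simp add: E_add E_smult)
    qed (use y in \<open>simp add: E_zero\<close>)
  qed
  define D where "D x = Tr x \<odot>\<^bsub>B\<^esub> x \<ominus>\<^bsub>B\<^esub> (x \<otimes>\<^bsub>B\<^esub> x \<oplus>\<^bsub>B\<^esub> N x \<odot>\<^bsub>B\<^esub> \<one>\<^bsub>B\<^esub>)" for x
  have D_add: "D (x \<oplus>\<^bsub>B\<^esub> y) = D x \<oplus>\<^bsub>B\<^esub> (D y \<oplus>\<^bsub>B\<^esub> E x y)" if "x \<in> carrier B" "y \<in> carrier B" for x y
    using that by (simp add: D_def E_def N_add expand)
  have D_smult: "D (r \<odot>\<^bsub>B\<^esub> x) = (r \<otimes>\<^bsub>R\<^esub> r) \<odot>\<^bsub>B\<^esub> D x" if "r \<in> carrier R" "x \<in> carrier B" for r x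
    using that by (simp add: D_def N_smult expand R.m_ac)
  fix x assume x: "x \<in> carrier B"
  then have "x \<in> lspan R B gens" using span by auto
  then have "D x = \<zero>\<^bsub>B\<^esub>"
  proof (induction rule: lspan.induct)
    case lspan_zero
    then show ?case using D_smult[of "\<zero>\<^bsub>R\<^esub>" "\<zero>\<^bsub>B\<^esub>"] by (simp add: D_def)
  next
    case (lspan_step y r v)
    moreover have v: "v \<in> carrier B" "y \<in> carrier B" using lspan_step L.lspan_closed gens by auto
    moreover have "D y = \<zero>\<^bsub>B\<^esub>"
      using quadratic[OF lspan_step(1)] v by (simp add: D_def B.diff_self)
    ultimately show ?case by (simp add: D_add D_smult E)
  qed
  then show "x \<otimes>\<^bsub>B\<^esub> x = Tr x \<odot>\<^bsub>B\<^esub> x \<ominus>\<^bsub>B\<^esub> N x \<odot>\<^bsub>B\<^esub> \<one>\<^bsub>B\<^esub>"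
    using x by (simp add: D_def B.diff_eq_eq B.eq_diff_eq)
qed

section \<open>Split algebras and local frames\<close>

text \<open>\<open>h_zero_imp\<close> is injectivity of \<open>h\<close>; for an etale
  trivialization it comes from flatness and surjectivity on spectra.\<close>

locale split_alg = quad_alg R B N for R :: "'r ring" and B :: "('r, 'q) module" and N +
  fixes A :: "'a ring" and h :: "'r \<Rightarrow> 'a" and \<phi> :: "'q \<Rightarrow> 'a \<times> 'a \<times> 'a \<times> 'a"
  assumes A: "cring A" and h: "h \<in> ring_hom R A" and split: "splitting R B A h \<phi>"
    and det: "\<And>y. y \<in> carrier B \<Longrightarrow> det2 A (\<phi> y) = h (N y)"
    and h_zero_imp: "\<And>r. r \<in> carrier R \<Longrightarrow> h r = \<zero>\<^bsub>A\<^esub> \<Longrightarrow> r = \<zero>\<^bsub>R\<^esub>"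
begin

sublocale A: mat2_ring A by (intro mat2_ring.intro A)
sublocale M: ch_alg A "mat2 A" "det2 A" by (rule A.ch_alg_mat2)
sublocale h: ring_hom_ring R A h
  by (intro ring_hom_ringI2 R.ring_axioms A.ring_axioms h)
sublocale \<phi>: ring_hom_ring B "mat2 A" \<phi>
  using split by (intro ring_hom_ringI2 B.ring_axioms M.B.ring_axioms) (simp add: splitting_def)

lemma \<phi>_smult: "r \<in> carrier R \<Longrightarrow> x \<in> carrier B \<Longrightarrow> \<phi> (r \<odot>\<^bsub>B\<^esub> x) = h r \<odot>\<^bsub>mat2 A\<^esub> \<phi> x"
  using split by (simp add: splitting_def)

lemma h_diff: "r \<in> carrier R \<Longrightarrow> s \<in> carrier R \<Longrightarrow> h (r \<ominus>\<^bsub>R\<^esub> s) = h r \<ominus>\<^bsub>A\<^esub> h s"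
  by (simp add: R.minus_eq A.minus_eq)

lemma \<phi>_diff: "x \<in> carrier B \<Longrightarrow> y \<in> carrier B \<Longrightarrow> \<phi> (x \<ominus>\<^bsub>B\<^esub> y) = \<phi> x \<ominus>\<^bsub>mat2 A\<^esub> \<phi> y"
  by (simp add: B.minus_eq M.B.minus_eq)

lemma h_inj: "r \<in> carrier R \<Longrightarrow> s \<in> carrier R \<Longrightarrow> h r = h s \<Longrightarrow> r = s"
  using h_zero_imp[of "r \<ominus>\<^bsub>R\<^esub> s"] by (simp add: h_diff A.diff_self R.diff_eq_eq)

lemma h_P: "x \<in> carrier B \<Longrightarrow> y \<in> carrier B \<Longrightarrow> h (P x y) = M.P (\<phi> x) (\<phi> y)"
  by (simp add: polar_form_def h_diff det flip: \<phi>.hom_add)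

lemma h_Tr: "x \<in> carrier B \<Longrightarrow> h (Tr x) = M.Tr (\<phi> x)"
  using h_P[of x "\<one>\<^bsub>B\<^esub>"] by simp

lemma h_tau: "x \<in> carrier B \<Longrightarrow> y \<in> carrier B \<Longrightarrow> z \<in> carrier B \<Longrightarrow>
    h (tau x y z) = M.tau (\<phi> x) (\<phi> y) (\<phi> z)"
  by (simp add: tau_def M.tau_def comm_def M.comm_def h_P \<phi>_diff del: P_diff M.P_diff)

lemma trace_alg: "trace_alg R B N"
proof
  show "N \<one>\<^bsub>B\<^esub> = \<one>\<^bsub>R\<^esub>"
    by (rule h_inj) (simp_all add: det[symmetric] M.N_one)
  fix x y assume "x \<in> carrier B" "y \<in> carrier B"
  then show "P x y = Tr x \<otimes>\<^bsub>R\<^esub> Tr y \<ominus>\<^bsub>R\<^esub> Tr (x \<otimes>\<^bsub>B\<^esub> y)"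
    using M.trace_mult[of "\<phi> x" "\<phi> y"] by (intro h_inj) (simp_all add: h_P h_Tr h_diff)
qed

text \<open>Every matrix is the image of a tensor, that is, an \<open>A\<close>-linear combination
  of values of \<open>\<phi>\<close>.\<close>

lemma spanning:
  assumes C: "subgroup C (add_monoid (mat2 A))"
    and smult: "\<And>k X'. k \<in> carrier A \<Longrightarrow> X' \<in> C \<Longrightarrow> k \<odot>\<^bsub>mat2 A\<^esub> X' \<in> C"
    and \<phi>: "\<And>x. x \<in> carrier B \<Longrightarrow> \<phi> x \<in> C"
  shows "carrier (mat2 A) \<subseteq> C"
proof
  let ?\<beta> = "\<lambda>(x, s). s \<odot>\<^bsub>mat2 A\<^esub> \<phi> x"
  interpret b: balanced_map R B "restrict_scalars A h" "mat2 A" ?\<beta>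
    by (rule balanced_map.intro[OF M.B.is_abelian_group])
      (auto simp: restrict_scalars_def M.M.smult_r_distr M.M.smult_l_distr M.smult_smult \<phi>_smult A.m_comm)
  fix X' assume "X' \<in> carrier (mat2 A)"
  moreover have "bij_betw (tensor_lift (mat2 A) ?\<beta>)
      (carrier (tensor_product R B (restrict_scalars A h))) (carrier (mat2 A))"
    using split by (simp add: splitting_def)
  ultimately obtain z where z: "z \<in> carrier b.F" "X' = tensor_lift (mat2 A) ?\<beta> (b.K #>\<^bsub>b.F\<^esub> z)"
    unfolding bij_betw_def b.carrier_tensor_product by blast
  then have "X' = frag_lift (mat2 A) ?\<beta> z"
    by (simp only: b.tensor_lift_coset)
  also have "\<dots> \<in> C"
    using z(1) by (intro frag_lift_in_subgroup M.B.is_abelian_group C)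
      (auto simp: restrict_scalars_def intro!: smult \<phi>)
  finally show "X' \<in> C" .
qed

text \<open>The matrices that \<open>l\<close> sends into \<open>I\<close> form an
  \<open>A\<close>-submodule containing the image of \<open>\<phi>\<close>.\<close>

lemma linear_in_ideal:
  assumes I: "ideal I A"
    and closed: "\<And>X'. X' \<in> carrier (mat2 A) \<Longrightarrow> l X' \<in> carrier A"
    and add: "\<And>X' Y. X' \<in> carrier (mat2 A) \<Longrightarrow> Y \<in> carrier (mat2 A) \<Longrightarrow> l (X' \<oplus>\<^bsub>mat2 A\<^esub> Y) = l X' \<oplus>\<^bsub>A\<^esub> l Y"
    and smult: "\<And>k X'. k \<in> carrier A \<Longrightarrow> X' \<in> carrier (mat2 A) \<Longrightarrow> l (k \<odot>\<^bsub>mat2 A\<^esub> X') = k \<otimes>\<^bsub>A\<^esub> l X'"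
    and \<phi>: "\<And>x. x \<in> carrier B \<Longrightarrow> l (\<phi> x) \<in> I"
    and X': "X' \<in> carrier (mat2 A)"
  shows "l X' \<in> I"
proof -
  interpret I: ideal I A by (rule I)
  let ?C = "{X' \<in> carrier (mat2 A). l X' \<in> I}"
  have "subgroup ?C (add_monoid (mat2 A))"
  proof (rule M.B.add.subgroupI)
    have "\<one>\<^bsub>mat2 A\<^esub> \<in> ?C" using \<phi>[of "\<one>\<^bsub>B\<^esub>"] by simp
    then show "?C \<noteq> {}" by blast
  next
    fix X' assume X': "X' \<in> ?C"
    have "l (\<ominus>\<^bsub>mat2 A\<^esub> X') = l ((\<ominus>\<^bsub>A\<^esub> \<one>\<^bsub>A\<^esub>) \<odot>\<^bsub>mat2 A\<^esub> X')"
      using X' by (simp add: M.M.smult_l_minus)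
    also have "\<dots> \<in> I"
      using X' I.I_l_closed by (simp add: smult)
    finally show "\<ominus>\<^bsub>mat2 A\<^esub> X' \<in> ?C"
      using X' by simp
  qed (auto simp: add additive_subgroup.a_closed[OF I.additive_subgroup_axioms])
  then have "carrier (mat2 A) \<subseteq> ?C"
    by (rule spanning) (auto simp: smult I.I_l_closed \<phi>)
  then show ?thesis using X' by auto
qed

text \<open>If \<open>tau\<close> mapped into \<open>I\<close> for all elements of \<open>B\<close>,
  then by linearity in one argument at a time the matrix form would take values in \<open>I\<close>
  on all matrices; but a triple of matrix units gives \<open>-1\<close>.\<close>

lemma ex_tau_notin_prime:
  assumes "primeideal I A"
  shows "\<exists>x\<in>carrier B. \<exists>y\<in>carrier B. \<exists>z\<in>carrier B. h (tau x y z) \<notin> I"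
proof (rule ccontr)
  assume "\<not> ?thesis"
  then have 0: "M.tau (\<phi> x) (\<phi> y) (\<phi> z) \<in> I"
    if "x \<in> carrier B" "y \<in> carrier B" "z \<in> carrier B" for x y z
    using that h_tau by fastforce
  interpret I: primeideal I A by (rule assms)
  note lin = M.tau_def M.comm_add M.comm_smult
  have 1: "M.tau (\<phi> x) (\<phi> y) Z \<in> I" if "x \<in> carrier B" "y \<in> carrier B" "Z \<in> carrier (mat2 A)" for x y Z
    by (rule linear_in_ideal[OF I.is_ideal, of "\<lambda>Z. M.tau (\<phi> x) (\<phi> y) Z"]) (use that 0 in \<open>auto simp: lin\<close>)
  have 2: "M.tau (\<phi> x) Y Z \<in> I" if "x \<in> carrier B" "Y \<in> carrier (mat2 A)" "Z \<in> carrier (mat2 A)" for x Y Z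
    by (rule linear_in_ideal[OF I.is_ideal, of "\<lambda>Y. M.tau (\<phi> x) Y Z"]) (use that 1 in \<open>auto simp: lin\<close>)
  have 3: "M.tau X' Y Z \<in> I"
    if "X' \<in> carrier (mat2 A)" "Y \<in> carrier (mat2 A)" "Z \<in> carrier (mat2 A)" for X' Y Z
    by (rule linear_in_ideal[OF I.is_ideal, of "\<lambda>X'. M.tau X' Y Z"]) (use that 2 in \<open>auto simp: lin\<close>)
  have "\<ominus>\<^bsub>A\<^esub> \<one>\<^bsub>A\<^esub> \<in> I"
    unfolding A.tau_mat2[symmetric] by (rule 3) (auto simp: mat2_simps)
  then have "\<ominus>\<^bsub>A\<^esub> \<one>\<^bsub>A\<^esub> \<otimes>\<^bsub>A\<^esub> \<ominus>\<^bsub>A\<^esub> \<one>\<^bsub>A\<^esub> \<in> I"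
    by (intro I.I_l_closed) auto
  then have "\<one>\<^bsub>A\<^esub> \<in> I"
    by (simp add: A.l_minus)
  then show False
    using I.I_notcarr I.one_imp_carrier by blast
qed

text \<open>A substitute for injectivity of \<open>\<phi>\<close>: elements with the same image
  cannot be told apart by the polar form, which is nondegenerate in the presence of a frame.\<close>

lemma \<phi>_eq_imp_P_eq:
  assumes "p \<in> carrier B" "q \<in> carrier B" "\<phi> p = \<phi> q" "y \<in> carrier B"
  shows "P p y = P q y"
  using assms by (intro h_inj) (simp_all add: h_P)

lemma \<phi>_CH:
  assumes "x \<in> carrier B"
  shows "\<phi> (x \<otimes>\<^bsub>B\<^esub> x \<oplus>\<^bsub>B\<^esub> N x \<odot>\<^bsub>B\<^esub> \<one>\<^bsub>B\<^esub>) = \<phi> (Tr x \<odot>\<^bsub>B\<^esub> x)"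
  using assms by (simp add: \<phi>_smult h_Tr M.CH det[symmetric] M.B.diff_simps M.B.diff_self)

lemma \<phi>_CH_linear:
  assumes "x \<in> carrier B" "y \<in> carrier B"
  shows "\<phi> (x \<otimes>\<^bsub>B\<^esub> y \<oplus>\<^bsub>B\<^esub> (P x y \<odot>\<^bsub>B\<^esub> \<one>\<^bsub>B\<^esub> \<oplus>\<^bsub>B\<^esub> y \<otimes>\<^bsub>B\<^esub> x)) =
    \<phi> (Tr x \<odot>\<^bsub>B\<^esub> y \<oplus>\<^bsub>B\<^esub> Tr y \<odot>\<^bsub>B\<^esub> x)"
proof -
  have "\<phi> x \<otimes>\<^bsub>mat2 A\<^esub> \<phi> y \<oplus>\<^bsub>mat2 A\<^esub> (M.P (\<phi> x) (\<phi> y) \<odot>\<^bsub>mat2 A\<^esub> \<one>\<^bsub>mat2 A\<^esub> \<oplus>\<^bsub>mat2 A\<^esub> \<phi> y \<otimes>\<^bsub>mat2 A\<^esub> \<phi> x) =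
      M.Tr (\<phi> x) \<odot>\<^bsub>mat2 A\<^esub> \<phi> y \<oplus>\<^bsub>mat2 A\<^esub> M.Tr (\<phi> y) \<odot>\<^bsub>mat2 A\<^esub> \<phi> x"
    using assms M.CH_linear[of "\<phi> x" "\<phi> y"] by (simp add: M.B.eq_diff_eq)
  then show ?thesis
    using assms by (simp add: \<phi>_smult h_Tr h_P)
qed

end

lemma is_sheaf_eqI:
  assumes F: "is_sheaf T F r" and "openin T U" "x \<in> F U" "y \<in> F U"
    and loc: "\<And>p. p \<in> U \<Longrightarrow> \<exists>V. openin T V \<and> p \<in> V \<and> V \<subseteq> U \<and> r U V x = r U V y"
  shows "x = y"
proof -
  \<comment> \<open>Taking all open sets on which the sections agree avoids choosing one at each
    point.\<close>
  define \<U> where "\<U> = {V. openin T V \<and> V \<subseteq> U \<and> r U V x = r U V y}"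
  have eq: "\<Union>\<U> = U" using loc by (auto simp: \<U>_def)
  have "\<forall>V\<in>\<U>. openin T V" by (simp add: \<U>_def)
  then have "\<forall>s\<in>F (\<Union>\<U>). \<forall>t\<in>F (\<Union>\<U>). (\<forall>V\<in>\<U>. r (\<Union>\<U>) V s = r (\<Union>\<U>) V t) \<longrightarrow> s = t"
    using F unfolding is_sheaf_def by (elim conjE) (drule spec[of _ \<U>], elim impE conjE)
  then show ?thesis
    unfolding eq using assms(3,4) by (simp add: \<U>_def)
qed

lemma is_sheaf_glue:
  assumes F: "is_sheaf T F r" and "\<And>U. U \<in> \<U> \<Longrightarrow> openin T U" "\<And>U. U \<in> \<U> \<Longrightarrow> f U \<in> F U"
    and "\<And>U V. U \<in> \<U> \<Longrightarrow> V \<in> \<U> \<Longrightarrow> r U (U \<inter> V) (f U) = r V (U \<inter> V) (f V)"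
  shows "\<exists>s\<in>F (\<Union>\<U>). \<forall>U\<in>\<U>. r (\<Union>\<U>) U s = f U"
proof -
  have "\<forall>V\<in>\<U>. openin T V" using assms(2) by simp
  then have "\<forall>f. (\<forall>U\<in>\<U>. f U \<in> F U) \<and>
      (\<forall>U\<in>\<U>. \<forall>V\<in>\<U>. r U (U \<inter> V) (f U) = r V (U \<inter> V) (f V)) \<longrightarrow>
      (\<exists>s\<in>F (\<Union>\<U>). \<forall>U\<in>\<U>. r (\<Union>\<U>) U s = f U)"
    using F unfolding is_sheaf_def by (elim conjE) (drule spec[of _ \<U>], elim impE conjE)
  from spec[OF this, of f] show ?thesis using assms(3,4) by blast
qed

lemmas (in scheme) rho_eq_if_locally_eq = is_sheaf_eqI[OF ringed_spaceD(1)[OF ringed]]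

locale norm_sheaf = scheme S for S :: "('p, 'r) ringed_space" +
  fixes Q :: "('p, 'r, 'q) alg_sheaf" and N :: "'p set \<Rightarrow> 'q \<Rightarrow> 'r"
  assumes sheaf: "sheaf_of_algebras S Q" and form: "quadratic_form S Q N"
begin

abbreviation F where "F \<equiv> al_sec Q"
abbreviation ar where "ar \<equiv> al_res Q"
abbreviation P where "P U \<equiv> polar_form (Oc U) (F U) (N U)"
abbreviation tau where "tau U \<equiv> quad_alg.tau (Oc U) (F U) (N U)"

lemma qa: "opens U \<Longrightarrow> quad_alg (Oc U) (F U) (N U)"
  using sheaf form O_cring
  by (simp add: quad_alg_def sheaf_of_algebras_def quadratic_form_def)

lemma F_sheaf: "is_sheaf (rs_top S) (\<lambda>U. carrier (F U)) ar"
  using sheaf by (simp add: sheaf_of_algebras_def)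

lemma F_ring: "opens U \<Longrightarrow> ring (F U)"
  using sheaf by (simp add: sheaf_of_algebras_def assoc_algebra_def)

lemma ar_hom: "opens U \<Longrightarrow> opens V \<Longrightarrow> V \<subseteq> U \<Longrightarrow> ar U V \<in> ring_hom (F U) (F V)"
  using sheaf by (simp add: sheaf_of_algebras_def)

lemma ar_hom_ring: "opens U \<Longrightarrow> opens V \<Longrightarrow> V \<subseteq> U \<Longrightarrow> ring_hom_ring (F U) (F V) (ar U V)"
  by (intro ring_hom_ringI2 F_ring ar_hom)

lemma ar_smult: "opens U \<Longrightarrow> opens V \<Longrightarrow> V \<subseteq> U \<Longrightarrow> r \<in> carrier (Oc U) \<Longrightarrow> x \<in> carrier (F U) \<Longrightarrow>
    ar U V (r \<odot>\<^bsub>F U\<^esub> x) = rho U V r \<odot>\<^bsub>F V\<^esub> ar U V x"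
  using sheaf by (simp add: sheaf_of_algebras_def)

lemma ar_closed: "opens U \<Longrightarrow> opens V \<Longrightarrow> V \<subseteq> U \<Longrightarrow> x \<in> carrier (F U) \<Longrightarrow> ar U V x \<in> carrier (F V)"
  using ring_hom_closed[OF ar_hom] .

lemma ar_ar:
  "opens U \<Longrightarrow> opens V \<Longrightarrow> opens W \<Longrightarrow> W \<subseteq> V \<Longrightarrow> V \<subseteq> U \<Longrightarrow> x \<in> carrier (F U) \<Longrightarrow>
    ar V W (ar U V x) = ar U W x"
  using F_sheaf by (simp add: is_sheaf_def)

lemma ar_id: "opens U \<Longrightarrow> x \<in> carrier (F U) \<Longrightarrow> ar U U x = x"
  using F_sheaf by (simp add: is_sheaf_def)

lemma ar_N: "opens U \<Longrightarrow> opens V \<Longrightarrow> V \<subseteq> U \<Longrightarrow> x \<in> carrier (F U) \<Longrightarrow>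
    N V (ar U V x) = rho U V (N U x)"
  using form by (simp add: quadratic_form_def)

lemma rho_diff:
  assumes "opens U" "opens V" "V \<subseteq> U" "r \<in> carrier (Oc U)" "s \<in> carrier (Oc U)"
  shows "rho U V (r \<ominus>\<^bsub>Oc U\<^esub> s) = rho U V r \<ominus>\<^bsub>Oc V\<^esub> rho U V s"
proof -
  interpret ring_hom_ring "Oc U" "Oc V" "rho U V" by (rule rho_hom[OF assms(1-3)])
  show ?thesis using assms(4,5) by (simp add: R.minus_eq S.minus_eq)
qed

lemma ar_diff:
  assumes "opens U" "opens V" "V \<subseteq> U" "x \<in> carrier (F U)" "y \<in> carrier (F U)"
  shows "ar U V (x \<ominus>\<^bsub>F U\<^esub> y) = ar U V x \<ominus>\<^bsub>F V\<^esub> ar U V y"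
proof -
  interpret ring_hom_ring "F U" "F V" "ar U V" by (rule ar_hom_ring[OF assms(1-3)])
  show ?thesis using assms(4,5) by (simp add: R.minus_eq S.minus_eq)
qed

lemma ar_P:
  assumes "opens U" "opens V" "V \<subseteq> U" "x \<in> carrier (F U)" "y \<in> carrier (F U)"
  shows "P V (ar U V x) (ar U V y) = rho U V (P U x y)"
proof -
  interpret ring_hom_ring "F U" "F V" "ar U V" by (rule ar_hom_ring[OF assms(1-3)])
  interpret U: quad_alg "Oc U" "F U" "N U" by (rule qa[OF assms(1)])
  show ?thesis
    using assms by (simp add: polar_form_def rho_diff ar_N flip: hom_add)
qed

lemma ar_comm:
  assumes "opens U" "opens V" "V \<subseteq> U" "x \<in> carrier (F U)" "y \<in> carrier (F U)"
  shows "quad_alg.comm (F V) (ar U V x) (ar U V y) = ar U V (quad_alg.comm (F U) x y)"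
proof -
  interpret ring_hom_ring "F U" "F V" "ar U V" by (rule ar_hom_ring[OF assms(1-3)])
  interpret U: quad_alg "Oc U" "F U" "N U" by (rule qa[OF assms(1)])
  interpret V: quad_alg "Oc V" "F V" "N V" by (rule qa[OF assms(2)])
  show ?thesis
    using assms by (simp add: U.comm_def V.comm_def ar_diff)
qed

lemma ar_tau:
  assumes "opens U" "opens V" "V \<subseteq> U" "x \<in> carrier (F U)" "y \<in> carrier (F U)" "z \<in> carrier (F U)"
  shows "tau V (ar U V x) (ar U V y) (ar U V z) = rho U V (tau U x y z)"
proof -
  interpret U: quad_alg "Oc U" "F U" "N U" by (rule qa[OF assms(1)])
  interpret V: quad_alg "Oc V" "F V" "N V" by (rule qa[OF assms(2)])
  show ?thesis
    using assms by (simp add: U.tau_def V.tau_def ar_comm ar_P)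
qed

lemma ar_conj:
  assumes "opens U" "opens V" "V \<subseteq> U" "x \<in> carrier (F U)"
  shows "quad_alg.conj (Oc V) (F V) (N V) (ar U V x) = ar U V (quad_alg.conj (Oc U) (F U) (N U) x)"
proof -
  interpret ring_hom_ring "F U" "F V" "ar U V" by (rule ar_hom_ring[OF assms(1-3)])
  interpret U: quad_alg "Oc U" "F U" "N U" by (rule qa[OF assms(1)])
  interpret V: quad_alg "Oc V" "F V" "N V" by (rule qa[OF assms(2)])
  show ?thesis
    using assms ar_P[OF assms, of "\<one>\<^bsub>F U\<^esub>"] by (simp add: U.conj_def V.conj_def ar_diff ar_smult)
qed

lemma eq_if_locally_eq:
  assumes "opens U" "x \<in> carrier (F U)" "y \<in> carrier (F U)"
    and "\<And>p. p \<in> U \<Longrightarrow> \<exists>V. opens V \<and> p \<in> V \<and> V \<subseteq> U \<and> ar U V x = ar U V y"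
  shows "x = y"
  by (rule is_sheaf_eqI[OF F_sheaf assms])

end

section \<open>Exchange of local generators and construction of frames\<close>

context norm_sheaf
begin

text \<open>Spanning is demanded over every smaller open set, since sections there need not be
  combinations of restrictions from \<open>V\<close>.\<close>

definition generates :: "'p set \<Rightarrow> 'q set \<Rightarrow> bool" where
  "generates V Z \<longleftrightarrow> Z \<subseteq> carrier (F V) \<and>
     (\<forall>W. opens W \<and> W \<subseteq> V \<longrightarrow> carrier (F W) \<subseteq> lspan (Oc W) (F W) (ar V W ` Z))"

lemma plain: "opens U \<Longrightarrow> plain_module (Oc U) (F U)"
  using quad_alg.plain_module[OF qa] .

lemma ar_lspan:
  assumes U: "opens U" and V: "opens V" "V \<subseteq> U" and Z: "Z \<subseteq> carrier (F U)"
    and w: "w \<in> lspan (Oc U) (F U) Z"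
  shows "ar U V w \<in> lspan (Oc V) (F V) (ar U V ` Z)"
proof -
  interpret a: ring_hom_ring "F U" "F V" "ar U V" by (rule ar_hom_ring[OF U V])
  interpret U: quad_alg "Oc U" "F U" "N U" by (rule qa[OF U])
  interpret L: plain_module "Oc U" "F U" by (rule plain[OF U])
  show ?thesis
    using w
  proof (induction rule: lspan.induct)
    case lspan_zero
    then show ?case by (simp add: lspan.lspan_zero)
  next
    case (lspan_step b r v)
    have c: "b \<in> carrier (F U)" "v \<in> carrier (F U)"
      using lspan_step Z L.lspan_closed by auto
    then show ?case
      using lspan_step U V by (simp add: ar_smult) (intro lspan.lspan_step imageI rho_closed)
  qed
qed

lemma generates_mono:
  assumes V: "opens V" and W: "opens W" "W \<subseteq> V" and g: "generates V Z"
  shows "generates W (ar V W ` Z)"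
proof -
  have Z: "Z \<subseteq> carrier (F V)" using g by (simp add: generates_def)
  have eq: "ar W W' ` ar V W ` Z = ar V W' ` Z" if "opens W'" "W' \<subseteq> W" for W'
    unfolding image_image by (intro image_cong refl ar_ar V W that subsetD[OF Z])
  show ?thesis
    unfolding generates_def
  proof (intro conjI allI impI)
    show "ar V W ` Z \<subseteq> carrier (F W)"
      using ar_closed[OF V W] Z by blast
    fix W' assume W': "opens W' \<and> W' \<subseteq> W"
    then show "carrier (F W') \<subseteq> lspan (Oc W') (F W') (ar W W' ` ar V W ` Z)"
      using g W unfolding generates_def by (simp add: eq order_trans[of W' W V])
  qed
qed

lemma generates_subst:
  assumes V: "opens V" and g: "generates V Z" and Z': "Z' \<subseteq> carrier (F V)"
    and sub: "Z \<subseteq> lspan (Oc V) (F V) Z'"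
  shows "generates V Z'"
  unfolding generates_def
proof (intro conjI allI impI Z')
  fix W assume W: "opens W \<and> W \<subseteq> V"
  interpret L: plain_module "Oc W" "F W" using W by (intro plain) auto
  have "ar V W ` Z \<subseteq> lspan (Oc W) (F W) (ar V W ` Z')"
    using ar_lspan[OF V _ _ Z'] W sub by blast
  moreover have "ar V W ` Z' \<subseteq> carrier (F W)"
    using W V Z' by (auto intro: ar_closed)
  ultimately have "lspan (Oc W) (F W) (ar V W ` Z) \<subseteq> lspan (Oc W) (F W) (ar V W ` Z')"
    by (intro L.lspan_trans)
  then show "carrier (F W) \<subseteq> lspan (Oc W) (F W) (ar V W ` Z')"
    using g W unfolding generates_def by blast
qed

text \<open>Pairing with \<open>z\<close> kills \<open>Y\<close> and is a unit at \<open>y\<close>,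
  so some generator in \<open>Z\<close> occurs in \<open>y\<close> with a coefficient invertible at
  \<open>x\<close>. Where that coefficient is invertible, the generator is solved for and
  replaced.\<close>

lemma exchange:
  assumes V: "opens V" "x \<in> V" and g: "generates V (Y \<union> Z)" and Z: "finite Z"
    and yz: "y \<in> carrier (F V)" "z \<in> carrier (F V)"
    and orth: "\<And>u. u \<in> Y \<Longrightarrow> P V u z = \<zero>\<^bsub>Oc V\<^esub>" and unit: "germ_unit S V x (P V y z)"
  shows "\<exists>V' b. opens V' \<and> x \<in> V' \<and> V' \<subseteq> V \<and> b \<in> Z \<and>
    generates V' (ar V V' ` (insert y (Y \<union> (Z - {b}))))"
proof -
  interpret V: quad_alg "Oc V" "F V" "N V" by (rule qa[OF V(1)])
  interpret LV: plain_module "Oc V" "F V" by (rule plain[OF V(1)])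
  have YZ: "Y \<union> Z \<subseteq> carrier (F V)" using g by (simp add: generates_def)
  have arV: "ar V V ` (Y \<union> Z) = Y \<union> Z"
    using YZ V by (force simp: ar_id image_iff)
  have "carrier (F V) \<subseteq> lspan (Oc V) (F V) (ar V V ` (Y \<union> Z))"
    using g V(1) unfolding generates_def by (elim conjE allE[of _ V]) simp
  then have y: "y \<in> lspan (Oc V) (F V) (Y \<union> Z)"
    using yz(1) unfolding arV by (rule subsetD)
  have "\<exists>b\<in>Z. \<exists>r\<in>carrier (Oc V). \<exists>v\<in>lspan (Oc V) (F V) (Y \<union> (Z - {b})).
      y = r \<odot>\<^bsub>F V\<^esub> b \<oplus>\<^bsub>F V\<^esub> v \<and> germ_unit S V x r"
  proof (rule LV.lspan_pick[OF Z YZ y, where l = "\<lambda>v. P V v z"])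
    show "germ_unit S V x r \<or> germ_unit S V x s"
      if "r \<in> carrier (Oc V)" "s \<in> carrier (Oc V)" "germ_unit S V x (r \<oplus>\<^bsub>Oc V\<^esub> s)" for r s
      using germ_unit_add[OF V that] .
    show "germ_unit S V x r"
      if "r \<in> carrier (Oc V)" "s \<in> carrier (Oc V)" "germ_unit S V x (r \<otimes>\<^bsub>Oc V\<^esub> s)" for r s
      using germ_unit_mult[OF V that(1,2)] that(3) by simp
    show "\<not> germ_unit S V x \<zero>\<^bsub>Oc V\<^esub>" by (rule germ_unit_zero[OF V])
  qed (use yz orth unit in simp_all)
  then obtain b r v where b: "b \<in> Z" "r \<in> carrier (Oc V)" "v \<in> lspan (Oc V) (F V) (Y \<union> (Z - {b}))"
    "y = r \<odot>\<^bsub>F V\<^esub> b \<oplus>\<^bsub>F V\<^esub> v" "germ_unit S V x r"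
    by blast
  obtain V' where V': "opens V'" "x \<in> V'" "V' \<subseteq> V" "rho V V' r \<in> Units (Oc V')"
    using b(5) by (auto simp: germ_unit_def)
  interpret V': quad_alg "Oc V'" "F V'" "N V'" by (rule qa[OF V'(1)])
  interpret LV': plain_module "Oc V'" "F V'" by (rule plain[OF V'(1)])
  interpret a: ring_hom_ring "F V" "F V'" "ar V V'" by (rule ar_hom_ring[OF V(1) V'(1,3)])
  let ?X = "insert y (Y \<union> (Z - {b}))" and ?r = "rho V V' r"
  let ?s = "inv\<^bsub>Oc V'\<^esub> ?r"
  have X: "?X \<subseteq> carrier (F V)" using YZ yz by auto
  have aX: "ar V V' ` ?X \<subseteq> carrier (F V')" using X by auto
  have bV: "b \<in> carrier (F V)" using b YZ by auto
  have vV: "v \<in> carrier (F V)" using b(3) YZ LV.lspan_closed by blast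
  have s: "?s \<in> carrier (Oc V')" "?r \<in> carrier (Oc V')" using V' by auto
  have "ar V V' y = ?r \<odot>\<^bsub>F V'\<^esub> ar V V' b \<oplus>\<^bsub>F V'\<^esub> ar V V' v"
    unfolding b(4) using V V' b(2) bV vV by (simp add: ar_smult)
  then have rb: "?r \<odot>\<^bsub>F V'\<^esub> ar V V' b = ar V V' y \<ominus>\<^bsub>F V'\<^esub> ar V V' v"
    using s bV vV by (simp add: V'.B.eq_diff_eq)
  have "ar V V' b = ?s \<odot>\<^bsub>F V'\<^esub> (?r \<odot>\<^bsub>F V'\<^esub> ar V V' b)"
    using V' s bV by (simp add: V'.smult_smult)
  also have "\<dots> = ?s \<odot>\<^bsub>F V'\<^esub> ar V V' y \<oplus>\<^bsub>F V'\<^esub> (\<ominus>\<^bsub>Oc V'\<^esub> ?s) \<odot>\<^bsub>F V'\<^esub> ar V V' v"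
    unfolding rb using s vV yz by (simp add: V'.smult_diff V'.M.smult_l_minus V'.B.add_minus_eq)
  finally have ab: "ar V V' b = \<dots>" .
  have "ar V V' v \<in> lspan (Oc V') (F V') (ar V V' ` ?X)"
    using ar_lspan[OF V(1) V'(1,3) _ b(3)] YZ lspan_mono[of "ar V V' ` (Y \<union> (Z - {b}))" "ar V V' ` ?X"]
    by blast
  then have "ar V V' b \<in> lspan (Oc V') (F V') (ar V V' ` ?X)"
    unfolding ab using s by (intro lspan.lspan_step LV'.lspan_smult aX) auto
  moreover have "ar V V' u \<in> lspan (Oc V') (F V') (ar V V' ` ?X)" if "u \<in> ?X" for u
    using that by (intro LV'.lspan_base aX) auto
  ultimately have "ar V V' ` (Y \<union> Z) \<subseteq> lspan (Oc V') (F V') (ar V V' ` ?X)"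
    by auto
  then have "generates V' (ar V V' ` ?X)"
    using generates_subst[OF V'(1) generates_mono[OF V(1) V'(1,3) g] aX] by simp
  then show ?thesis using V' b(1) by blast
qed

text \<open>\<open>Y\<close> collects the sections already exchanged in, and \<open>n\<close> bounds
  the number of old generators left; the shrinking of neighborhoods is hidden in the
  quantifier.\<close>

definition gen_near :: "'p set \<Rightarrow> 'p \<Rightarrow> 'q set \<Rightarrow> nat \<Rightarrow> bool" where
  "gen_near U x Y n \<longleftrightarrow> (\<exists>V Z. opens V \<and> x \<in> V \<and> V \<subseteq> U \<and> finite Z \<and> card Z \<le> n \<and>
     generates V (ar U V ` Y \<union> Z))"

lemma gen_near_insert:
  assumes U: "opens U" and x: "x \<in> U" and g: "gen_near U x Y (Suc n)" and Y: "Y \<subseteq> carrier (F U)"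
    and yz: "y \<in> carrier (F U)" "z \<in> carrier (F U)"
    and orth: "\<And>u. u \<in> Y \<Longrightarrow> P U u z = \<zero>\<^bsub>Oc U\<^esub>" and unit: "germ_unit S U x (P U y z)"
  shows "gen_near U x (insert y Y) n"
proof -
  obtain V Z where V: "opens V" "x \<in> V" "V \<subseteq> U" and Z: "finite Z" "card Z \<le> Suc n"
    and gV: "generates V (ar U V ` Y \<union> Z)"
    using g by (auto simp: gen_near_def)
  interpret UV: ring_hom_ring "Oc U" "Oc V" "rho U V" by (rule rho_hom[OF U V(1,3)])
  interpret U: quad_alg "Oc U" "F U" "N U" by (rule qa[OF U])
  have "P V u (ar U V z) = \<zero>\<^bsub>Oc V\<^esub>" if "u \<in> ar U V ` Y" for u
    using that Y yz U V by (auto simp: ar_P orth subsetD)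
  moreover have unitV: "germ_unit S V x (P V (ar U V y) (ar U V z))"
    using unit yz U V by (simp add: ar_P germ_unit_rho)
  ultimately have "\<exists>V' b. opens V' \<and> x \<in> V' \<and> V' \<subseteq> V \<and> b \<in> Z \<and>
      generates V' (ar V V' ` (insert (ar U V y) (ar U V ` Y \<union> (Z - {b}))))"
    by (intro exchange[OF V(1,2) gV Z(1) _ _ _ unitV] ar_closed[OF U V(1,3)] yz)
  then obtain V' b where V': "opens V'" "x \<in> V'" "V' \<subseteq> V" and b: "b \<in> Z"
    and gV': "generates V' (ar V V' ` (insert (ar U V y) (ar U V ` Y \<union> (Z - {b}))))"
    by blast
  have "ar V V' ` (insert (ar U V y) (ar U V ` Y \<union> (Z - {b}))) =
      ar U V' ` insert y Y \<union> ar V V' ` (Z - {b})"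
    using U V V' yz Y by (auto simp: image_Un image_image ar_ar subsetD intro!: image_cong)
  moreover have "card (ar V V' ` (Z - {b})) \<le> n"
    using card_image_le[of "Z - {b}" "ar V V'"] Z b by (simp add: card_Diff_singleton)
  ultimately show ?thesis
    unfolding gen_near_def using V' V Z gV' by (intro exI[of _ V'] exI[of _ "ar V V' ` (Z - {b})"]) auto
qed

lemma gen_near_subset:
  assumes U: "opens U" and V: "opens V" "x \<in> V" and g: "generates V Z" "finite Z" "card Z \<le> n"
    and x: "x \<in> U"
  shows "gen_near U x {} n"
proof -
  have W: "opens (U \<inter> V)" "U \<inter> V \<subseteq> V" using U V by auto
  have "generates (U \<inter> V) (ar V (U \<inter> V) ` Z)"
    by (rule generates_mono[OF V(1) W g(1)])
  then show ?thesis
    unfolding gen_near_def using W V x g card_image_le[of Z "ar V (U \<inter> V)"]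
    by (intro exI[of _ "U \<inter> V"] exI[of _ "ar V (U \<inter> V) ` Z"]) auto
qed

lemma locally_free_generates:
  assumes "locally_free_of_rank S Q n" "x \<in> sp"
  shows "\<exists>V Z. opens V \<and> x \<in> V \<and> generates V Z \<and> finite Z \<and> card Z \<le> n"
proof -
  obtain V e where V: "opens V" "x \<in> V" "e \<in> {..<n} \<rightarrow> carrier (F V)"
    and bij: "\<And>W. opens W \<Longrightarrow> W \<subseteq> V \<Longrightarrow>
      bij_betw (\<lambda>c. \<Oplus>\<^bsub>F W\<^esub>i\<in>{..<n}. c i \<odot>\<^bsub>F W\<^esub> ar V W (e i))
        ({..<n} \<rightarrow>\<^sub>E carrier (Oc W)) (carrier (F W))"
    using assms unfolding locally_free_of_rank_def by meson
  have "carrier (F W) \<subseteq> lspan (Oc W) (F W) (ar V W ` e ` {..<n})" if W: "opens W" "W \<subseteq> V" for W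
  proof
    interpret W: quad_alg "Oc W" "F W" "N W" by (rule qa[OF W(1)])
    fix w assume "w \<in> carrier (F W)"
    then obtain k where k: "k \<in> {..<n} \<rightarrow>\<^sub>E carrier (Oc W)"
      "w = (\<Oplus>\<^bsub>F W\<^esub>i\<in>{..<n}. k i \<odot>\<^bsub>F W\<^esub> ar V W (e i))"
      using bij[OF W] unfolding bij_betw_def by blast
    have e: "ar V W (e i) \<in> carrier (F W)" if "i < n" for i
      using that V W by (intro ar_closed) auto
    have "(\<Oplus>\<^bsub>F W\<^esub>i\<in>I. k i \<odot>\<^bsub>F W\<^esub> ar V W (e i)) \<in> lspan (Oc W) (F W) (ar V W ` e ` {..<n})"
      if "finite I" "I \<subseteq> {..<n}" for I
      using that
    proof (induction I rule: finite_induct)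
      case empty
      then show ?case by (simp add: lspan.lspan_zero)
    next
      case (insert i I)
      have "k j \<odot>\<^bsub>F W\<^esub> ar V W (e j) \<in> carrier (F W)" if "j \<in> insert i I" for j
        using that insert.prems k(1) e by (intro W.M.smult_closed) auto
      then have "(\<Oplus>\<^bsub>F W\<^esub>i\<in>insert i I. k i \<odot>\<^bsub>F W\<^esub> ar V W (e i)) =
          k i \<odot>\<^bsub>F W\<^esub> ar V W (e i) \<oplus>\<^bsub>F W\<^esub> (\<Oplus>\<^bsub>F W\<^esub>i\<in>I. k i \<odot>\<^bsub>F W\<^esub> ar V W (e i))"
        using insert.hyps by (intro W.B.finsum_insert) auto
      also have "\<dots> \<in> lspan (Oc W) (F W) (ar V W ` e ` {..<n})"
        using insert k(1) by (intro lspan.lspan_step) auto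
      finally show ?case .
    qed
    from this[of "{..<n}"] show "w \<in> lspan (Oc W) (F W) (ar V W ` e ` {..<n})"
      using k(2) by simp
  qed
  then have "generates V (e ` {..<n})"
    unfolding generates_def using V(3) by auto
  then show ?thesis
    using V card_image_le[of "{..<n}" e] by (intro exI[of _ V] exI[of _ "e ` {..<n}"]) auto
qed

text \<open>As in \<open>generates\<close>, the conditions are imposed over all smaller open sets,
  so that frames restrict.\<close>

definition frame_on :: "'p set \<Rightarrow> 'q \<Rightarrow> 'q \<Rightarrow> 'q \<Rightarrow> bool" where
  "frame_on V a b c \<longleftrightarrow> opens V \<and> a \<in> carrier (F V) \<and> b \<in> carrier (F V) \<and> c \<in> carrier (F V) \<and>
     (\<forall>W. opens W \<and> W \<subseteq> V \<longrightarrow>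
        frame_alg (Oc W) (F W) (N W) (ar V W a) (ar V W b) (ar V W c))"

lemma frame_on_subset:
  assumes "frame_on V a b c" "opens W" "W \<subseteq> V"
  shows "frame_on W (ar V W a) (ar V W b) (ar V W c)"
  using assms unfolding frame_on_def by (auto intro: ar_closed simp: ar_ar)

text \<open>Faithful flatness gives injectivity, argued point by point: the prime of
  \<open>x\<close> is the contraction of a prime \<open>I\<close> of \<open>A\<close>, and
  \<open>flat_annihilator\<close> supplies an annihilator of \<open>r\<close> that is invertible
  near \<open>x\<close>.\<close>

lemma h_zero_imp:
  assumes U: "opens U" and A: "etale_map (Oc U) A h" "surjective_on_spectra (Oc U) A h"
    and r: "r \<in> carrier (Oc U)" "h r = \<zero>\<^bsub>A\<^esub>"
  shows "r = \<zero>\<^bsub>Oc U\<^esub>"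
proof (rule rho_eq_if_locally_eq[OF U r(1)])
  interpret OU: cring "Oc U" by (rule O_cring[OF U])
  show "\<zero>\<^bsub>Oc U\<^esub> \<in> carrier (Oc U)" by simp
  fix x assume x: "x \<in> U"
  obtain I where I: "primeideal I A" "{r \<in> carrier (Oc U). \<not> germ_unit S U x r} = {r \<in> carrier (Oc U). h r \<in> I}"
    using A(2) nonunits_primeideal[OF U x]
    unfolding surjective_on_spectra_def prime_spectrum_def by blast
  obtain s where s: "s \<in> carrier (Oc U)" "h s \<notin> I" "s \<otimes>\<^bsub>Oc U\<^esub> r = \<zero>\<^bsub>Oc U\<^esub>"
    using flat_annihilator[of "Oc U" A h I r] I(1) r A(1) unfolding etale_map_def by blast
  have "germ_unit S U x s" using s I(2) by blast
  then obtain V where V: "opens V" "x \<in> V" "V \<subseteq> U" "rho U V s \<in> Units (Oc V)"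
    by (auto simp: germ_unit_def)
  interpret a: ring_hom_ring "Oc U" "Oc V" "rho U V" by (rule rho_hom[OF U V(1,3)])
  interpret OV: cring "Oc V" by (rule O_cring[OF V(1)])
  have "rho U V r \<otimes>\<^bsub>Oc V\<^esub> rho U V s = \<zero>\<^bsub>Oc V\<^esub>"
    using s r a.hom_mult[of s r] by (simp add: OV.m_comm)
  then have "rho U V r = \<zero>\<^bsub>Oc V\<^esub>"
    using OV.Units_mult_eq_zero[OF V(4)] r by simp
  then show "\<exists>V. opens V \<and> x \<in> V \<and> V \<subseteq> U \<and> rho U V r = rho U V \<zero>\<^bsub>Oc U\<^esub>"
    using V by (intro exI[of _ V]) simp
qed

text \<open>Vanishing of \<open>tau\<close> at \<open>x\<close> can be tested at a prime of
  \<open>A\<close> above it, where some triple has a value outside the prime. Exchange against a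
  local basis makes the triple, with \<open>1\<close>, a generating set, and Cayley-Hamilton follows
  over each small open set.\<close>

theorem local_frame:
  fixes A :: "'a ring"
  assumes free: "locally_free_of_rank S Q 4" and x: "x \<in> sp" "x \<in> U"
    and triv: "etale_trivialization S Q U A h \<phi>"
    and det: "\<And>y. y \<in> carrier (F U) \<Longrightarrow> det2 A (\<phi> y) = h (N U y)"
  shows "\<exists>V a b c. x \<in> V \<and> frame_on V a b c"
proof -
  have U: "opens U" using triv by (simp add: etale_trivialization_def affine_open_def)
  have et: "etale_map (Oc U) A h" "surjective_on_spectra (Oc U) A h" "splitting (Oc U) (F U) A h \<phi>"
    using triv by (auto simp: etale_trivialization_def)
  interpret U: quad_alg "Oc U" "F U" "N U" by (rule qa[OF U])
  interpret U: split_alg "Oc U" "F U" "N U" A h \<phi>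
  proof (intro split_alg.intro split_alg_axioms.intro U.quad_alg_axioms et(3) det)
    show "cring A" "h \<in> ring_hom (Oc U) A" using et(1) by (simp_all add: etale_map_def)
  qed (auto dest: h_zero_imp[OF U et(1,2)])
  interpret U: trace_alg "Oc U" "F U" "N U" by (rule U.trace_alg)
  obtain I where I: "primeideal I A"
    "{r \<in> carrier (Oc U). \<not> germ_unit S U x r} = {r \<in> carrier (Oc U). h r \<in> I}"
    using et(2) nonunits_primeideal[OF U x(2)]
    unfolding surjective_on_spectra_def prime_spectrum_def by blast
  obtain a b c where abc [simp]: "a \<in> carrier (F U)" "b \<in> carrier (F U)" "c \<in> carrier (F U)"
    and "h (U.tau a b c) \<notin> I"
    using U.ex_tau_notin_prime[OF I(1)] by blast
  then have unit: "germ_unit S U x (U.tau a b c)"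
    using I(2) U.tau_closed by blast
  have minus_unit: "germ_unit S U x (\<ominus>\<^bsub>Oc U\<^esub> U.tau a b c)"
    using unit germ_unit_mult[OF U x(2), of "\<ominus>\<^bsub>Oc U\<^esub> U.tau a b c" "\<ominus>\<^bsub>Oc U\<^esub> \<one>\<^bsub>Oc U\<^esub>"]
    by (simp add: U.R.l_minus U.R.r_minus)
  have one_comm: "P U \<one>\<^bsub>F U\<^esub> (U.comm y z) = \<zero>\<^bsub>Oc U\<^esub>" if "y \<in> carrier (F U)" "z \<in> carrier (F U)" for y z
    using that U.tau_one[of y z] U.P_sym[of "\<one>\<^bsub>F U\<^esub>" "U.comm y z"] by (simp add: U.tau_def)
  have P_comm: "P U w (U.comm y z) = U.tau y z w"
    if "y \<in> carrier (F U)" "z \<in> carrier (F U)" "w \<in> carrier (F U)" for y z w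
    using that by (simp add: U.tau_def U.P_sym)
  obtain V0 Z0 where V0: "opens V0" "x \<in> V0" "generates V0 Z0" "finite Z0" "card Z0 \<le> 4"
    using locally_free_generates[OF free x(1)] by blast
  \<comment> \<open>Each exchange tests the new section against an element orthogonal to those
    already placed: \<open>[a, b] c\<close> for \<open>1\<close>, then \<open>[b, c]\<close>,
    \<open>[c, a]\<close> and \<open>[a, b]\<close> for \<open>a\<close>, \<open>b\<close> and
    \<open>c\<close>. All four pairings are \<open>tau a b c\<close> up to sign.\<close>
  have "gen_near U x {} (Suc (Suc (Suc (Suc 0))))"
    using gen_near_subset[OF U V0 x(2)] by (simp add: numeral_eq_Suc)
  then have "gen_near U x {\<one>\<^bsub>F U\<^esub>} (Suc (Suc (Suc 0)))"
  proof (rule gen_near_insert[OF U x(2)])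
    have "P U \<one>\<^bsub>F U\<^esub> (U.comm a b \<otimes>\<^bsub>F U\<^esub> c) = \<ominus>\<^bsub>Oc U\<^esub> U.tau a b c"
      using U.tau_one[of a b] U.P_sym[of "\<one>\<^bsub>F U\<^esub>" "U.comm a b \<otimes>\<^bsub>F U\<^esub> c"]
      by (simp add: U.Tr_mult U.tau_def U.R.minus_eq)
    then show "germ_unit S U x (P U \<one>\<^bsub>F U\<^esub> (U.comm a b \<otimes>\<^bsub>F U\<^esub> c))"
      using minus_unit by simp
  qed auto
  then have "gen_near U x {a, \<one>\<^bsub>F U\<^esub>} (Suc (Suc 0))"
  proof (rule gen_near_insert[OF U x(2)])
    show "germ_unit S U x (P U a (U.comm b c))"
      using unit U.tau_cyc[of a b c] by (simp add: P_comm)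
  qed (auto simp: one_comm)
  then have "gen_near U x {b, a, \<one>\<^bsub>F U\<^esub>} (Suc 0)"
  proof (rule gen_near_insert[OF U x(2)])
    show "germ_unit S U x (P U b (U.comm c a))"
      using unit U.tau_cyc[of a b c] U.tau_cyc[of b c a] by (simp add: P_comm)
  qed (auto simp: one_comm P_comm U.tau_23 U.tau_one)
  then have "gen_near U x {c, b, a, \<one>\<^bsub>F U\<^esub>} 0"
  proof (rule gen_near_insert[OF U x(2)])
    show "germ_unit S U x (P U c (U.comm a b))"
      using unit by (simp add: P_comm)
  qed (auto simp: one_comm P_comm U.tau_23 U.tau_13 U.tau_one)
  then obtain V1 where V1: "opens V1" "x \<in> V1" "V1 \<subseteq> U" "generates V1 (ar U V1 ` {c, b, a, \<one>\<^bsub>F U\<^esub>})"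
    by (auto simp: gen_near_def)
  obtain V2 where V2: "opens V2" "x \<in> V2" "V2 \<subseteq> U" "rho U V2 (U.tau a b c) \<in> Units (Oc V2)"
    using unit by (auto simp: germ_unit_def)
  define V where "V = V1 \<inter> V2"
  have V: "opens V" "x \<in> V" "V \<subseteq> U" "V \<subseteq> V1" "V \<subseteq> V2" using V1 V2 by (auto simp: V_def)
  have "frame_alg (Oc W) (F W) (N W) (ar U W a) (ar U W b) (ar U W c)" if W: "opens W" "W \<subseteq> V" for W
  proof -
    have WU: "W \<subseteq> U" using W V by auto
    note UW = U W(1) WU
    interpret W: quad_alg "Oc W" "F W" "N W" by (rule qa[OF W(1)])
    interpret rh: ring_hom_ring "Oc U" "Oc W" "rho U W" by (rule rho_hom[OF UW])
    interpret ah: ring_hom_ring "F U" "F W" "ar U W" by (rule ar_hom_ring[OF UW])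
    let ?X = "{\<one>\<^bsub>F U\<^esub>, a, b, c}"
    have arX: "ar U W ` ?X = {\<one>\<^bsub>F W\<^esub>, ar U W a, ar U W b, ar U W c}" by simp
    have eqX: "ar V1 W ` (ar U V1 ` {c, b, a, \<one>\<^bsub>F U\<^esub>}) = ar U W ` ?X"
      using U V1 V W by (auto simp: ar_ar)
    have WV1: "opens W \<and> W \<subseteq> V1" using W V by auto
    from V1(4) have "opens W \<and> W \<subseteq> V1 \<longrightarrow>
        carrier (F W) \<subseteq> lspan (Oc W) (F W) (ar V1 W ` (ar U V1 ` {c, b, a, \<one>\<^bsub>F U\<^esub>}))"
      unfolding generates_def by (elim conjE) (rule spec)
    from mp[OF this WV1] have span: "carrier (F W) \<subseteq> lspan (Oc W) (F W) (ar U W ` ?X)"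
      unfolding eqX .
    have XU: "?X \<subseteq> carrier (F U)" by simp
    have preX: "\<exists>y'. y = ar U W y' \<and> y' \<in> carrier (F U)" if "y \<in> ar U W ` ?X" for y
      using that XU by blast
    have Xc: "ar U W ` ?X \<subseteq> carrier (F W)" by auto
    have Tr: "W.Tr (ar U W y) = rho U W (U.Tr y)" if "y \<in> carrier (F U)" for y
      using ar_P[OF UW that, of "\<one>\<^bsub>F U\<^esub>"] by simp
    interpret W: trace_alg "Oc W" "F W" "N W"
    proof (rule W.trace_algI[OF _ Xc span])
      show "N W \<one>\<^bsub>F W\<^esub> = \<one>\<^bsub>Oc W\<^esub>"
        using ar_N[OF UW U.B.one_closed] U.N_one by simp
      fix y z assume yz: "y \<in> ar U W ` ?X" "z \<in> ar U W ` ?X"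
      obtain y' where y': "y = ar U W y'" "y' \<in> carrier (F U)" using preX[OF yz(1)] by blast
      obtain z' where z': "z = ar U W z'" "z' \<in> carrier (F U)" using preX[OF yz(2)] by blast
      have "W.P y z = rho U W (U.P y' z')"
        using y' z' by (simp add: ar_P[OF UW])
      also have "\<dots> = W.Tr y \<otimes>\<^bsub>Oc W\<^esub> W.Tr z \<ominus>\<^bsub>Oc W\<^esub> W.Tr (y \<otimes>\<^bsub>F W\<^esub> z)"
        using y' z' U.trace_mult[of y' z'] Tr[of "y' \<otimes>\<^bsub>F U\<^esub> z'"] by (simp add: rho_diff[OF UW] Tr)
      finally show "W.P y z = W.Tr y \<otimes>\<^bsub>Oc W\<^esub> W.Tr z \<ominus>\<^bsub>Oc W\<^esub> W.Tr (y \<otimes>\<^bsub>F W\<^esub> z)" .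
    qed
    have tau_W: "W.tau (ar U W a) (ar U W b) (ar U W c) \<in> Units (Oc W)"
    proof -
      have "rho V2 W (rho U V2 (U.tau a b c)) \<in> Units (Oc W)"
        using V2 V W by (intro rho_Units[of V2 W]) auto
      then show ?thesis using V2 V W UW by (simp add: ar_tau rho_rho)
    qed
    interpret W: frame_trace_alg "Oc W" "F W" "N W" "ar U W a" "ar U W b" "ar U W c"
    proof
      fix w assume "w \<in> carrier (F W)"
      then show "\<exists>r0\<in>carrier (Oc W). \<exists>r1\<in>carrier (Oc W). \<exists>r2\<in>carrier (Oc W). \<exists>r3\<in>carrier (Oc W).
          w = r0 \<odot>\<^bsub>F W\<^esub> \<one>\<^bsub>F W\<^esub> \<oplus>\<^bsub>F W\<^esub> (r1 \<odot>\<^bsub>F W\<^esub> ar U W a \<oplus>\<^bsub>F W\<^esub>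
            (r2 \<odot>\<^bsub>F W\<^esub> ar U W b \<oplus>\<^bsub>F W\<^esub> r3 \<odot>\<^bsub>F W\<^esub> ar U W c))"
        using span unfolding arX by (intro W.lspan_four) auto
    qed (use tau_W in auto)
    \<comment> \<open>Sections with the same matrix have restrictions with the same pairings against
      the frame, hence equal restrictions. This brings Cayley-Hamilton down from the
      matrices.\<close>
    have eq: "ar U W p = ar U W q"
      if pq: "p \<in> carrier (F U)" "q \<in> carrier (F U)" "\<phi> p = \<phi> q" for p q
    proof -
      have orth: "W.P (ar U W p \<ominus>\<^bsub>F W\<^esub> ar U W q) (ar U W y) = \<zero>\<^bsub>Oc W\<^esub>" if "y \<in> carrier (F U)" for y
        using pq that U.\<phi>_eq_imp_P_eq[OF pq that] by (simp add: ar_P[OF UW] W.R.diff_self)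
      have "ar U W p \<ominus>\<^bsub>F W\<^esub> ar U W q = \<zero>\<^bsub>F W\<^esub>"
        using pq orth[of "\<one>\<^bsub>F U\<^esub>"] orth[of a] orth[of b] orth[of c] by - (rule W.nondegenerate; simp)
      then show ?thesis using pq by (simp add: W.B.diff_eq_eq)
    qed
    interpret W: ch_alg "Oc W" "F W" "N W"
    proof (rule W.ch_algI[OF Xc span])
      fix y assume "y \<in> ar U W ` ?X"
      then obtain y' where y': "y = ar U W y'" "y' \<in> carrier (F U)" using preX by blast
      show "y \<otimes>\<^bsub>F W\<^esub> y \<oplus>\<^bsub>F W\<^esub> N W y \<odot>\<^bsub>F W\<^esub> \<one>\<^bsub>F W\<^esub> = W.Tr y \<odot>\<^bsub>F W\<^esub> y"
        using eq[OF _ _ U.\<phi>_CH[OF y'(2)]] y' by (simp add: ar_smult[OF UW] ar_N[OF UW] Tr)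
      fix z assume "z \<in> ar U W ` ?X"
      then obtain z' where z': "z = ar U W z'" "z' \<in> carrier (F U)" using preX by blast
      show "y \<otimes>\<^bsub>F W\<^esub> z \<oplus>\<^bsub>F W\<^esub> (W.P y z \<odot>\<^bsub>F W\<^esub> \<one>\<^bsub>F W\<^esub> \<oplus>\<^bsub>F W\<^esub> z \<otimes>\<^bsub>F W\<^esub> y) =
          W.Tr y \<odot>\<^bsub>F W\<^esub> z \<oplus>\<^bsub>F W\<^esub> W.Tr z \<odot>\<^bsub>F W\<^esub> y"
        using eq[OF _ _ U.\<phi>_CH_linear[OF y'(2) z'(2)]] y' z'
        by (simp add: ar_smult[OF UW] ar_P[OF UW] Tr)
    qed
    show ?thesis by unfold_locales
  qed
  then have "frame_on V (ar U V a) (ar U V b) (ar U V c)"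
    unfolding frame_on_def using U V by (auto simp: ar_ar ar_closed)
  then show ?thesis using V by blast
qed

end

section \<open>Gluing\<close>

locale algebra_iso =
  fixes S :: "('p, 'r) ringed_space" and Q :: "('p, 'r, 'q) alg_sheaf" and Q' :: "('p, 'r, 'q2) alg_sheaf"
    and f :: "'p set \<Rightarrow> 'q \<Rightarrow> 'q2"
  assumes iso: "\<And>U. openin (rs_top S) U \<Longrightarrow> f U \<in> ring_iso (al_sec Q U) (al_sec Q' U)"
    and smult: "\<And>U a x. openin (rs_top S) U \<Longrightarrow> a \<in> carrier (rs_sec S U) \<Longrightarrow> x \<in> carrier (al_sec Q U) \<Longrightarrow>
      f U (a \<odot>\<^bsub>al_sec Q U\<^esub> x) = a \<odot>\<^bsub>al_sec Q' U\<^esub> f U x"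
    and nat: "\<And>U V x. openin (rs_top S) U \<Longrightarrow> openin (rs_top S) V \<Longrightarrow> V \<subseteq> U \<Longrightarrow>
      x \<in> carrier (al_sec Q U) \<Longrightarrow> f V (al_res Q U V x) = al_res Q' U V (f U x)"

lemma algebra_isomorphic_iff: "algebra_isomorphic S Q Q' \<longleftrightarrow> (\<exists>f. algebra_iso S Q Q' f)"
  unfolding algebra_isomorphic_def algebra_iso_def
  by (intro arg_cong[where f = Ex] ext iffI; elim conjE; intro conjI allI ballI impI; simp)

lemma algebra_isomorphic_sym:
  assumes Q: "\<And>U. openin (rs_top S) U \<Longrightarrow> assoc_algebra (rs_sec S U) (al_sec Q U)"
    and res: "\<And>U V x. openin (rs_top S) U \<Longrightarrow> openin (rs_top S) V \<Longrightarrow> V \<subseteq> U \<Longrightarrow>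
      x \<in> carrier (al_sec Q U) \<Longrightarrow> al_res Q U V x \<in> carrier (al_sec Q V)"
    and "algebra_isomorphic S Q Q'"
  shows "algebra_isomorphic S Q' Q"
proof -
  obtain f where "algebra_iso S Q Q' f"
    using assms(3) algebra_isomorphic_iff by blast
  then interpret algebra_iso S Q Q' f .
  define k where "k U = inv_into (carrier (al_sec Q U)) (f U)" for U
  have bij: "bij_betw (f U) (carrier (al_sec Q U)) (carrier (al_sec Q' U))" if "openin (rs_top S) U" for U
    using iso[OF that] by (simp add: ring_iso_def)
  have kf: "k U (f U x) = x" if "openin (rs_top S) U" "x \<in> carrier (al_sec Q U)" for U x
    unfolding k_def using bij_betw_inv_into_left[OF bij[OF that(1)] that(2)] .
  have ex: "\<exists>x\<in>carrier (al_sec Q U). y = f U x" if "openin (rs_top S) U" "y \<in> carrier (al_sec Q' U)" for U y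
    using bij_betw_imp_surj_on[OF bij[OF that(1)]] that(2) by blast
  have "k U \<in> ring_iso (al_sec Q' U) (al_sec Q U)" if "openin (rs_top S) U" for U
    unfolding k_def using iso[OF that] Q[OF that] by (intro ring_iso_set_sym) (simp_all add: assoc_algebra_def)
  moreover have "k U (a \<odot>\<^bsub>al_sec Q' U\<^esub> y) = a \<odot>\<^bsub>al_sec Q U\<^esub> k U y"
    if U: "openin (rs_top S) U" and a: "a \<in> carrier (rs_sec S U)" and y: "y \<in> carrier (al_sec Q' U)" for U a y
  proof -
    obtain x where x: "x \<in> carrier (al_sec Q U)" "y = f U x" using ex[OF U y] by blast
    interpret M: module "rs_sec S U" "al_sec Q U" using Q[OF U] by (simp add: assoc_algebra_def)
    show ?thesis
      using x a U kf[OF U, of "a \<odot>\<^bsub>al_sec Q U\<^esub> x"] by (simp add: smult kf)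
  qed
  moreover have "k V (al_res Q' U V y) = al_res Q U V (k U y)"
    if U: "openin (rs_top S) U" and V: "openin (rs_top S) V" "V \<subseteq> U" and y: "y \<in> carrier (al_sec Q' U)" for U V y
  proof -
    obtain x where x: "x \<in> carrier (al_sec Q U)" "y = f U x" using ex[OF U y] by blast
    then show ?thesis
      using U V nat[OF U V x(1)] kf[OF V(1) res[OF U V x(1)]] by (simp add: kf)
  qed
  ultimately show ?thesis
    unfolding algebra_isomorphic_def by (intro exI[of _ k]) simp
qed

section \<open>Sheaves of algebras with local frames\<close>

locale framed_sheaf = norm_sheaf +
  assumes frames: "\<And>x. x \<in> sp \<Longrightarrow> \<exists>V a b c. x \<in> V \<and> frame_on V a b c"
begin

lemma frame_near:
  assumes "opens U" "x \<in> U"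
  shows "\<exists>V a b c. x \<in> V \<and> V \<subseteq> U \<and> frame_on V a b c"
proof -
  have "x \<in> sp" using assms openin_subset by blast
  then obtain V a b c where V: "x \<in> V" "frame_on V a b c" using frames by blast
  then have "opens V" by (simp add: frame_on_def)
  then have "frame_on (U \<inter> V) (ar V (U \<inter> V) a) (ar V (U \<inter> V) b) (ar V (U \<inter> V) c)"
    using assms by (intro frame_on_subset[OF V(2)]) auto
  then show ?thesis using V(1) assms(2) by blast
qed

lemma frame_onD:
  assumes "frame_on V a b c"
  shows "opens V" and "frame_alg (Oc V) (F V) (N V) a b c"
proof -
  show V: "opens V" using assms by (simp add: frame_on_def)
  have "frame_alg (Oc V) (F V) (N V) (ar V V a) (ar V V b) (ar V V c)"
    using assms V unfolding frame_on_def by blast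
  then show "frame_alg (Oc V) (F V) (N V) a b c"
    using assms by (simp add: frame_on_def ar_id)
qed

text \<open>The axioms are identities between sections and can be checked on a cover by frame
  domains, so they hold even over open sets without a frame.\<close>

lemma ch_alg_sections:
  assumes U: "opens U"
  shows "ch_alg (Oc U) (F U) (N U)"
proof -
  interpret U: quad_alg "Oc U" "F U" "N U" by (rule qa[OF U])
  have near: "\<exists>V. opens V \<and> x \<in> V \<and> V \<subseteq> U \<and> ch_alg (Oc V) (F V) (N V)" if "x \<in> U" for x
    using frame_near[OF U that] frame_onD frame_alg.axioms(2) by metis
  have Tr: "P V (ar U V y) \<one>\<^bsub>F V\<^esub> = rho U V (U.Tr y)"
    if "opens V" "V \<subseteq> U" "y \<in> carrier (F U)" for V y
    using ar_P[OF U that, of "\<one>\<^bsub>F U\<^esub>"] ring_hom_one[OF ar_hom[OF U that(1,2)]] by simp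
  show ?thesis
  proof
    show "N U \<one>\<^bsub>F U\<^esub> = \<one>\<^bsub>Oc U\<^esub>"
    proof (rule rho_eq_if_locally_eq[OF U])
      fix p assume "p \<in> U"
      then obtain V where V: "opens V" "p \<in> V" "V \<subseteq> U" "ch_alg (Oc V) (F V) (N V)" using near by blast
      interpret V: ch_alg "Oc V" "F V" "N V" by (rule V(4))
      interpret rh: ring_hom_ring "Oc U" "Oc V" "rho U V" by (rule rho_hom[OF U V(1,3)])
      interpret ah: ring_hom_ring "F U" "F V" "ar U V" by (rule ar_hom_ring[OF U V(1,3)])
      have "rho U V (N U \<one>\<^bsub>F U\<^esub>) = rho U V \<one>\<^bsub>Oc U\<^esub>"
        using ar_N[OF U V(1,3) U.B.one_closed] V.N_one by simp
      then show "\<exists>V. opens V \<and> p \<in> V \<and> V \<subseteq> U \<and> rho U V (N U \<one>\<^bsub>F U\<^esub>) = rho U V \<one>\<^bsub>Oc U\<^esub>"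
        using V by blast
    qed auto
  next
    fix x y assume xy: "x \<in> carrier (F U)" "y \<in> carrier (F U)"
    let ?r = "U.Tr x \<otimes>\<^bsub>Oc U\<^esub> U.Tr y \<ominus>\<^bsub>Oc U\<^esub> U.Tr (x \<otimes>\<^bsub>F U\<^esub> y)"
    show "U.P x y = ?r"
    proof (rule rho_eq_if_locally_eq[OF U])
      fix p assume "p \<in> U"
      then obtain V where V: "opens V" "p \<in> V" "V \<subseteq> U" "ch_alg (Oc V) (F V) (N V)" using near by blast
      interpret V: ch_alg "Oc V" "F V" "N V" by (rule V(4))
      interpret rh: ring_hom_ring "Oc U" "Oc V" "rho U V" by (rule rho_hom[OF U V(1,3)])
      interpret ah: ring_hom_ring "F U" "F V" "ar U V" by (rule ar_hom_ring[OF U V(1,3)])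
      have "rho U V (U.P x y) = rho U V ?r"
        using xy V.trace_mult[of "ar U V x" "ar U V y"] Tr[OF V(1,3), of "x \<otimes>\<^bsub>F U\<^esub> y"]
        by (simp add: ar_P[OF U V(1,3)] rho_diff[OF U V(1,3)] Tr[OF V(1,3)])
      then show "\<exists>V. opens V \<and> p \<in> V \<and> V \<subseteq> U \<and> rho U V (U.P x y) = rho U V ?r"
        using V by blast
    qed (use xy in auto)
  next
    fix x assume x: "x \<in> carrier (F U)"
    let ?r = "U.Tr x \<odot>\<^bsub>F U\<^esub> x \<ominus>\<^bsub>F U\<^esub> N U x \<odot>\<^bsub>F U\<^esub> \<one>\<^bsub>F U\<^esub>"
    show "x \<otimes>\<^bsub>F U\<^esub> x = ?r"
    proof (rule eq_if_locally_eq[OF U])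
      fix p assume "p \<in> U"
      then obtain V where V: "opens V" "p \<in> V" "V \<subseteq> U" "ch_alg (Oc V) (F V) (N V)" using near by blast
      interpret V: ch_alg "Oc V" "F V" "N V" by (rule V(4))
      interpret ah: ring_hom_ring "F U" "F V" "ar U V" by (rule ar_hom_ring[OF U V(1,3)])
      have "ar U V (x \<otimes>\<^bsub>F U\<^esub> x) = ar U V ?r"
        using x V.CH[of "ar U V x"]
        by (simp add: ar_diff[OF U V(1,3)] ar_smult[OF U V(1,3)] ar_N[OF U V(1,3)] Tr[OF V(1,3)])
      then show "\<exists>V. opens V \<and> p \<in> V \<and> V \<subseteq> U \<and> ar U V (x \<otimes>\<^bsub>F U\<^esub> x) = ar U V ?r"
        using V by blast
    qed (use x in auto)
  qed
qed

end

locale framed_pair = Q: framed_sheaf S Q N + Q': framed_sheaf S Q' N'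
  for S :: "('p, 'r) ringed_space" and Q :: "('p, 'r, 'q) alg_sheaf" and N
    and Q' :: "('p, 'r, 'q2) alg_sheaf" and N'
begin

text \<open>Equality of norms is local, so it is checked on frame domains of \<open>Q'\<close>,
  where \<open>norm_of_isomorphism\<close> applies.\<close>

lemma isometric_if_isomorphic:
  assumes "algebra_isomorphic S Q Q'"
  shows "isometric S Q N Q' N'"
proof -
  obtain f where "algebra_iso S Q Q' f"
    using assms algebra_isomorphic_iff by blast
  then interpret f: algebra_iso S Q Q' f .
  note iso = f.iso and smult = f.smult and nat = f.nat
  have hom: "f U \<in> ring_hom (Q.F U) (Q'.F U)" if "Q.opens U" for U
    using iso[OF that] by (simp add: ring_iso_def)
  have norm: "N' U (f U x) = N U x" if U: "Q.opens U" and x: "x \<in> carrier (Q.F U)" for U x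
  proof (rule Q.rho_eq_if_locally_eq[OF U])
    interpret QU: quad_alg "Q.Oc U" "Q.F U" "N U" by (rule Q.qa[OF U])
    interpret QU': quad_alg "Q.Oc U" "Q'.F U" "N' U" by (rule Q'.qa[OF U])
    have fx: "f U x \<in> carrier (Q'.F U)" using ring_hom_closed[OF hom[OF U] x] .
    then show "N' U (f U x) \<in> carrier (Q.Oc U)" "N U x \<in> carrier (Q.Oc U)" using x by simp_all
    fix p assume p: "p \<in> U"
    obtain V a b c where V: "p \<in> V" "V \<subseteq> U" "Q'.frame_on V a b c"
      using Q'.frame_near[OF U p] by (elim exE conjE) (rule that)
    note oV = Q'.frame_onD(1)[OF V(3)]
    interpret V: frame_alg "Q.Oc V" "Q'.F V" "N' V" a b c by (rule Q'.frame_onD(2)[OF V(3)])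
    have "N' V (f V (Q.ar U V x)) = N V (Q.ar U V x)"
      by (rule V.norm_of_isomorphism[OF Q.ch_alg_sections[OF oV] iso[OF oV]])
        (use smult[OF oV] Q.ar_closed[OF U oV V(2) x] in auto)
    then have "Q.rho U V (N' U (f U x)) = Q.rho U V (N U x)"
      using Q.ar_N[OF U oV V(2) x] Q'.ar_N[OF U oV V(2) fx] nat[OF U oV V(2) x] by simp
    then show "\<exists>V. Q.opens V \<and> p \<in> V \<and> V \<subseteq> U \<and> Q.rho U V (N' U (f U x)) = Q.rho U V (N U x)"
      using V oV by blast
  qed
  show ?thesis
    unfolding isometric_def
    by (rule exI[of _ f]) (use iso hom smult nat norm in \<open>auto simp: ring_iso_def ring_hom_add\<close>)
qed

end

section \<open>From an isometry of sheaves to an isomorphism of algebras\<close>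

locale sheaf_isometry = framed_pair S Q N Q' N'
  for S :: "('p, 'r) ringed_space" and Q :: "('p, 'r, 'q) alg_sheaf" and N
    and Q' :: "('p, 'r, 'q2) alg_sheaf" and N' +
  fixes f :: "'p set \<Rightarrow> 'q \<Rightarrow> 'q2"
  assumes f_bij: "\<And>U. openin (rs_top S) U \<Longrightarrow> bij_betw (f U) (carrier (al_sec Q U)) (carrier (al_sec Q' U))"
    and f_add: "\<And>U x y. openin (rs_top S) U \<Longrightarrow> x \<in> carrier (al_sec Q U) \<Longrightarrow> y \<in> carrier (al_sec Q U) \<Longrightarrow>
      f U (x \<oplus>\<^bsub>al_sec Q U\<^esub> y) = f U x \<oplus>\<^bsub>al_sec Q' U\<^esub> f U y"
    and f_smult: "\<And>U a x. openin (rs_top S) U \<Longrightarrow> a \<in> carrier (rs_sec S U) \<Longrightarrow> x \<in> carrier (al_sec Q U) \<Longrightarrow>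
      f U (a \<odot>\<^bsub>al_sec Q U\<^esub> x) = a \<odot>\<^bsub>al_sec Q' U\<^esub> f U x"
    and f_norm: "\<And>U x. openin (rs_top S) U \<Longrightarrow> x \<in> carrier (al_sec Q U) \<Longrightarrow> N' U (f U x) = N U x"
    and f_nat: "\<And>U V x. openin (rs_top S) U \<Longrightarrow> openin (rs_top S) V \<Longrightarrow> V \<subseteq> U \<Longrightarrow>
      x \<in> carrier (al_sec Q U) \<Longrightarrow> f V (al_res Q U V x) = al_res Q' U V (f U x)"

lemma (in framed_pair) isometric_iff: "isometric S Q N Q' N' \<longleftrightarrow> (\<exists>f. sheaf_isometry S Q N Q' N' f)"
  unfolding isometric_def sheaf_isometry_def sheaf_isometry_axioms_def
  by (intro arg_cong[where f = Ex] ext iffI; elim conjE; intro conjI allI ballI impI framed_pair_axioms; simp)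

context sheaf_isometry
begin

abbreviation bar where "bar U \<equiv> quad_alg.conj (Q.Oc U) (Q'.F U) (N' U)"

definition g :: "'p set \<Rightarrow> 'q \<Rightarrow> 'q2" where
  "g U x = bar U (f U \<one>\<^bsub>Q.F U\<^esub>) \<otimes>\<^bsub>Q'.F U\<^esub> f U x"

text \<open>A version of the relation in \<open>unital_isometry\<close> that also makes sense over
  open sets without a frame.\<close>

definition splits :: "'p set \<Rightarrow> 'r \<Rightarrow> 'q \<Rightarrow> 'q \<Rightarrow> bool" where
  "splits U e x y \<longleftrightarrow> g U (x \<otimes>\<^bsub>Q.F U\<^esub> y) =
     g U y \<otimes>\<^bsub>Q'.F U\<^esub> g U x \<oplus>\<^bsub>Q'.F U\<^esub> e \<odot>\<^bsub>Q'.F U\<^esub> quad_alg.comm (Q'.F U) (g U x) (g U y)"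

lemma ch: "Q.opens U \<Longrightarrow> ch_alg (Q.Oc U) (Q.F U) (N U)" "Q.opens U \<Longrightarrow> ch_alg (Q.Oc U) (Q'.F U) (N' U)"
  by (rule Q.ch_alg_sections Q'.ch_alg_sections; assumption)+

lemma f_closed: "Q.opens U \<Longrightarrow> x \<in> carrier (Q.F U) \<Longrightarrow> f U x \<in> carrier (Q'.F U)"
  using bij_betw_apply[OF f_bij] .

lemma g_closed:
  assumes "Q.opens U" "x \<in> carrier (Q.F U)"
  shows "g U x \<in> carrier (Q'.F U)"
proof -
  interpret ch_alg "Q.Oc U" "Q.F U" "N U" by (rule ch[OF assms(1)])
  interpret U': ch_alg "Q.Oc U" "Q'.F U" "N' U" by (rule ch[OF assms(1)])
  show ?thesis using assms by (simp add: g_def f_closed)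
qed

lemma g_nat:
  assumes U: "Q.opens U" "Q.opens V" "V \<subseteq> U" and x: "x \<in> carrier (Q.F U)"
  shows "g V (Q.ar U V x) = Q'.ar U V (g U x)"
proof -
  interpret U: ch_alg "Q.Oc U" "Q.F U" "N U" by (rule ch[OF U(1)])
  interpret U': ch_alg "Q.Oc U" "Q'.F U" "N' U" by (rule ch[OF U(1)])
  have one: "f V \<one>\<^bsub>Q.F V\<^esub> = Q'.ar U V (f U \<one>\<^bsub>Q.F U\<^esub>)"
    using f_nat[OF U U.B.one_closed] ring_hom_one[OF Q.ar_hom[OF U]] by simp
  have "bar V (f V \<one>\<^bsub>Q.F V\<^esub>) = Q'.ar U V (bar U (f U \<one>\<^bsub>Q.F U\<^esub>))"
    unfolding one using Q'.ar_conj[OF U f_closed[OF U(1) U.B.one_closed]] .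
  then show ?thesis
    using x U ring_hom_mult[OF Q'.ar_hom[OF U], of "bar U (f U \<one>\<^bsub>Q.F U\<^esub>)" "f U x"]
    by (simp add: g_def f_nat f_closed)
qed

lemma splits_rho:
  assumes U: "Q.opens U" "Q.opens V" "V \<subseteq> U" and e: "e \<in> carrier (Q.Oc U)"
    and xy: "x \<in> carrier (Q.F U)" "y \<in> carrier (Q.F U)" and s: "splits U e x y"
  shows "splits V (Q.rho U V e) (Q.ar U V x) (Q.ar U V y)"
proof -
  interpret U: ch_alg "Q.Oc U" "Q.F U" "N U" by (rule ch[OF U(1)])
  interpret U': ch_alg "Q.Oc U" "Q'.F U" "N' U" by (rule ch[OF U(1)])
  interpret a: ring_hom_ring "Q.F U" "Q.F V" "Q.ar U V" by (rule Q.ar_hom_ring[OF U])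
  interpret a': ring_hom_ring "Q'.F U" "Q'.F V" "Q'.ar U V" by (rule Q'.ar_hom_ring[OF U])
  note gc = g_closed[OF U(1) xy(1)] g_closed[OF U(1) xy(2)]
  have "g V (Q.ar U V x \<otimes>\<^bsub>Q.F V\<^esub> Q.ar U V y) = Q'.ar U V (g U (x \<otimes>\<^bsub>Q.F U\<^esub> y))"
    using g_nat[OF U, of "x \<otimes>\<^bsub>Q.F U\<^esub> y"] xy by simp
  also have "\<dots> = Q'.ar U V (g U y) \<otimes>\<^bsub>Q'.F V\<^esub> Q'.ar U V (g U x) \<oplus>\<^bsub>Q'.F V\<^esub>
      Q.rho U V e \<odot>\<^bsub>Q'.F V\<^esub> Q'.ar U V (U'.comm (g U x) (g U y))"
    using s gc e unfolding splits_def by (simp add: Q'.ar_smult[OF U])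
  finally show ?thesis
    unfolding splits_def by (simp add: g_nat[OF U] xy Q'.ar_comm[OF U] gc)
qed

lemma isometry_on_frame:
  assumes "Q'.frame_on U a b c"
  shows "isometry (Q.Oc U) (Q.F U) (N U) (Q'.F U) (N' U) a b c (f U)"
proof -
  note U = Q'.frame_onD[OF assms]
  interpret U: ch_alg "Q.Oc U" "Q.F U" "N U" by (rule ch[OF U(1)])
  interpret U': frame_alg "Q.Oc U" "Q'.F U" "N' U" a b c by (rule U(2))
  show ?thesis
    by unfold_locales (use U(1) in \<open>auto simp: f_bij f_add f_smult f_norm\<close>)
qed

text \<open>Quantifying over sections on all smaller open sets makes the property stable under
  restriction, as sections over \<open>V\<close> need not come from \<open>U\<close>.\<close>

definition mixing :: "'p set \<Rightarrow> 'r \<Rightarrow> bool" where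
  "mixing U e \<longleftrightarrow> e \<in> carrier (Q.Oc U) \<and>
     (\<forall>V. Q.opens V \<longrightarrow> V \<subseteq> U \<longrightarrow>
       (\<forall>x\<in>carrier (Q.F V). \<forall>y\<in>carrier (Q.F V). splits V (Q.rho U V e) x y))"

lemma mixingD: "mixing U e \<Longrightarrow> Q.opens V \<Longrightarrow> V \<subseteq> U \<Longrightarrow> x \<in> carrier (Q.F V) \<Longrightarrow> y \<in> carrier (Q.F V) \<Longrightarrow>
    splits V (Q.rho U V e) x y"
  by (simp add: mixing_def)

lemma mixing_rho:
  assumes "mixing U e" "Q.opens U" "Q.opens V" "V \<subseteq> U"
  shows "mixing V (Q.rho U V e)"
  using assms unfolding mixing_def by (auto simp: Q.rho_closed Q.rho_rho)

lemma mixing_unique: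
  assumes fr: "Q'.frame_on U a b c" and e: "mixing U e" "mixing U e'"
  shows "e = e'"
proof -
  note U = Q'.frame_onD(1)[OF fr]
  interpret I: isometry "Q.Oc U" "Q.F U" "N U" "Q'.F U" "N' U" a b c "f U" by (rule isometry_on_frame[OF fr])
  obtain x where x: "x \<in> carrier (Q.F U)" "I.g x = a" using I.unital.g_surj[OF I.Q'.a] by blast
  obtain y where y: "y \<in> carrier (Q.F U)" "I.g y = b" using I.unital.g_surj[OF I.Q'.b] by blast
  have ec: "e \<in> carrier (Q.Oc U)" "e' \<in> carrier (Q.Oc U)" using e by (auto simp: mixing_def)
  have "I.unital.splits e x y" "I.unital.splits e' x y"
    using mixingD[OF e(1) U order_refl x(1) y(1)] mixingD[OF e(2) U order_refl x(1) y(1)] ec U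
    by (simp_all add: I.unital.splits_def splits_def g_def Q.rho_id)
  then show ?thesis
    using I.unital.splits_unique[OF ec x(1) y(1) x(2) y(2)] by blast
qed

lemma mixing_idem:
  assumes fr: "Q'.frame_on U a b c" and e: "mixing U e"
  shows "e \<otimes>\<^bsub>Q.Oc U\<^esub> e = e"
proof -
  note U = Q'.frame_onD(1)[OF fr]
  interpret I: isometry "Q.Oc U" "Q.F U" "N U" "Q'.F U" "N' U" a b c "f U" by (rule isometry_on_frame[OF fr])
  have ec: "e \<in> carrier (Q.Oc U)" using e by (auto simp: mixing_def)
  have "I.unital.splits e x y" if "x \<in> carrier (Q.F U)" "y \<in> carrier (Q.F U)" for x y
    using mixingD[OF e U order_refl that] ec U by (simp add: I.unital.splits_def splits_def g_def Q.rho_id)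
  then show ?thesis by (rule I.unital.splits_idem[OF ec])
qed

text \<open>The scalar found over a smaller \<open>V\<close> could a priori differ from the
  restriction of the one over \<open>U\<close>. Both satisfy the relation on the restricted
  preimages of \<open>a\<close> and \<open>b\<close>, and this pair determines the scalar.\<close>

lemma ex_mixing:
  assumes fr: "Q'.frame_on U a b c"
  shows "\<exists>e. mixing U e"
proof -
  note U = Q'.frame_onD(1)[OF fr]
  interpret I: isometry "Q.Oc U" "Q.F U" "N U" "Q'.F U" "N' U" a b c "f U" by (rule isometry_on_frame[OF fr])
  obtain e where e: "e \<in> carrier (Q.Oc U)"
    and split_e: "\<And>x y. x \<in> carrier (Q.F U) \<Longrightarrow> y \<in> carrier (Q.F U) \<Longrightarrow> splits U e x y"
    using I.unital.ex_splits unfolding I.unital.splits_def splits_def g_def by blast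
  obtain p where p: "p \<in> carrier (Q.F U)" "g U p = a"
    using I.unital.g_surj[OF I.Q'.a] unfolding g_def by blast
  obtain q where q: "q \<in> carrier (Q.F U)" "g U q = b"
    using I.unital.g_surj[OF I.Q'.b] unfolding g_def by blast
  have "splits V (Q.rho U V e) x y"
    if V: "Q.opens V" "V \<subseteq> U" and xy: "x \<in> carrier (Q.F V)" "y \<in> carrier (Q.F V)" for V x y
  proof -
    interpret J: isometry "Q.Oc V" "Q.F V" "N V" "Q'.F V" "N' V" "Q'.ar U V a" "Q'.ar U V b" "Q'.ar U V c" "f V"
      by (rule isometry_on_frame[OF Q'.frame_on_subset[OF fr V]])
    obtain e' where e': "e' \<in> carrier (Q.Oc V)"
      and split_e': "\<And>x y. x \<in> carrier (Q.F V) \<Longrightarrow> y \<in> carrier (Q.F V) \<Longrightarrow> J.unital.splits e' x y"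
      using J.unital.ex_splits by blast
    have J: "J.unital.splits k x y \<longleftrightarrow> splits V k x y" for k x y
      by (simp add: J.unital.splits_def splits_def g_def)
    have pq: "Q.ar U V p \<in> carrier (Q.F V)" "Q.ar U V q \<in> carrier (Q.F V)"
      using p q U V by (auto intro: Q.ar_closed)
    have "Q.rho U V e = e'"
    proof (rule J.unital.splits_unique[OF _ e' pq])
      show "Q.rho U V e \<in> carrier (Q.Oc V)" using U V e by (intro Q.rho_closed)
      show "J.g (Q.ar U V p) = Q'.ar U V a" "J.g (Q.ar U V q) = Q'.ar U V b"
        using g_nat[OF U V p(1)] g_nat[OF U V q(1)] p q by (simp_all add: g_def)
      show "J.unital.splits (Q.rho U V e) (Q.ar U V p) (Q.ar U V q)"
        unfolding J using splits_rho[OF U V e p(1) q(1) split_e[OF p(1) q(1)]] .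
      show "J.unital.splits e' (Q.ar U V p) (Q.ar U V q)" by (rule split_e'[OF pq])
    qed
    then show ?thesis using split_e'[OF xy] unfolding J by simp
  qed
  then show ?thesis using e unfolding mixing_def by blast
qed

lemma ex_global_mixing:
  "\<exists>e\<in>carrier (Q.Oc Q.sp). \<forall>U. Q.opens U \<longrightarrow> mixing U (Q.rho Q.sp U e) \<and>
     Q.rho Q.sp U e \<otimes>\<^bsub>Q.Oc U\<^esub> Q.rho Q.sp U e = Q.rho Q.sp U e"
proof -
  \<comment> \<open>The cover consists of all frame domains. Open subsets of frame domains are frame
    domains, so uniqueness applies on overlaps.\<close>
  define \<U> where "\<U> = {U. \<exists>a b c. Q'.frame_on U a b c}"
  define k where "k U = (SOME e. mixing U e)" for U
  have k: "mixing U (k U)" if "U \<in> \<U>" for U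
  proof -
    have "\<exists>e. mixing U e" using that ex_mixing unfolding \<U>_def by blast
    then show ?thesis unfolding k_def by (rule someI_ex)
  qed
  have kc: "k U \<in> carrier (Q.Oc U)" if "U \<in> \<U>" for U
    using k[OF that] by (simp add: mixing_def)
  have \<U>_open: "Q.opens U" if "U \<in> \<U>" for U
    using that Q'.frame_onD(1) unfolding \<U>_def by blast
  have compat: "Q.rho U (U \<inter> V) (k U) = Q.rho V (U \<inter> V) (k V)" if UV: "U \<in> \<U>" "V \<in> \<U>" for U V
  proof -
    obtain a b c where fr: "Q'.frame_on U a b c" using UV unfolding \<U>_def by blast
    have I: "Q.opens (U \<inter> V)" "U \<inter> V \<subseteq> U" "U \<inter> V \<subseteq> V" using \<U>_open UV by auto
    show ?thesis
      by (rule mixing_unique[OF Q'.frame_on_subset[OF fr I(1,2)]])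
        (rule mixing_rho[OF k \<U>_open]; use UV I in simp)+
  qed
  have cover: "\<Union>\<U> = Q.sp"
  proof
    show "\<Union>\<U> \<subseteq> Q.sp" using \<U>_open openin_subset by blast
    show "Q.sp \<subseteq> \<Union>\<U>" using Q'.frames unfolding \<U>_def by blast
  qed
  obtain e where e: "e \<in> carrier (Q.Oc Q.sp)" "\<And>U. U \<in> \<U> \<Longrightarrow> Q.rho Q.sp U e = k U"
    using is_sheaf_glue[OF ringed_spaceD(1)[OF Q.ringed], of \<U> k] \<U>_open kc compat unfolding cover by blast
  have sp: "Q.opens Q.sp" by simp
  have near: "\<exists>V. Q.opens V \<and> p \<in> V \<and> V \<subseteq> U \<and> V \<in> \<U>" if U: "Q.opens U" "p \<in> U" for U p
    using Q'.frame_near[OF U] Q'.frame_onD(1) unfolding \<U>_def by blast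
  have sub: "U \<subseteq> Q.sp" if "Q.opens U" for U using openin_subset[OF that] .
  \<comment> \<open>An arbitrary open set need not carry a frame, so the relation is verified on
    members of the cover inside it.\<close>
  have split: "splits U (Q.rho Q.sp U e) x y"
    if U: "Q.opens U" and xy: "x \<in> carrier (Q.F U)" "y \<in> carrier (Q.F U)" for U x y
    unfolding splits_def
  proof (rule Q'.eq_if_locally_eq[OF U])
    let ?e = "Q.rho Q.sp U e"
    have ec: "?e \<in> carrier (Q.Oc U)" by (rule Q.rho_closed[OF sp U sub[OF U] e(1)])
    interpret U: ch_alg "Q.Oc U" "Q.F U" "N U" by (rule ch[OF U])
    interpret U': ch_alg "Q.Oc U" "Q'.F U" "N' U" by (rule ch[OF U])
    note gc = g_closed[OF U xy(1)] g_closed[OF U xy(2)]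
    let ?r = "g U y \<otimes>\<^bsub>Q'.F U\<^esub> g U x \<oplus>\<^bsub>Q'.F U\<^esub> ?e \<odot>\<^bsub>Q'.F U\<^esub> U'.comm (g U x) (g U y)"
    show "g U (x \<otimes>\<^bsub>Q.F U\<^esub> y) \<in> carrier (Q'.F U)" using xy by (intro g_closed U) simp
    show "?r \<in> carrier (Q'.F U)" using gc ec by simp
    fix p assume "p \<in> U"
    then obtain V where V: "Q.opens V" "p \<in> V" "V \<subseteq> U" "V \<in> \<U>" using near[OF U] by blast
    note UV = U V(1,3)
    interpret a: ring_hom_ring "Q.F U" "Q.F V" "Q.ar U V" by (rule Q.ar_hom_ring[OF UV])
    interpret a': ring_hom_ring "Q'.F U" "Q'.F V" "Q'.ar U V" by (rule Q'.ar_hom_ring[OF UV])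
    have eV: "Q.rho U V ?e = k V"
      using Q.rho_rho[OF sp U V(1,3) sub[OF U] e(1)] e(2)[OF V(4)] by simp
    have "splits V (Q.rho V V (k V)) (Q.ar U V x) (Q.ar U V y)"
      using mixingD[OF k[OF V(4)] V(1) order_refl] xy by simp
    then have s: "splits V (k V) (Q.ar U V x) (Q.ar U V y)"
      using Q.rho_id[OF V(1) kc[OF V(4)]] by simp
    have "Q'.ar U V (g U (x \<otimes>\<^bsub>Q.F U\<^esub> y)) = g V (Q.ar U V x \<otimes>\<^bsub>Q.F V\<^esub> Q.ar U V y)"
      using g_nat[OF UV, of "x \<otimes>\<^bsub>Q.F U\<^esub> y"] xy by simp
    also have "\<dots> = Q'.ar U V ?r"
      using s gc ec unfolding splits_def
      by (simp add: Q'.ar_smult[OF UV] eV g_nat[OF UV] xy Q'.ar_comm[OF UV])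
    finally show "\<exists>V. Q.opens V \<and> p \<in> V \<and> V \<subseteq> U \<and>
        Q'.ar U V (g U (x \<otimes>\<^bsub>Q.F U\<^esub> y)) = Q'.ar U V ?r"
      using V by blast
  qed
  have mix: "mixing U (Q.rho Q.sp U e)" if U: "Q.opens U" for U
    using split Q.rho_closed[OF sp U sub[OF U] e(1)] unfolding mixing_def
    by (simp add: Q.rho_rho[OF sp U _ _ sub[OF U] e(1)])
  have idem: "Q.rho Q.sp U e \<otimes>\<^bsub>Q.Oc U\<^esub> Q.rho Q.sp U e = Q.rho Q.sp U e" if U: "Q.opens U" for U
  proof (rule Q.rho_eq_if_locally_eq[OF U])
    let ?e = "Q.rho Q.sp U e"
    interpret O: cring "Q.Oc U" by (rule Q.O_cring[OF U])
    show ec: "?e \<in> carrier (Q.Oc U)" by (rule Q.rho_closed[OF sp U sub[OF U] e(1)])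
    then show "?e \<otimes>\<^bsub>Q.Oc U\<^esub> ?e \<in> carrier (Q.Oc U)" by simp
    fix p assume "p \<in> U"
    then obtain V where V: "Q.opens V" "p \<in> V" "V \<subseteq> U" "V \<in> \<U>" using near[OF U] by blast
    interpret a: ring_hom_ring "Q.Oc U" "Q.Oc V" "Q.rho U V" by (rule Q.rho_hom[OF U V(1,3)])
    have eV: "Q.rho U V ?e = k V"
      using Q.rho_rho[OF sp U V(1,3) sub[OF U] e(1)] e(2)[OF V(4)] by simp
    obtain a b c where "Q'.frame_on V a b c" using V(4) unfolding \<U>_def by blast
    then have "k V \<otimes>\<^bsub>Q.Oc V\<^esub> k V = k V" using mixing_idem k[OF V(4)] by blast
    then have "Q.rho U V (?e \<otimes>\<^bsub>Q.Oc U\<^esub> ?e) = Q.rho U V ?e"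
      using ec eV by simp
    then show "\<exists>V. Q.opens V \<and> p \<in> V \<and> V \<subseteq> U \<and> Q.rho U V (?e \<otimes>\<^bsub>Q.Oc U\<^esub> ?e) = Q.rho U V ?e"
      using V by blast
  qed
  show ?thesis using e(1) mix idem by blast
qed

lemma isomorphic: "algebra_isomorphic S Q Q'"
proof -
  obtain e0 where e0: "e0 \<in> carrier (Q.Oc Q.sp)"
    and mix: "\<And>U. Q.opens U \<Longrightarrow> mixing U (Q.rho Q.sp U e0)"
    and idem: "\<And>U. Q.opens U \<Longrightarrow> Q.rho Q.sp U e0 \<otimes>\<^bsub>Q.Oc U\<^esub> Q.rho Q.sp U e0 = Q.rho Q.sp U e0"
    using ex_global_mixing by blast
  define e where "e U = Q.rho Q.sp U e0" for U
  have sp: "Q.opens Q.sp" by simp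
  have sub: "U \<subseteq> Q.sp" if "Q.opens U" for U using openin_subset[OF that] .
  have ec: "e U \<in> carrier (Q.Oc U)" if "Q.opens U" for U
    unfolding e_def by (rule Q.rho_closed[OF sp that sub[OF that] e0])
  define H where "H U x = ch_alg.twist (Q.Oc U) (Q'.F U) (N' U) (e U) (g U x)" for U x
  have "algebra_iso S Q Q' H"
  proof
    fix U assume U: "Q.opens U"
    interpret U: ch_alg "Q.Oc U" "Q.F U" "N U" by (rule ch[OF U])
    interpret U': ch_alg "Q.Oc U" "Q'.F U" "N' U" by (rule ch[OF U])
    note [simp] = ec[OF U] g_closed[OF U] f_closed[OF U]
    let ?u = "f U \<one>\<^bsub>Q.F U\<^esub>"
    have u: "?u \<otimes>\<^bsub>Q'.F U\<^esub> U'.conj ?u = \<one>\<^bsub>Q'.F U\<^esub>" "U'.conj ?u \<otimes>\<^bsub>Q'.F U\<^esub> ?u = \<one>\<^bsub>Q'.F U\<^esub>"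
      by (simp_all add: U'.mult_conj U'.conj_mult_self f_norm[OF U] U.N_one)
    have "bij_betw (\<lambda>y. U'.conj ?u \<otimes>\<^bsub>Q'.F U\<^esub> y) (carrier (Q'.F U)) (carrier (Q'.F U))"
      by (rule bij_betwI[where g = "\<lambda>y. ?u \<otimes>\<^bsub>Q'.F U\<^esub> y"]) (auto simp: u simp flip: U'.B.m_assoc)
    then have g_bij: "bij_betw (g U) (carrier (Q.F U)) (carrier (Q'.F U))"
      using bij_betw_trans[OF f_bij[OF U]] unfolding g_def o_def by blast
    have eU: "e U \<otimes>\<^bsub>Q.Oc U\<^esub> e U = e U" unfolding e_def by (rule idem[OF U])
    \<comment> \<open>For an idempotent \<open>e\<close> the twist is its own inverse.\<close>
    have tw: "bij_betw (U'.twist (e U)) (carrier (Q'.F U)) (carrier (Q'.F U))"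
      by (rule bij_betwI[where g = "U'.twist (e U)"]) (auto simp: U'.twist_twist[OF ec[OF U] eU])
    have H_bij: "bij_betw (H U) (carrier (Q.F U)) (carrier (Q'.F U))"
      using bij_betw_trans[OF g_bij tw] unfolding H_def o_def .
    have g_add: "g U (x \<oplus>\<^bsub>Q.F U\<^esub> y) = g U x \<oplus>\<^bsub>Q'.F U\<^esub> g U y"
      if "x \<in> carrier (Q.F U)" "y \<in> carrier (Q.F U)" for x y
      using that by (simp add: g_def f_add[OF U] U'.B.r_distr)
    have "H U \<in> ring_hom (Q.F U) (Q'.F U)"
    proof (rule ring_hom_memI)
      fix x y assume xy: "x \<in> carrier (Q.F U)" "y \<in> carrier (Q.F U)"
      show "H U x \<in> carrier (Q'.F U)" using xy by (simp add: H_def)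
      show "H U (x \<oplus>\<^bsub>Q.F U\<^esub> y) = H U x \<oplus>\<^bsub>Q'.F U\<^esub> H U y"
        using xy by (simp add: H_def g_add U'.twist_add)
      have "splits U (Q.rho U U (e U)) x y"
        using mixingD[OF mix[OF U] U order_refl xy] unfolding e_def .
      then have "g U (x \<otimes>\<^bsub>Q.F U\<^esub> y) =
          g U y \<otimes>\<^bsub>Q'.F U\<^esub> g U x \<oplus>\<^bsub>Q'.F U\<^esub> e U \<odot>\<^bsub>Q'.F U\<^esub> U'.comm (g U x) (g U y)"
        using Q.rho_id[OF U ec[OF U]] by (simp add: splits_def)
      then show "H U (x \<otimes>\<^bsub>Q.F U\<^esub> y) = H U x \<otimes>\<^bsub>Q'.F U\<^esub> H U y"
        using xy by (simp add: H_def U'.twist_mult[OF ec[OF U] eU])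
    next
      show "H U \<one>\<^bsub>Q.F U\<^esub> = \<one>\<^bsub>Q'.F U\<^esub>"
        by (simp add: H_def g_def u U'.twist_one)
    qed
    then show "H U \<in> ring_iso (Q.F U) (Q'.F U)"
      using H_bij by (simp add: ring_iso_def)
    show "H U (a \<odot>\<^bsub>Q.F U\<^esub> x) = a \<odot>\<^bsub>Q'.F U\<^esub> H U x" if "a \<in> carrier (Q.Oc U)" "x \<in> carrier (Q.F U)" for a x
    proof -
      have "g U (a \<odot>\<^bsub>Q.F U\<^esub> x) = a \<odot>\<^bsub>Q'.F U\<^esub> g U x"
        using that by (simp add: g_def f_smult[OF U])
      then show ?thesis using that by (simp add: H_def U'.twist_smult)
    qed
    fix V x assume V: "Q.opens V" "V \<subseteq> U" and x: "x \<in> carrier (Q.F U)"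
    interpret V': ch_alg "Q.Oc V" "Q'.F V" "N' V" by (rule ch[OF V(1)])
    interpret rh: ring_hom_ring "Q.Oc U" "Q.Oc V" "Q.rho U V" by (rule Q.rho_hom[OF U V])
    interpret a': ring_hom_ring "Q'.F U" "Q'.F V" "Q'.ar U V" by (rule Q'.ar_hom_ring[OF U V])
    have eV: "Q.rho U V (e U) = e V"
      unfolding e_def by (rule Q.rho_rho[OF sp U V sub[OF U] e0])
    show "H V (Q.ar U V x) = Q'.ar U V (H U x)"
      using x by (simp add: H_def U'.twist_def V'.twist_def g_nat[OF U V] Q'.ar_smult[OF U V]
          Q'.ar_conj[OF U V] Q.rho_diff[OF U V] eV)
  qed
  then show ?thesis using algebra_isomorphic_iff by blast
qed

end

text \<open>The frame is built along the trivialization that comes with the reduced norm, because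
  there the norm is known to be the determinant.\<close>

lemma framed_sheaf_reduced_norm:
  fixes S :: "('p, 'r) ringed_space" and Q :: "('p, 'r, 'q) alg_sheaf"
  assumes S: "is_scheme S" and Q: "quaternion_algebra S Q" and N: "reduced_norm S Q N"
  shows "framed_sheaf S Q N"
proof -
  interpret norm_sheaf S Q N
    using S Q N by unfold_locales (auto simp: quaternion_algebra_def reduced_norm_def)
  show ?thesis
  proof
    fix x assume x: "x \<in> sp"
    obtain U h \<phi> and A :: "(nat multiset \<Rightarrow> 'r) set ring" where "x \<in> U"
      and "etale_trivialization S Q U A h \<phi>" "\<forall>y\<in>carrier (F U). det2 A (\<phi> y) = h (N U y)"
      using N x unfolding reduced_norm_def by blast
    then show "\<exists>V a b c. x \<in> V \<and> frame_on V a b c"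
      using Q x by (intro local_frame[of x U A h \<phi>]) (auto simp: quaternion_algebra_def)
  qed
qed

theorem theorem2p4:
  fixes S :: "('p, 'r) ringed_space"
    and Q :: "('p, 'r, 'q) alg_sheaf" and Q' :: "('p, 'r, 'q2) alg_sheaf"
    and Nrd :: "'p set \<Rightarrow> 'q \<Rightarrow> 'r" and Nrd' :: "'p set \<Rightarrow> 'q2 \<Rightarrow> 'r"
  assumes "is_scheme S"
    and "quaternion_algebra S Q" and "quaternion_algebra S Q'"
    and "reduced_norm S Q Nrd" and "reduced_norm S Q' Nrd'"
  shows "algebra_isomorphic S Q' Q \<longleftrightarrow> isometric S Q Nrd Q' Nrd'"
proof -
  interpret framed_pair S Q Nrd Q' Nrd'
    using framed_sheaf_reduced_norm[OF assms(1,2,4)] framed_sheaf_reduced_norm[OF assms(1,3,5)]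
    by (rule framed_pair.intro)
  \<comment> \<open>The isomorphism and the isometry run in opposite directions in the
    claim.\<close>
  have "algebra_isomorphic S Q' Q \<longleftrightarrow> algebra_isomorphic S Q Q'"
  proof
    show "algebra_isomorphic S Q Q'" if "algebra_isomorphic S Q' Q"
      by (rule algebra_isomorphic_sym[OF _ Q'.ar_closed that])
        (use Q'.sheaf in \<open>simp add: sheaf_of_algebras_def\<close>)
    show "algebra_isomorphic S Q' Q" if "algebra_isomorphic S Q Q'"
      by (rule algebra_isomorphic_sym[OF _ Q.ar_closed that])
        (use Q.sheaf in \<open>simp add: sheaf_of_algebras_def\<close>)
  qed
  also have "\<dots> \<longleftrightarrow> isometric S Q Nrd Q' Nrd'"
    using isometric_if_isomorphic isometric_iff sheaf_isometry.isomorphic by blast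
  finally show ?thesis .
qed

end
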